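(* Fix $q\in[0,1)$, $s\in(-1,0)$, and parameters $\theta_1,\theta_2,\dots\in[-s,-s^{-1}]$, $u_1,u_2,\dots\in[0,1)$. Consider the stochastic higher spin six vertex model on the quadrant with these parameters and with the step boundary conditions, and let $\mathfrak{h}^{\mathrm{HS}}$ be its height function. For $x,y\in\mathbb{Z}_{\ge0}$ let $\lambda^{(x,y)}$ be a random Young diagram with $$\mathrm{Prob}(\lambda^{(x,y)}=\nu)=\prod_{1\le i\le x,\ 1\le j\le y}\frac{1-u_js}{1+u_j\theta_i}\ \mathsf{F}_\nu(u_1,\dots,u_y)\,\mathbb{F}^*_{\nu'}(\theta_1,\dots,\theta_x)$$ for all Young diagrams $\nu$, where $\nu'$ is the transposed diagram. Then for any fixed $(x,y)$ in the quadrant the random variables $y-\ell(\lambda^{(x,y)})$ and $\mathfrak{h}^{\mathrm{HS}}(x+1,y)$ have the same distribution.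
   Context: $(a;q)_0=1$, $(a;q)_k=\prod_{i=1}^k(1-aq^{i-1})$. Young diagrams $\lambda=(\lambda_1\ge\lambda_2\ge\dots\ge0)$ have finitely many nonzero parts; $\ell(\lambda)$ is the number of nonzero parts; $\lambda'_j=\#\{i:\lambda_i\ge j\}$. Spin Hall-Littlewood functions: for $n\ge\ell(\lambda)$, $$\mathsf{F}_\lambda(u_1,\dots,u_n)=\frac{(1-q)^n}{(q;q)_{n-\ell(\lambda)}}\sum_{\sigma\in\mathfrak{S}_n}\sigma\Bigl\{\prod_{i<j}\frac{u_i-qu_j}{u_i-u_j}\prod_{i=1}^n\Bigl(\frac{u_i-s}{1-su_i}\Bigr)^{\lambda_i}\prod_{i=1}^{\ell(\lambda)}\frac{u_i}{u_i-s}\Bigr\}$$ ($\sigma$ permutes the indices of the $u_i$ only; at coinciding $u_i$ the value is by continuity), and $\mathsf{F}_\lambda(u_1,\dots,u_n)=0$ if $\ell(\lambda)>n$. Dual spin $q$-Whittaker polynomials: write $\mu\prec\lambda$ if $\lambda_1\ge\mu_1\ge\lambda_2\ge\mu_2\ge\cdots$. Set $\mathbb{F}^*_{\lambda/\mu}(\theta)=0$ unless $\mu\prec\lambda$, and for $\mu\prec\lambda$ $$\mathbb{F}^*_{\lambda/\mu}(\theta)=\prod_{k\ge1}\theta^{\lambda_k-\mu_k}\frac{(-s/\theta;q)_{\lambda_k-\mu_k}}{(q;q)_{\lambda_k-\mu_k}}\cdot\frac{(-s\theta;q)_{\mu_k-\lambda_{k+1}}}{(q;q)_{\mu_k-\lambda_{k+1}}}\cdot\frac{(q;q)_{\mu_k-\mu_{k+1}}}{(s^2;q)_{\mu_k-\mu_{k+1}}};$$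 $\mathbb{F}^*_{\lambda/\mu}(\theta_1,\dots,\theta_l)=\sum_\varkappa\mathbb{F}^*_{\lambda/\varkappa}(\theta_l)\mathbb{F}^*_{\varkappa/\mu}(\theta_1,\dots,\theta_{l-1})$, $\mathbb{F}^*_\lambda=\mathbb{F}^*_{\lambda/\varnothing}$; with no variables $\mathsf F_\lambda=\mathbb F^*_\lambda=\mathbf 1_{\lambda=\varnothing}$. (The displayed probabilities are nonnegative and sum to one by a Cauchy identity.) Stochastic higher spin six vertex model: a random configuration of up-right directed paths on $\mathbb{Z}_{\ge0}^2$, any number of paths per vertical edge, at most one path per horizontal edge. A vertex $(x,y)$ with $x,y\ge1$ has configuration $(i_1,j_1;i_2,j_2)$, where $i_1,j_1$ are the numbers of paths entering from below and from the left, and $i_2,j_2$ the numbers of paths exiting to the top and to the right. Given $(i_1,j_1)$, the pair $(i_2,j_2)$ is chosen with probability $\mathcal{L}_{u_y,\theta_x}(i_1,j_1;i_2,j_2)$, where for $g\in\mathbb{Z}_{\ge0}$ $$\mathcal{L}_{u,\theta}(g,0;g,0)=\frac{q^g+u\theta}{1+u\theta},\quad \mathcal{L}_{u,\theta}(g,0;g-1,1)=\frac{1-q^g}{1+u\theta},\quad \mathcal{L}_{u,\theta}(g,1;g,1)=\frac{1-usq^g}{1+u\theta},\quad \mathcal{L}_{u,\theta}(g,1;g+1,0)=\frac{u(\theta+sq^g)}{1+u\theta},$$ all other weights being $0$; choices are made sequentially in $x+y$, independently for different vertices given their inputs. Step boundary conditions: a path enters horizontally from $(0,y)$ to $(1,y)$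 for every $y\ge1$, and no paths enter from the bottom boundary. The height function $\mathfrak{h}^{\mathrm{HS}}(x+1,y)$ is the number of paths which go through or to the right of the point $(x+1,y)$, i.e. the number of $k\in\{1,\dots,y\}$ such that the horizontal edge from $(x,k)$ to $(x+1,k)$ is occupied. *)

theory Defs
  imports "HOL-Probability.Probability" "HOL-Combinatorics.Permutations"
begin

definition qpochhammer :: "real \<Rightarrow> real \<Rightarrow> nat \<Rightarrow> real" where
  "qpochhammer a q k = (\<Prod>i=1..k. 1 - a * q ^ (i - 1))"


section \<open>Young diagrams\<close>

text \<open>A Young diagram is its sequence of parts, indexed from 0: the value of the function at \<open>i\<close>
  is the part \<open>\<lambda>\<^sub>i\<^sub>+\<^sub>1\<close> of the mathematical notation.\<close>

definition young_diagrams :: "(nat \<Rightarrow> nat) set" where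
  "young_diagrams = {lam. antimono lam \<and> finite {i. lam i \<noteq> 0}}"

definition ell :: "(nat \<Rightarrow> nat) \<Rightarrow> nat" where
  "ell lam = card {i. lam i \<noteq> 0}"

definition transposed :: "(nat \<Rightarrow> nat) \<Rightarrow> nat \<Rightarrow> nat" where
  "transposed lam = (\<lambda>j. card {i. lam i \<ge> Suc j})"

definition interlaces :: "(nat \<Rightarrow> nat) \<Rightarrow> (nat \<Rightarrow> nat) \<Rightarrow> bool" where
  "interlaces mu lam \<longleftrightarrow> (\<forall>i. mu i \<le> lam i \<and> lam (Suc i) \<le> mu i)"

lemma finite_interlaces:
  assumes "lam \<in> young_diagrams"
  shows "finite {kap \<in> young_diagrams. interlaces kap lam}"
proof (rule finite_subset)
  define S where "S = {i. lam i \<noteq> 0}"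
  have "finite S" using assms by (simp add: S_def young_diagrams_def)
  then show "finite {f. \<forall>i. (i \<in> S \<longrightarrow> f i \<in> {..lam 0}) \<and> (i \<notin> S \<longrightarrow> f i = (0::nat))}"
    by (rule finite_set_of_finite_funs) simp
  have "lam i \<le> lam 0" for i
    using assms by (auto simp: young_diagrams_def antimono_def)
  then show "{kap \<in> young_diagrams. interlaces kap lam}
      \<subseteq> {f. \<forall>i. (i \<in> S \<longrightarrow> f i \<in> {..lam 0}) \<and> (i \<notin> S \<longrightarrow> f i = 0)}"
    unfolding interlaces_def S_def by (auto intro: order_trans) (metis le_zero_eq)
qed


section \<open>Spin Hall-Littlewood functions\<close>

text \<open>The variables are \<open>u 1, \<dots>, u n\<close>. The part \<open>\<lambda>\<^sub>i\<close> paired with the \<open>i\<close>-th variable is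
  \<open>lam (i - 1)\<close>. The expression is meaningful when \<open>u 1, \<dots>, u n\<close> are pairwise distinct and
  \<open>ell lam \<le> n\<close>.\<close>

definition spin_HL_sum :: "real \<Rightarrow> real \<Rightarrow> (nat \<Rightarrow> nat) \<Rightarrow> nat \<Rightarrow> (nat \<Rightarrow> real) \<Rightarrow> real" where
  "spin_HL_sum q s lam n u =
     (1 - q) ^ n / qpochhammer q q (n - ell lam) *
     (\<Sum>\<sigma> | \<sigma> permutes {1..n}.
        (\<Prod>(i, j) \<in> {(i, j). 1 \<le> i \<and> i < j \<and> j \<le> n}.
           (u (\<sigma> i) - q * u (\<sigma> j)) / (u (\<sigma> i) - u (\<sigma> j))) *
        (\<Prod>i=1..n. ((u (\<sigma> i) - s) / (1 - s * u (\<sigma> i))) ^ lam (i - 1)) *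
        (\<Prod>i=1..ell lam. u (\<sigma> i) / (u (\<sigma> i) - s)))"

text \<open>At coinciding variables the value is the limit along points with distinct variables.\<close>

definition spin_HL :: "real \<Rightarrow> real \<Rightarrow> (nat \<Rightarrow> nat) \<Rightarrow> nat \<Rightarrow> (nat \<Rightarrow> real) \<Rightarrow> real" where
  "spin_HL q s lam n u =
     (if ell lam > n then 0
      else if inj_on u {1..n} then spin_HL_sum q s lam n u
      else Lim (at u within {v. inj_on v {1..n}}) (spin_HL_sum q s lam n))"


section \<open>Dual spin q-Whittaker polynomials\<close>

text \<open>If \<open>mu\<close> interlaces \<open>lam\<close>, then all factors of the infinite product beyond the
  \<open>ell lam\<close>-th one equal 1.\<close>

definition dual_spin_qW1 ::
    "real \<Rightarrow> real \<Rightarrow> real \<Rightarrow> (nat \<Rightarrow> nat) \<Rightarrow> (nat \<Rightarrow> nat) \<Rightarrow> real" where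
  "dual_spin_qW1 q s \<theta> lam mu =
     (if interlaces mu lam then
        (\<Prod>k<ell lam.
           \<theta> ^ (lam k - mu k) *
           (qpochhammer (- s / \<theta>) q (lam k - mu k) / qpochhammer q q (lam k - mu k)) *
           (qpochhammer (- s * \<theta>) q (mu k - lam (Suc k)) / qpochhammer q q (mu k - lam (Suc k))) *
           (qpochhammer q q (mu k - mu (Suc k)) / qpochhammer (s\<^sup>2) q (mu k - mu (Suc k))))
      else 0)"

text \<open>In the branching rule only the finitely many diagrams \<open>kap\<close> interlacing \<open>lam\<close> have a nonzero
  first factor.\<close>

primrec dual_spin_qW_skew ::
    "real \<Rightarrow> real \<Rightarrow> (nat \<Rightarrow> real) \<Rightarrow> nat \<Rightarrow> (nat \<Rightarrow> nat) \<Rightarrow> (nat \<Rightarrow> nat) \<Rightarrow> real" where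
  "dual_spin_qW_skew q s \<theta> 0 lam mu = (if lam = mu then 1 else 0)"
| "dual_spin_qW_skew q s \<theta> (Suc l) lam mu =
     (\<Sum>kap \<in> {kap \<in> young_diagrams. interlaces kap lam}.
        dual_spin_qW1 q s (\<theta> (Suc l)) lam kap * dual_spin_qW_skew q s \<theta> l kap mu)"

definition dual_spin_qW ::
    "real \<Rightarrow> real \<Rightarrow> (nat \<Rightarrow> nat) \<Rightarrow> nat \<Rightarrow> (nat \<Rightarrow> real) \<Rightarrow> real" where
  "dual_spin_qW q s lam l \<theta> = dual_spin_qW_skew q s \<theta> l lam (\<lambda>_. 0)"


section \<open>The stochastic higher spin six vertex model\<close>

definition vertex_weight ::
    "real \<Rightarrow> real \<Rightarrow> real \<Rightarrow> real \<Rightarrow> nat \<Rightarrow> nat \<Rightarrow> nat \<Rightarrow> nat \<Rightarrow> real" where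
  "vertex_weight q s u \<theta> i1 j1 i2 j2 =
     (if j1 = 0 \<and> j2 = 0 \<and> i2 = i1 then (q ^ i1 + u * \<theta>) / (1 + u * \<theta>)
      else if j1 = 0 \<and> j2 = 1 \<and> i1 = Suc i2 then (1 - q ^ i1) / (1 + u * \<theta>)
      else if j1 = 1 \<and> j2 = 1 \<and> i2 = i1 then (1 - u * s * q ^ i1) / (1 + u * \<theta>)
      else if j1 = 1 \<and> j2 = 0 \<and> i2 = Suc i1 then u * (\<theta> + s * q ^ i1) / (1 + u * \<theta>)
      else 0)"

text \<open>A configuration is given by the number \<open>v x y\<close> of paths on the vertical edge from
  \<open>(x, y)\<close> to \<open>(x, y + 1)\<close> and the number \<open>h x y\<close> of paths on the horizontal edge from \<open>(x, y)\<close>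
  to \<open>(x + 1, y)\<close>. The vertex \<open>(x, y)\<close> thus has
  \<open>(i\<^sub>1, j\<^sub>1; i\<^sub>2, j\<^sub>2) = (v x (y - 1), h (x - 1) y; v x y, h x y)\<close>.\<close>

definition step_boundary :: "(nat \<Rightarrow> nat \<Rightarrow> nat) \<Rightarrow> (nat \<Rightarrow> nat \<Rightarrow> nat) \<Rightarrow> bool" where
  "step_boundary v h \<longleftrightarrow> (\<forall>y\<ge>1. h 0 y = 1) \<and> (\<forall>x\<ge>1. v x 0 = 0)"

text \<open>The event that the random configuration \<open>(V, H)\<close> coincides with \<open>(v, h)\<close> at the outputs of all
  vertices with \<open>x + y \<le> n\<close>.\<close>

definition agree_upto ::
    "'a measure \<Rightarrow> ('a \<Rightarrow> nat \<Rightarrow> nat \<Rightarrow> nat) \<Rightarrow> ('a \<Rightarrow> nat \<Rightarrow> nat \<Rightarrow> nat) \<Rightarrow> nat \<Rightarrow>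
     (nat \<Rightarrow> nat \<Rightarrow> nat) \<Rightarrow> (nat \<Rightarrow> nat \<Rightarrow> nat) \<Rightarrow> 'a set" where
  "agree_upto N V H n v h =
     {\<omega> \<in> space N. \<forall>x\<ge>1. \<forall>y\<ge>1. x + y \<le> n \<longrightarrow> V \<omega> x y = v x y \<and> H \<omega> x y = h x y}"

text \<open>The sequential sampling rule: given the outputs of all vertices with \<open>x + y \<le> n\<close>, the outputs
  of the vertices with \<open>x + y = n + 1\<close> are independent with the distributions prescribed by the
  vertex weights. It is written in product form, so that nothing is conditioned on a null event.\<close>

definition stochastic_hs6v ::
    "real \<Rightarrow> real \<Rightarrow> (nat \<Rightarrow> real) \<Rightarrow> (nat \<Rightarrow> real) \<Rightarrow> 'a measure \<Rightarrow>
     ('a \<Rightarrow> nat \<Rightarrow> nat \<Rightarrow> nat) \<Rightarrow> ('a \<Rightarrow> nat \<Rightarrow> nat \<Rightarrow> nat) \<Rightarrow> bool" where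
  "stochastic_hs6v q s \<theta> u N V H \<longleftrightarrow>
     prob_space N \<and>
     (\<forall>x y. (\<lambda>\<omega>. V \<omega> x y) \<in> N \<rightarrow>\<^sub>M count_space UNIV \<and> (\<lambda>\<omega>. H \<omega> x y) \<in> N \<rightarrow>\<^sub>M count_space UNIV) \<and>
     (\<forall>\<omega> \<in> space N. step_boundary (V \<omega>) (H \<omega>)) \<and>
     (\<forall>n v h. step_boundary v h \<longrightarrow>
        measure N (agree_upto N V H (Suc n) v h) =
        measure N (agree_upto N V H n v h) *
        (\<Prod>(x, y) \<in> {(x, y). 1 \<le> x \<and> 1 \<le> y \<and> x + y = Suc n}.
           vertex_weight q s (u y) (\<theta> x) (v x (y - 1)) (h (x - 1) y) (v x y) (h x y)))"

text \<open>The height function at the point \<open>(X, y)\<close> with \<open>X \<ge> 1\<close>.\<close>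

definition hs_height :: "(nat \<Rightarrow> nat \<Rightarrow> nat) \<Rightarrow> nat \<Rightarrow> nat \<Rightarrow> nat" where
  "hs_height h X y = card {k \<in> {1..y}. h (X - 1) k > 0}"

subsection \<open>Existence\<close>

text \<open>For admissible parameters the predicate above is satisfiable: sample independently an output
  of each vertex for each of its possible inputs, then read off the configuration from the boundary.\<close>

fun hs6v_config :: "(nat \<times> nat \<times> nat \<times> nat \<Rightarrow> nat \<times> nat) \<Rightarrow> nat \<Rightarrow> nat \<Rightarrow> nat \<times> nat" where
  "hs6v_config \<omega> 0 y = (0, 1)"
| "hs6v_config \<omega> (Suc x) 0 = (0, 0)"
| "hs6v_config \<omega> (Suc x) (Suc y) =
     \<omega> (Suc x, Suc y, fst (hs6v_config \<omega> (Suc x) y), snd (hs6v_config \<omega> x (Suc y)))"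

lemma vertex_weight_pmf:
  assumes q: "0 \<le> q" "q < 1" and s: "- 1 < s" "s < 0"
    and th: "\<theta> \<in> {- s .. - inverse s}" and u: "u \<in> {0..<1}"
  shows "\<exists>p :: (nat \<times> nat) pmf. \<forall>i2 j2. pmf p (i2, j2) = vertex_weight q s u \<theta> i1 j1 i2 j2 \<or> j1 > 1"
proof -
  have th0: "\<theta> > 0" "\<theta> \<ge> - s" using th s by auto
  have ut: "0 \<le> u * \<theta>" using th0 u by auto
  have qi: "0 \<le> q ^ i1" "q ^ i1 \<le> 1" using q by (auto simp: power_le_one)
  have sq: "- s * q ^ i1 \<le> - s * 1" "0 \<le> - s * q ^ i1"
    using qi s mult_left_mono[of "q ^ i1" 1 "- s"] by (auto simp: mult_nonpos_nonneg)
  have pos: "0 \<le> \<theta> + s * q ^ i1" using sq th0 by auto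
  have up: "0 \<le> u * (\<theta> + s * q ^ i1)" using pos u by (intro mult_nonneg_nonneg) auto
  have us: "0 \<le> - u * s * q ^ i1" using sq(2) u mult_nonneg_nonneg[of u "- s * q ^ i1"] by (simp add: mult.assoc)
  define p where "p = (if j1 = 0 then (1 - q ^ i1) / (1 + u * \<theta>) else (1 - u * s * q ^ i1) / (1 + u * \<theta>))"
  have p: "0 \<le> p" "p \<le> 1"
    using ut qi up us unfolding p_def by (auto simp: divide_simps algebra_simps)
  define f where "f b = (if j1 = 0 then (if b then (i1 - 1, 1) else (i1, 0)) else (if b then (i1, 1) else (Suc i1, 0 :: nat)))" for b
  have inj: "inj f" by (auto simp: inj_def f_def)
  have "pmf (map_pmf f (bernoulli_pmf p)) (i2, j2) = vertex_weight q s u \<theta> i1 j1 i2 j2" if "j1 \<le> 1" for i2 j2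
  proof (cases "(i2, j2) \<in> range f")
    case True
    then obtain b where b: "(i2, j2) = f b" by auto
    have "pmf (map_pmf f (bernoulli_pmf p)) (i2, j2) = (if b then p else 1 - p)"
      unfolding b pmf_map_inj'[OF inj] using p by (cases b) auto
    also have "1 - p = (if j1 = 0 then (q ^ i1 + u * \<theta>) / (1 + u * \<theta>) else u * (\<theta> + s * q ^ i1) / (1 + u * \<theta>))"
      using ut unfolding p_def by (simp add: divide_simps) (simp add: algebra_simps)
    also have "(if b then p else \<dots>) = vertex_weight q s u \<theta> i1 j1 i2 j2"
    proof (cases "j1 = 0")
      case True
      then show ?thesis using b by (cases i1) (auto simp: f_def vertex_weight_def p_def split: if_splits)
    next
      case False
      then have "j1 = 1" using that by simp
      then show ?thesis using b by (auto simp: f_def vertex_weight_def p_def split: if_splits)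
    qed
    finally show ?thesis .
  next
    case False
    then have "pmf (map_pmf f (bernoulli_pmf p)) (i2, j2) = 0"
      by (intro pmf_map_outside) auto
    moreover have "(i2, j2) \<noteq> f True" "(i2, j2) \<noteq> f False" using False by auto
    ultimately show ?thesis using that by (auto simp: f_def vertex_weight_def split: if_splits)
  qed
  then show ?thesis by (meson not_le)
qed

lemma stochastic_hs6v_exists:
  assumes "0 \<le> q" "q < 1" "- 1 < s" "s < 0"
    and "\<And>i. i \<ge> 1 \<Longrightarrow> \<theta> i \<in> {- s .. - inverse s}"
    and "\<And>j. j \<ge> 1 \<Longrightarrow> u j \<in> {0 ..< 1}"
  shows "\<exists>(N :: (nat \<times> nat \<times> nat \<times> nat \<Rightarrow> nat \<times> nat) measure) V H. stochastic_hs6v q s \<theta> u N V H"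
proof -
  have "\<forall>x y i j. \<exists>p :: (nat \<times> nat) pmf. x \<ge> 1 \<longrightarrow> y \<ge> 1 \<longrightarrow> (\<forall>i2 j2. pmf p (i2, j2) = vertex_weight q s (u y) (\<theta> x) i j i2 j2 \<or> j > 1)"
    using vertex_weight_pmf[OF assms(1-4) assms(5,6)] by metis
  then obtain K :: "nat \<Rightarrow> nat \<Rightarrow> nat \<Rightarrow> nat \<Rightarrow> (nat \<times> nat) pmf" where
    K: "\<And>x y i j i2 j2. x \<ge> 1 \<Longrightarrow> y \<ge> 1 \<Longrightarrow> j \<le> 1 \<Longrightarrow>
          pmf (K x y i j) (i2, j2) = vertex_weight q s (u y) (\<theta> x) i j i2 j2"
    by (metis not_le)
  text \<open>The weights vanish for \<open>j\<^sub>1 > 1\<close>, an input which never occurs.\<close>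
  define K' where "K' = (\<lambda>(x, y, i, j). if j \<le> 1 then K x y i j else return_pmf (0, 0))"
  define N where "N = PiM (UNIV :: (nat \<times> nat \<times> nat \<times> nat) set) (\<lambda>k. measure_pmf (K' k))"
  define V where "V \<omega> x y = fst (hs6v_config \<omega> x y)" for \<omega> x y
  define H where "H \<omega> x y = snd (hs6v_config \<omega> x y)" for \<omega> x y
  interpret product_prob_space "\<lambda>k. measure_pmf (K' k)" UNIV ..
  have comp: "(\<lambda>\<omega>. \<omega> k) \<in> N \<rightarrow>\<^sub>M count_space UNIV" for k
    using measurable_component_singleton[of k UNIV "\<lambda>k. measure_pmf (K' k)"]
      measurable_cong_sets[OF refl, of "measure_pmf (K' k)" "count_space UNIV" N]
    by (simp add: N_def)
  have meas: "(\<lambda>\<omega>. hs6v_config \<omega> x y) \<in> N \<rightarrow>\<^sub>M count_space UNIV" for x y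
  proof (induction "\<lambda>k::nat \<times> nat \<times> nat \<times> nat. (0::nat, 0::nat)" x y rule: hs6v_config.induct)
    case (3 x y)
    have "(\<lambda>\<omega>. (fst (hs6v_config \<omega> (Suc x) y), snd (hs6v_config \<omega> x (Suc y)))) \<in> N \<rightarrow>\<^sub>M count_space UNIV"
      using 3 by measurable
    from measurable_compose_countable[OF comp this, of "\<lambda>(a, b). (Suc x, Suc y, a, b)"]
    show ?case by (simp add: case_prod_beta)
  qed simp_all
  have sp: "space N = UNIV" by (simp add: N_def space_PiM)
  define T where "T n = {(x, y). 1 \<le> x \<and> 1 \<le> y \<and> x + y \<le> (n::nat)}" for n
  define D where "D n = {(x, y). 1 \<le> x \<and> 1 \<le> y \<and> x + y = (n::nat)}" for n
  have finT: "finite (T n)" for n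
    by (rule finite_subset[of _ "{..n} \<times> {..n}"]) (auto simp: T_def)
  have agree: "measure N (agree_upto N V H n v h) =
      (\<Prod>(x, y) \<in> T n. pmf (K' (x, y, v x (y - 1), h (x - 1) y)) (v x y, h x y))"
    if bd: "step_boundary v h" for n v h
  proof -
    define inp where "inp = (\<lambda>(x, y). (x, y, v x (y - 1), h (x - 1) y))"
    define X where "X = (\<lambda>(x, y, i :: nat, j :: nat). {(v x y, h x y)})"
    have "agree_upto N V H n v h = {\<omega>. \<forall>k \<in> T n. \<omega> (inp k) \<in> X (inp k)}"
    proof (intro set_eqI iffI)
      fix \<omega> assume "\<omega> \<in> agree_upto N V H n v h"
      then have A: "V \<omega> x y = v x y \<and> H \<omega> x y = h x y" if "(x, y) \<in> T n" for x y
        using that by (auto simp: agree_upto_def T_def)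
      have "\<omega> (x, y, v x (y - 1), h (x - 1) y) = (v x y, h x y)" if xy: "(x, y) \<in> T n" for x y
      proof -
        obtain a b where ab: "x = Suc a" "y = Suc b"
          using xy by (auto simp: T_def) (metis Suc_le_D)
        have "V \<omega> x b = v x b"
          using A[of x b] xy bd by (cases b) (auto simp: ab T_def step_boundary_def V_def)
        moreover have "H \<omega> a y = h a y"
          using A[of a y] xy bd by (cases a) (auto simp: ab T_def step_boundary_def H_def)
        ultimately show ?thesis using A[OF xy] by (auto simp: ab V_def H_def prod_eq_iff)
      qed
      then show "\<omega> \<in> {\<omega>. \<forall>k \<in> T n. \<omega> (inp k) \<in> X (inp k)}" by (auto simp: inp_def X_def)
    next
      fix \<omega> assume "\<omega> \<in> {\<omega>. \<forall>k \<in> T n. \<omega> (inp k) \<in> X (inp k)}"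
      then have B: "\<omega> (x, y, v x (y - 1), h (x - 1) y) = (v x y, h x y)" if "(x, y) \<in> T n" for x y
        using that by (auto simp: inp_def X_def)
      have "hs6v_config \<omega> x y = (v x y, h x y)" if "(x, y) \<in> T n" for x y
        using that
      proof (induction "x + y" arbitrary: x y rule: less_induct)
        case less
        obtain a b where ab: "x = Suc a" "y = Suc b"
          using less.prems by (auto simp: T_def) (metis Suc_le_D)
        have "fst (hs6v_config \<omega> x b) = v x b"
          using less.hyps[of x b] less.prems bd by (cases b) (auto simp: ab T_def step_boundary_def)
        moreover have "snd (hs6v_config \<omega> a y) = h a y"
          using less.hyps[of a y] less.prems bd by (cases a) (auto simp: ab T_def step_boundary_def)
        ultimately show ?case using B[OF less.prems] by (simp add: ab)
      qed
      then show "\<omega> \<in> agree_upto N V H n v h"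
        by (auto simp: agree_upto_def sp T_def V_def H_def)
    qed
    also have "\<dots> = prod_emb UNIV (\<lambda>k. measure_pmf (K' k)) (inp ` T n) (Pi\<^sub>E (inp ` T n) X)"
      by (auto simp: prod_emb_def Pi_iff)
    finally have "measure N (agree_upto N V H n v h) = (\<Prod>k \<in> inp ` T n. measure (K' k) (X k))"
      unfolding N_def using finT by (simp add: measure_PiM_emb)
    also have "\<dots> = (\<Prod>k \<in> T n. measure (K' (inp k)) (X (inp k)))"
      by (rule prod.reindex_cong[of inp]) (auto simp: inp_def inj_on_def)
    finally show ?thesis
      by (simp add: inp_def X_def case_prod_beta measure_pmf_single)
  qed
  have "stochastic_hs6v q s \<theta> u N V H"
    unfolding stochastic_hs6v_def
  proof (intro conjI allI ballI impI)
    show "prob_space N" unfolding N_def by (rule P.prob_space_axioms)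
  next
    fix x y
    show "(\<lambda>\<omega>. V \<omega> x y) \<in> N \<rightarrow>\<^sub>M count_space UNIV" "(\<lambda>\<omega>. H \<omega> x y) \<in> N \<rightarrow>\<^sub>M count_space UNIV"
      unfolding V_def H_def by (rule measurable_compose[OF meas], simp)+
  next
    fix \<omega>
    have "hs6v_config \<omega> x 0 = (0, 0)" if "x \<ge> 1" for x
      using that by (cases x) auto
    then show "step_boundary (V \<omega>) (H \<omega>)" by (simp add: step_boundary_def V_def H_def)
  next
    fix n v h assume bd: "step_boundary v h"
    let ?f = "\<lambda>(x, y). pmf (K' (x, y, v x (y - 1), h (x - 1) y)) (v x y, h x y)"
    let ?w = "\<lambda>(x, y). vertex_weight q s (u y) (\<theta> x) (v x (y - 1)) (h (x - 1) y) (v x y) (h x y)"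
    have split: "T (Suc n) = T n \<union> D (Suc n)" "T n \<inter> D (Suc n) = {}"
      by (auto simp: T_def D_def)
    have finD: "finite (D (Suc n))" using finT[of "Suc n"] split(1) by auto
    have eq: "prod ?f (T (Suc n)) = prod ?f (T n) * prod ?f (D (Suc n))"
      unfolding split(1) using finT finD split(2) by (rule prod.union_disjoint)
    have "prod ?f (T n) * prod ?f (D (Suc n)) = prod ?f (T n) * prod ?w (D (Suc n))"
    proof (cases "\<forall>(x, y) \<in> T n. h x y \<le> 1")
      case True
      have "h (x - 1) y \<le> 1" if "(x, y) \<in> D (Suc n)" for x y
      proof (cases "x = 1")
        case False
        then have "(x - 1, y) \<in> T n" using that by (auto simp: T_def D_def)
        then show ?thesis using True by auto
      qed (use that bd in \<open>auto simp: D_def step_boundary_def\<close>)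
      then have "prod ?f (D (Suc n)) = prod ?w (D (Suc n))"
        by (intro prod.cong) (auto simp: K'_def K D_def)
      then show ?thesis by simp
    next
      case False
      then obtain x y where xy: "(x, y) \<in> T n" "h x y > 1" by force
      have "pmf (K' (x, y, i, j)) (k, h x y) = 0" for i j k
        using xy by (auto simp: K'_def K T_def vertex_weight_def)
      then have "prod ?f (T n) = 0"
        using xy(1) finT by (intro prod_zero) (auto intro!: bexI[of _ "(x, y)"])
      then show ?thesis by simp
    qed
    then show "measure N (agree_upto N V H (Suc n) v h) = measure N (agree_upto N V H n v h) *
        prod ?w {(x, y). 1 \<le> x \<and> 1 \<le> y \<and> x + y = Suc n}"
      using eq agree[OF bd] by (simp add: D_def)
  qed
  then show ?thesis by blast
qed
end

theory Submission
  imports Defs "HOL-Combinatorics.Multiset_Permutations"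
begin

text \<open>
  On both sides the event of having \<open>k\<close> nonzero parts, respectively height \<open>y - k\<close>, has for distinct
  \<open>u\<^sub>1, \<dots>, u\<^sub>y\<close> a probability of the form
  \<open>\<Sum> (\<Prod>\<^sub>i\<^sub>\<in>\<^sub>K\<^sub>,\<^sub>j\<^sub>\<notin>\<^sub>K (u\<^sub>i - q u\<^sub>j) / (u\<^sub>i - u\<^sub>j)) (\<Prod>\<^sub>j\<^sub>\<notin>\<^sub>K d(u\<^sub>j)) p(K)\<close>, the sum being over the sets \<open>K\<close> of \<open>k\<close>
  variables. For the diagrams this is the splitting of the symmetrization according to the variables of the
  nonzero parts; for the vertex model it follows from the exchange relations between the two types of rows,
  with an exiting and without an exiting path. In each case \<open>p(K)\<close> only depends on the variables in \<open>K\<close>,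
  and \<open>d\<close> is the same. The total mass is one for every set of variables: in the vertex model trivially, for
  the diagrams by the Cauchy identity, which is proved one \<open>\<theta>\<close> at a time. By induction on the number of
  variables this determines \<open>p\<close>, so the two functions \<open>p\<close> agree. Coinciding variables are a limit.
\<close>

section \<open>Partial fractions and the cluster identity\<close>

text \<open>The Cauchy identity for one \<theta> localizes. Passing from \<open>kap\<close> to
  \<open>lam\<close> raises some of the parts equal to k to k + 1, for every k. The scattering
  factors between two blocks of variables do not depend on the order inside the blocks, so the
  groups of equal parts separate, and for one group \<open>cluster_sum_eq\<close> remains. There
  \<alpha> = s, while \<beta> is s for positive parts and 0 for the parts 0, because a variable that
  leaves the value 0 also acquires the factor \<open>u / (u - s)\<close>. Neither function p has to
  be computed. The term K = U has an empty product as its coefficient, so the total mass for U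
  expresses p(U) through the p(K) of smaller sets; this is why the mass must be known for all sets
  of variables. The variables are treated as a set of real numbers, hence their distinctness. Every
  single term of the symmetrization has poles at coinciding variables; that they cancel in the sum
  has to be proved, since otherwise the value of \<open>Lim\<close> in \<open>spin_HL\<close> would
  be unspecified.\<close>

lemma partial_fractions:
  fixes \<phi> :: "'a \<Rightarrow> 'a \<Rightarrow> real" and e r :: real
  assumes "finite M" "w \<notin> M"
    and \<phi>: "\<And>x i m. x \<noteq> i \<Longrightarrow> x \<noteq> m \<Longrightarrow> i \<noteq> m \<Longrightarrow> \<phi> x i * \<phi> x m = \<phi> x m * \<phi> m i + \<phi> x i * \<phi> i m"
  shows "(\<Prod>j\<in>M. e + r * \<phi> w j) =
    e ^ card M + (\<Sum>j\<in>M. r * \<phi> w j * (\<Prod>l\<in>M - {j}. e + r * \<phi> j l))"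
  using assms(1,2)
proof (induction M arbitrary: w rule: finite_induct)
  case empty
  then show ?case by simp
next
  case (insert m M)
  define R where "R j = (\<Prod>l\<in>M - {j}. e + r * \<phi> j l)" for j
  have wm: "w \<noteq> m" "w \<notin> M" using insert.prems by auto
  have 1: "(\<Prod>l\<in>insert m M - {j}. e + r * \<phi> j l) = (e + r * \<phi> j m) * R j" if "j \<in> M" for j
  proof -
    have "insert m M - {j} = insert m (M - {j})" using that insert.hyps by auto
    then show ?thesis using insert.hyps by (simp add: R_def)
  qed
  have 2: "insert m M - {m} = M" using insert.hyps by auto
  have IHw: "(\<Prod>j\<in>M. e + r * \<phi> w j) = e ^ card M + (\<Sum>j\<in>M. r * \<phi> w j * R j)"
    using insert.IH[OF wm(2)] by (simp add: R_def)
  have IHm: "(\<Prod>j\<in>M. e + r * \<phi> m j) = e ^ card M + (\<Sum>j\<in>M. r * \<phi> m j * R j)"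
    using insert.IH[OF insert.hyps(2)] by (simp add: R_def)
  \<comment> \<open>The relation for \<phi> separates the two poles of a product. The part with
    \<open>\<phi> w m\<close> adds up to the induction hypothesis at \<open>m\<close> in the place
    of \<open>w\<close>, hence the induction over arbitrary \<open>w\<close>.\<close>
  have "(e + r * \<phi> w m) * (r * \<phi> w j * R j) =
      r * \<phi> w m * (r * \<phi> m j * R j) + r * \<phi> w j * ((e + r * \<phi> j m) * R j)" if "j \<in> M" for j
  proof -
    have "\<phi> w j * \<phi> w m = \<phi> w m * \<phi> m j + \<phi> w j * \<phi> j m"
      using that wm insert.hyps by (intro \<phi>) auto
    then have "r * r * R j * (\<phi> w j * \<phi> w m) = r * r * R j * (\<phi> w m * \<phi> m j + \<phi> w j * \<phi> j m)"
      by simp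
    then show ?thesis by (simp add: algebra_simps)
  qed
  then have 3: "(\<Sum>j\<in>M. (e + r * \<phi> w m) * (r * \<phi> w j * R j)) =
      (\<Sum>j\<in>M. r * \<phi> w m * (r * \<phi> m j * R j)) + (\<Sum>j\<in>M. r * \<phi> w j * ((e + r * \<phi> j m) * R j))"
    by (simp add: sum.distrib)
  have "(\<Prod>j\<in>insert m M. e + r * \<phi> w j) =
      (e + r * \<phi> w m) * e ^ card M + (\<Sum>j\<in>M. (e + r * \<phi> w m) * (r * \<phi> w j * R j))"
    using insert.hyps by (simp add: IHw distrib_left sum_distrib_left)
  also have "\<dots> = e ^ card (insert m M) + (r * \<phi> w m * (\<Prod>j\<in>M. e + r * \<phi> m j)
      + (\<Sum>j\<in>M. r * \<phi> w j * ((e + r * \<phi> j m) * R j)))"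
    using insert.hyps unfolding 3 IHm by (simp add: algebra_simps sum_distrib_left)
  also have "r * \<phi> w m * (\<Prod>j\<in>M. e + r * \<phi> m j) + (\<Sum>j\<in>M. r * \<phi> w j * ((e + r * \<phi> j m) * R j))
      = (\<Sum>j\<in>insert m M. r * \<phi> w j * (\<Prod>l\<in>insert m M - {j}. e + r * \<phi> j l))"
    using insert.hyps by (simp add: 1 2)
  finally show ?case .
qed

text \<open>The kernels differ by 1: \<open>j / (x - j)\<close> vanishes at infinity,
  \<open>x / (x - j)\<close> at x = 0 for nonzero j. Expanded in the first one, a product of
  scattering factors shows its value at infinity as the constant term, in the second one its value
  at 0. The cluster identity compares both expansions.\<close>

lemma partial_fraction_kernels:
  fixes x i m :: real
  assumes "x \<noteq> i" "x \<noteq> m" "i \<noteq> m"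
  shows "i / (x - i) * (m / (x - m)) = m / (x - m) * (i / (m - i)) + i / (x - i) * (m / (i - m))"
    and "x / (x - i) * (x / (x - m)) = x / (x - m) * (m / (m - i)) + x / (x - i) * (i / (i - m))"
proof -
  have "x - i \<noteq> 0" "x - m \<noteq> 0" "m - i \<noteq> 0" "i - m \<noteq> 0" using assms by auto
  then show "i / (x - i) * (m / (x - m)) = m / (x - m) * (i / (m - i)) + i / (x - i) * (m / (i - m))"
    "x / (x - i) * (x / (x - m)) = x / (x - m) * (m / (m - i)) + x / (x - i) * (i / (i - m))"
    by (simp_all add: divide_simps) (simp_all add: algebra_simps)
qed

lemma prod_scattering_right:
  fixes w q :: real
  assumes "finite M" "w \<notin> M"
  shows "(\<Prod>j\<in>M. (w - q * j) / (w - j)) =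
      1 + (\<Sum>j\<in>M. (1 - q) * (j / (w - j)) * (\<Prod>l\<in>M - {j}. (j - q * l) / (j - l)))" (is ?a)
    and "(\<Prod>j\<in>M. (w - q * j) / (w - j)) =
      q ^ card M + (\<Sum>j\<in>M. (1 - q) * (w / (w - j)) * (\<Prod>l\<in>M - {j}. (j - q * l) / (j - l)))" (is ?b)
proof -
  have 1: "(x - q * j) / (x - j) = 1 + (1 - q) * (j / (x - j))"
    and 2: "(x - q * j) / (x - j) = q + (1 - q) * (x / (x - j))" if "x \<noteq> j" for x j
    using that by (simp_all add: field_simps)
  have 3: "(\<Prod>j\<in>M. (w - q * j) / (w - j)) = (\<Prod>j\<in>M. 1 + (1 - q) * (j / (w - j)))"
    and 4: "(\<Prod>j\<in>M. (w - q * j) / (w - j)) = (\<Prod>j\<in>M. q + (1 - q) * (w / (w - j)))"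
    using assms 1 2 by (metis (no_types, lifting) prod.cong)+
  have 5: "(\<Prod>l\<in>M - {j}. (j - q * l) / (j - l)) = (\<Prod>l\<in>M - {j}. 1 + (1 - q) * (l / (j - l)))"
    and 6: "(\<Prod>l\<in>M - {j}. (j - q * l) / (j - l)) = (\<Prod>l\<in>M - {j}. q + (1 - q) * (j / (j - l)))" for j
    using 1 2 by (metis (no_types, lifting) DiffD2 insertI1 prod.cong)+
  show ?a unfolding 3 5
    using partial_fractions[OF assms, of "\<lambda>x j. j / (x - j)" 1 "1 - q", OF partial_fraction_kernels(1)]
    by simp
  show ?b unfolding 4 6
    by (rule partial_fractions[OF assms partial_fraction_kernels(2)])
qed

lemma prod_scattering_left:
  fixes w q :: real
  assumes "finite M" "w \<notin> M"
  shows "(\<Prod>i\<in>M. (i - q * w) / (i - w)) =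
      q ^ card M - (\<Sum>i\<in>M. (1 - q) * (i / (w - i)) * (\<Prod>l\<in>M - {i}. (l - q * i) / (l - i)))" (is ?a)
    and "(\<Prod>i\<in>M. (i - q * w) / (i - w)) =
      1 - (\<Sum>i\<in>M. (1 - q) * (w / (w - i)) * (\<Prod>l\<in>M - {i}. (l - q * i) / (l - i)))" (is ?b)
proof -
  have 1: "(j - q * x) / (j - x) = q + (- (1 - q)) * (j / (x - j))"
    and 2: "(j - q * x) / (j - x) = 1 + (- (1 - q)) * (x / (x - j))" if "x \<noteq> j" for x j
    using that by (simp_all add: field_simps) 
  have 3: "(\<Prod>j\<in>M. (j - q * w) / (j - w)) = (\<Prod>j\<in>M. q + (- (1 - q)) * (j / (w - j)))"
    and 4: "(\<Prod>j\<in>M. (j - q * w) / (j - w)) = (\<Prod>j\<in>M. 1 + (- (1 - q)) * (w / (w - j)))"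
    using assms 1 2 by (metis (no_types, lifting) prod.cong)+
  have 5: "(\<Prod>l\<in>M - {j}. (l - q * j) / (l - j)) = (\<Prod>l\<in>M - {j}. q + (- (1 - q)) * (l / (j - l)))"
    and 6: "(\<Prod>l\<in>M - {j}. (l - q * j) / (l - j)) = (\<Prod>l\<in>M - {j}. 1 + (- (1 - q)) * (j / (j - l)))" for j
    using 1 2 by (metis (no_types, lifting) DiffD2 insertI1 prod.cong)+
  show ?a unfolding 3 5
    using partial_fractions[OF assms, of "\<lambda>x j. j / (x - j)" q "- (1 - q)", OF partial_fraction_kernels(1)]
    by (simp only: sum_negf[symmetric] mult_minus_left diff_conv_add_uminus power_one simp_thms)
  show ?b unfolding 4 6
    using partial_fractions[OF assms, of "\<lambda>x j. x / (x - j)" 1 "- (1 - q)", OF partial_fraction_kernels(2)]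
    by (simp only: sum_negf[symmetric] mult_minus_left diff_conv_add_uminus power_one simp_thms)
qed

definition cross :: "real \<Rightarrow> real set \<Rightarrow> real set \<Rightarrow> real" where
  "cross q I J = (\<Prod>i\<in>I. \<Prod>j\<in>J. (i - q * j) / (i - j))"

lemma cross_empty [simp]: "cross q {} J = 1" "cross q I {} = 1"
  by (simp_all add: cross_def)

lemma cross_insert_left:
  assumes "finite I" "w \<notin> I"
  shows "cross q (insert w I) J = (\<Prod>j\<in>J. (w - q * j) / (w - j)) * cross q I J"
  using assms by (simp add: cross_def)

lemma cross_insert_right:
  assumes "finite J" "w \<notin> J"
  shows "cross q I (insert w J) = (\<Prod>i\<in>I. (i - q * w) / (i - w)) * cross q I J"
  using assms by (simp add: cross_def prod.distrib del: times_divide_eq_left times_divide_eq_right)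

lemma sum_Pow_insert:
  assumes "finite M" "w \<notin> M"
  shows "sum f (Pow (insert w M)) = (\<Sum>I\<in>Pow M. f (insert w I) + f I)"
proof -
  have "sum f (insert w ` Pow M) = (\<Sum>I\<in>Pow M. f (insert w I))"
    by (rule sum.reindex_cong[of "insert w"]) (use assms in \<open>auto simp: inj_on_def\<close>)
  then show ?thesis
    unfolding Pow_insert using assms by (subst sum.union_disjoint) (auto simp: sum.distrib add.commute)
qed

lemma sum_Pow_move_element:
  assumes "finite M"
  shows "(\<Sum>I\<in>Pow M. \<Sum>i\<in>I. f I i) = (\<Sum>L\<in>Pow M. \<Sum>i\<in>M - L. f (insert i L) i)"
proof -
  have fin: "finite I" if "I \<in> Pow M" for I using that assms finite_subset by auto
  have "(\<Sum>I\<in>Pow M. \<Sum>i\<in>I. f I i) = (\<Sum>(I, i)\<in>(SIGMA I:Pow M. I). f I i)"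
    using assms fin by (subst sum.Sigma) auto
  also have "\<dots> = (\<Sum>(L, i)\<in>(SIGMA L:Pow M. M - L). f (insert i L) i)"
    by (rule sum.reindex_bij_witness[of _ "\<lambda>(L, i). (insert i L, i)" "\<lambda>(I, i). (I - {i}, i)"])
      (auto simp: insert_absorb)
  also have "\<dots> = (\<Sum>L\<in>Pow M. \<Sum>i\<in>M - L. f (insert i L) i)"
    using assms by (subst sum.Sigma) auto
  finally show ?thesis .
qed

text \<open>The variables of a group of equal parts that move up form \<open>I\<close>, the others
  stay. For \<alpha> = \<beta> = 0 the terms with |I| = a add up to \<open>\<theta> ^ a\<close>
  times the elementary symmetric polynomial e_a, which is the Hall-Littlewood polynomial of a
  column.\<close>

definition cluster_sum :: "real \<Rightarrow> real \<Rightarrow> real \<Rightarrow> real \<Rightarrow> real set \<Rightarrow> real" where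
  "cluster_sum q \<theta> \<alpha> \<beta> M = (\<Sum>I\<in>Pow M.
     (\<Prod>r<card I. \<theta> + \<alpha> * q ^ r) * (\<Prod>r<card (M - I). 1 + \<beta> * \<theta> * q ^ r) *
     cross q I (M - I) * (\<Prod>i\<in>I. i - \<beta>) * (\<Prod>j\<in>M - I. 1 - \<alpha> * j))"

text \<open>Induction by adding a variable \<open>w\<close>. In \<open>w\<close> the single terms
  have poles at the elements of \<open>M\<close>; these cancel in pairs, and what is left is so
  simple that its behaviour at 0 and at infinity determines it.\<close>

lemma cluster_sum_eq:
  assumes "finite M"
  shows "cluster_sum q \<theta> \<alpha> \<beta> M = (\<Prod>r<card M. 1 - \<alpha> * \<beta> * q ^ r) * (\<Prod>i\<in>M. 1 + \<theta> * i)"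
  using assms
proof (induction M rule: finite_induct)
  case empty
  then show ?case by (simp add: cluster_sum_def)
next
  case (insert w M)
  note finM = insert.hyps(1)
  define f where "f a = (\<Prod>r<a. \<theta> + \<alpha> * q ^ r)" for a
  define k where "k b = (\<Prod>r<b. 1 + \<beta> * \<theta> * q ^ r)" for b
  define p where "p I = \<theta> + \<alpha> * q ^ card I" for I :: "real set"
  define r where "r I = 1 + \<beta> * \<theta> * q ^ card (M - I)" for I
  define W where "W I = f (card I) * k (card (M - I)) * cross q I (M - I) *
    (\<Prod>i\<in>I. i - \<beta>) * (\<Prod>j\<in>M - I. 1 - \<alpha> * j)" for I
  define g where "g J w = (\<Prod>j\<in>J. (w - q * j) / (w - j))" for J w
  define h where "h I w = (\<Prod>i\<in>I. (i - q * w) / (i - w))" for I w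
  \<comment> \<open>The common part of two residues at \<open>i\<close>: the one of the term
    \<open>L\<close>, where \<open>w\<close> joins the first block and \<open>i\<close> lies in the
    second, and the one of the term \<open>insert i L\<close>, where \<open>w\<close> joins the
    second block and \<open>i\<close> lies in the first.\<close>
  define X where "X L i = f (Suc (card L)) * k (card (M - L)) * cross q L (M - L - {i}) *
     h L i * g (M - L - {i}) i * (\<Prod>i\<in>L. i - \<beta>) * (\<Prod>j\<in>M - L - {i}. 1 - \<alpha> * j)" for L i
  have f_Suc: "f (Suc a) = f a * (\<theta> + \<alpha> * q ^ a)" for a by (simp add: f_def)
  have k_Suc: "k (Suc a) = k a * (1 + \<beta> * \<theta> * q ^ a)" for a by (simp add: k_def)
  have SM: "cluster_sum q \<theta> \<alpha> \<beta> M = (\<Sum>I\<in>Pow M. W I)"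
    by (simp add: cluster_sum_def W_def f_def k_def)
  have fin: "finite I" if "I \<in> Pow M" for I using that finM finite_subset by auto
  have card: "card I + card (M - I) = card M" if "I \<in> Pow M" for I
    using that finM by (simp add: card_Diff_subset fin card_mono)
  have expand: "cluster_sum q \<theta> \<alpha> \<beta> (insert w M) =
     (\<Sum>I\<in>Pow M. W I * (p I * (w - \<beta>) * g (M - I) w +
        r I * (1 - \<alpha> * w) * h I w))" if w: "w \<notin> M" for w
    unfolding cluster_sum_def f_def[symmetric] k_def[symmetric]
  proof (subst sum_Pow_insert[OF finM w], rule sum.cong[OF refl], goal_cases)
    case (1 I)
    have wI: "w \<notin> I" "w \<notin> M - I" "finite I" "finite (M - I)" using 1 w fin finM by auto
    have e: "insert w M - insert w I = M - I" "insert w M - I = insert w (M - I)" using wI w by auto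
    show ?case unfolding e using wI
      by (simp add: cross_insert_left cross_insert_right f_Suc k_Suc W_def g_def h_def p_def r_def) (simp add: algebra_simps)
  qed
  have X1: "W L * p L * g (M - L - {i}) i = X L i * (1 - \<alpha> * i)"
    if "L \<in> Pow M" "i \<in> M - L" for L i
  proof -
    have e: "M - L = insert i (M - L - {i})" using that by auto
    have c: "cross q L (M - L) = h L i * cross q L (M - L - {i})"
      by (subst e, subst cross_insert_right) (use finM in \<open>auto simp: h_def\<close>)
    have pr: "(\<Prod>j\<in>M - L. 1 - \<alpha> * j) = (1 - \<alpha> * i) * (\<Prod>j\<in>M - L - {i}. 1 - \<alpha> * j)"
      by (subst e, subst prod.insert) (use finM in auto)
    show ?thesis unfolding W_def X_def c pr f_Suc p_def by (simp add: algebra_simps)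
  qed
  have X2: "W (insert i L) * r (insert i L) * h L i = X L i * (i - \<beta>)"
    if "L \<in> Pow M" "i \<in> M - L" for L i
  proof -
    have e: "M - insert i L = M - L - {i}" by auto
    have cd: "card (M - L) = Suc (card (M - insert i L))"
      unfolding e using that finM by (metis card_Suc_Diff1 finite_Diff)
    have c: "cross q (insert i L) (M - insert i L) = g (M - L - {i}) i * cross q L (M - L - {i})"
      by (subst cross_insert_left) (use that fin in \<open>auto simp: g_def e\<close>)
    have pr: "(\<Prod>j\<in>insert i L. j - \<beta>) = (i - \<beta>) * (\<Prod>j\<in>L. j - \<beta>)" "card (insert i L) = Suc (card L)"
      using that fin by auto
    show ?thesis unfolding W_def X_def c pr cd k_Suc r_def by (simp add: e algebra_simps)
  qed
  \<comment> \<open>Both residues at \<open>i\<close> are brought to the same \<open>L\<close>. Then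
    \<open>(w - \<beta>) * (1 - \<alpha> * i) - (1 - \<alpha> * w) * (i - \<beta>) = (1 - \<alpha> *
    \<beta>) * (w - i)\<close> cancels the pole; \<open>\<psi>\<close> is what the chosen kernel
    leaves of it.\<close>
  have poles: "(\<Sum>I\<in>Pow M. W I * p I * (w - \<beta>) *
        (\<Sum>j\<in>M - I. (1 - q) * \<phi> j * g (M - I - {j}) j)) -
      (\<Sum>I\<in>Pow M. W I * r I * (1 - \<alpha> * w) *
        (\<Sum>i\<in>I. (1 - q) * \<phi> i * h (I - {i}) i)) =
      (1 - q) * (1 - \<alpha> * \<beta>) * (\<Sum>L\<in>Pow M. \<Sum>i\<in>M - L. X L i * \<psi> i)"
    if \<phi>: "\<And>i. i \<in> M \<Longrightarrow> \<phi> i * (w - i) = \<psi> i" for w \<phi> \<psi>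
  proof -
    have "(\<Sum>I\<in>Pow M. W I * p I * (w - \<beta>) *
        (\<Sum>j\<in>M - I. (1 - q) * \<phi> j * g (M - I - {j}) j)) =
      (\<Sum>L\<in>Pow M. \<Sum>i\<in>M - L. (w - \<beta>) * (1 - q) * \<phi> i * (X L i * (1 - \<alpha> * i)))"
      unfolding sum_distrib_left
      by (intro sum.cong refl, subst X1[symmetric]) (auto simp: algebra_simps)
    moreover have "(\<Sum>I\<in>Pow M. W I * r I * (1 - \<alpha> * w) *
        (\<Sum>i\<in>I. (1 - q) * \<phi> i * h (I - {i}) i)) =
      (\<Sum>L\<in>Pow M. \<Sum>i\<in>M - L. (1 - \<alpha> * w) * (1 - q) * \<phi> i * (X L i * (i - \<beta>)))"
      unfolding sum_distrib_left
      by (subst sum_Pow_move_element[OF finM], intro sum.cong refl, subst X2[symmetric])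
        (auto simp: algebra_simps)
    moreover have "(w - \<beta>) * (1 - q) * \<phi> i * (X L i * (1 - \<alpha> * i)) -
        (1 - \<alpha> * w) * (1 - q) * \<phi> i * (X L i * (i - \<beta>)) =
        (1 - q) * (1 - \<alpha> * \<beta>) * (X L i * \<psi> i)" if "i \<in> M" for L i
      unfolding \<phi>[OF that, symmetric] by algebra
    ultimately show ?thesis
      by (simp add: sum_subtractf[symmetric] sum_distrib_left)
  qed
  define c where "c = (1 - q) * (1 - \<alpha> * \<beta>)"
  have expand_poles: "cluster_sum q \<theta> \<alpha> \<beta> (insert w M) =
      (\<Sum>I\<in>Pow M. W I * (p I * (w - \<beta>) * G I + r I * (1 - \<alpha> * w) * H I)) +
      c * (\<Sum>L\<in>Pow M. \<Sum>i\<in>M - L. X L i * \<psi> i)"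
    if w: "w \<notin> M" and \<phi>: "\<And>i. i \<in> M \<Longrightarrow> \<phi> i * (w - i) = \<psi> i"
      and G: "\<And>I. I \<in> Pow M \<Longrightarrow> g (M - I) w = G I + (\<Sum>j\<in>M - I. (1 - q) * \<phi> j * g (M - I - {j}) j)"
      and H: "\<And>I. I \<in> Pow M \<Longrightarrow> h I w = H I - (\<Sum>i\<in>I. (1 - q) * \<phi> i * h (I - {i}) i)"
    for w \<phi> \<psi> G H
  proof -
    let ?G = "\<lambda>I. \<Sum>j\<in>M - I. (1 - q) * \<phi> j * g (M - I - {j}) j"
    let ?H = "\<lambda>I. \<Sum>i\<in>I. (1 - q) * \<phi> i * h (I - {i}) i"
    have "cluster_sum q \<theta> \<alpha> \<beta> (insert w M) =
        (\<Sum>I\<in>Pow M. W I * (p I * (w - \<beta>) * G I + r I * (1 - \<alpha> * w) * H I) +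
          (W I * p I * (w - \<beta>) * ?G I - W I * r I * (1 - \<alpha> * w) * ?H I))"
      unfolding expand[OF w] by (intro sum.cong refl) (simp add: G H, algebra)
    then show ?thesis
      using poles[where w = w and \<phi> = \<phi> and \<psi> = \<psi>, OF \<phi>] by (simp add: sum.distrib sum_subtractf c_def)
  qed
  define B1 where "B1 = (\<Sum>I\<in>Pow M. W I * (p I * q ^ card (M - I) - \<alpha> * r I)) + c * (\<Sum>L\<in>Pow M. \<Sum>i\<in>M - L. X L i)"
  define A2 where "A2 = (\<Sum>I\<in>Pow M. W I * (- \<beta> * p I + r I * q ^ card I)) + c * (\<Sum>L\<in>Pow M. \<Sum>i\<in>M - L. X L i * i)"
  define S where "S = (1 - \<alpha> * \<beta> * q ^ card M) * cluster_sum q \<theta> \<alpha> \<beta> M"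
  text \<open>As a function of \<open>w\<close>, the sum is affine. The two forms of the partial fraction expansions show
    its constant and its linear coefficient.\<close>
  have form1: "cluster_sum q \<theta> \<alpha> \<beta> (insert w M) = S + w * B1" if w: "w \<notin> M" for w
  proof -
    have "cluster_sum q \<theta> \<alpha> \<beta> (insert w M) =
        (\<Sum>I\<in>Pow M. W I * (p I * (w - \<beta>) * q ^ card (M - I) + r I * (1 - \<alpha> * w) * 1)) +
        c * (\<Sum>L\<in>Pow M. \<Sum>i\<in>M - L. X L i * w)"
    proof (rule expand_poles[OF w, where \<phi> = "\<lambda>i. w / (w - i)"])
      fix I assume I: "I \<in> Pow M"
      show "g (M - I) w = q ^ card (M - I) + (\<Sum>j\<in>M - I. (1 - q) * (w / (w - j)) * g (M - I - {j}) j)"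
        unfolding g_def using finM w by (subst prod_scattering_right(2)) auto
      show "h I w = 1 - (\<Sum>i\<in>I. (1 - q) * (w / (w - i)) * h (I - {i}) i)"
        unfolding h_def using fin[OF I] I w by (subst prod_scattering_left(2)) auto
    qed (use w in auto)
    also have "(\<Sum>I\<in>Pow M. W I * (p I * (w - \<beta>) * q ^ card (M - I) + r I * (1 - \<alpha> * w) * 1)) =
        (\<Sum>I\<in>Pow M. (1 - \<alpha> * \<beta> * q ^ card M) * W I + w * (W I * (p I * q ^ card (M - I) - \<alpha> * r I)))"
      by (intro sum.cong refl) (simp only: card[symmetric] power_add p_def r_def, algebra)
    finally show ?thesis unfolding S_def B1_def SM
      by (simp add: sum.distrib sum_distrib_left sum_distrib_right distrib_left mult_ac)
  qed
  have form2: "cluster_sum q \<theta> \<alpha> \<beta> (insert w M) = A2 + w * (\<theta> * S)" if w: "w \<notin> M" for w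
  proof -
    have "cluster_sum q \<theta> \<alpha> \<beta> (insert w M) =
        (\<Sum>I\<in>Pow M. W I * (p I * (w - \<beta>) * 1 + r I * (1 - \<alpha> * w) * q ^ card I)) +
        c * (\<Sum>L\<in>Pow M. \<Sum>i\<in>M - L. X L i * i)"
    proof (rule expand_poles[OF w, where \<phi> = "\<lambda>i. i / (w - i)"])
      fix I assume I: "I \<in> Pow M"
      show "g (M - I) w = 1 + (\<Sum>j\<in>M - I. (1 - q) * (j / (w - j)) * g (M - I - {j}) j)"
        unfolding g_def using finM w by (subst prod_scattering_right(1)) auto
      show "h I w = q ^ card I - (\<Sum>i\<in>I. (1 - q) * (i / (w - i)) * h (I - {i}) i)"
        unfolding h_def using fin[OF I] I w by (subst prod_scattering_left(1)) auto
    qed (use w in auto)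
    also have "(\<Sum>I\<in>Pow M. W I * (p I * (w - \<beta>) * 1 + r I * (1 - \<alpha> * w) * q ^ card I)) =
        (\<Sum>I\<in>Pow M. W I * (- \<beta> * p I + r I * q ^ card I) + w * (\<theta> * ((1 - \<alpha> * \<beta> * q ^ card M) * W I)))"
      by (intro sum.cong refl) (simp only: card[symmetric] power_add p_def r_def, algebra)
    finally show ?thesis unfolding S_def A2_def SM
      by (simp add: sum.distrib sum_distrib_left sum_distrib_right distrib_left mult_ac)
  qed
  \<comment> \<open>Both forms hold only off \<open>M\<close>, but \<open>M\<close> is finite: two
    points outside are enough to compare the linear coefficients of two affine functions.\<close>
  obtain w1 where w1: "w1 \<notin> M" using insert.hyps by blast
  obtain w2 where w2: "w2 \<notin> insert w1 M"
    using ex_new_if_finite[OF infinite_UNIV_char_0, of "insert w1 M"] finM by auto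
  have "S + w1 * B1 = A2 + w1 * (\<theta> * S)" "S + w2 * B1 = A2 + w2 * (\<theta> * S)"
    using form1 form2 w1 w2 by auto
  then have "(w1 - w2) * (B1 - \<theta> * S) = 0" by algebra
  then have "B1 = \<theta> * S" using w2 by auto
  then have "cluster_sum q \<theta> \<alpha> \<beta> (insert w M) = S * (1 + \<theta> * w)"
    using form1[OF insert.hyps(2)] by (simp add: algebra_simps)
  then show ?case
    using insert.hyps by (simp add: S_def insert.IH algebra_simps)
qed

section \<open>Symmetrized sums\<close>

primrec scatter :: "real \<Rightarrow> real list \<Rightarrow> real" where
  "scatter q [] = 1"
| "scatter q (x # xs) = (\<Prod>y\<in>set xs. (x - q * y) / (x - y)) * scatter q xs"

text \<open>A symmetrization over permutations of indices becomes a sum over the orderings of the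
  set of values, so that symmetry in the variables is built in. \<open>f k x\<close> is the
  contribution of the variable \<open>x\<close> when it receives the part \<open>k\<close>.\<close>

definition bethe :: "real \<Rightarrow> (nat \<Rightarrow> real \<Rightarrow> real) \<Rightarrow> nat list \<Rightarrow> real set \<Rightarrow> real" where
  "bethe q f ps U = (\<Sum>xs\<in>permutations_of_set U. scatter q xs * prod_list (map2 f ps xs))"

lemma scatter_append:
  assumes "distinct (xs @ ys)"
  shows "scatter q (xs @ ys) = cross q (set xs) (set ys) * (scatter q xs * scatter q ys)"
  using assms
proof (induction xs)
  case (Cons x xs)
  have "(\<Prod>y\<in>set xs \<union> set ys. (x - q * y) / (x - y)) =
      (\<Prod>y\<in>set xs. (x - q * y) / (x - y)) * (\<Prod>y\<in>set ys. (x - q * y) / (x - y))"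
    using Cons.prems by (intro prod.union_disjoint) auto
  then show ?case using Cons by (simp add: cross_insert_left)
qed simp

lemma sum_permutations_of_set_append:
  assumes "finite U" "k \<le> card U"
  shows "sum F (permutations_of_set U) = (\<Sum>I | I \<subseteq> U \<and> card I = k.
    \<Sum>ys\<in>permutations_of_set I. \<Sum>zs\<in>permutations_of_set (U - I). F (ys @ zs))"
proof -
  define Q where "Q = (SIGMA I:{I. I \<subseteq> U \<and> card I = k}. permutations_of_set I \<times> permutations_of_set (U - I))"
  have fin: "finite {I. I \<subseteq> U \<and> card I = k}" "finite I" if "I \<subseteq> U" for I
    using assms(1) finite_subset that by auto
  have "sum F (permutations_of_set U) = (\<Sum>(I, ys, zs)\<in>Q. F (ys @ zs))"
  proof (rule sum.reindex_bij_witness[of _ "\<lambda>(I, ys, zs). ys @ zs" "\<lambda>xs. (set (take k xs), take k xs, drop k xs)"], goal_cases)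
    case (2 xs)
    then have xs: "set xs = U" "distinct xs" by (auto simp: permutations_of_set_def)
    then have "length xs = card U" using distinct_card by fastforce
    then have "card (set (take k xs)) = k" using xs assms by (simp add: distinct_card)
    moreover have "set (drop k xs) = U - set (take k xs)"
      using xs set_take_disj_set_drop_if_distinct[OF xs(2), of k k] set_append[of "take k xs" "drop k xs"]
      by auto
    ultimately show ?case using xs set_take_subset[of k xs] by (auto simp: Q_def permutations_of_set_def)
  next
    case (3 p)
    then obtain I ys zs where p: "p = (I, ys, zs)" "I \<subseteq> U" "card I = k" "set ys = I" "distinct ys"
      by (auto simp: Q_def permutations_of_set_def)
    then have "length ys = k" using distinct_card by fastforce
    then show ?case by (simp add: p)
  next
    case (4 p)
    then show ?case by (auto simp: Q_def permutations_of_set_def)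
  qed auto
  also have "\<dots> = (\<Sum>I | I \<subseteq> U \<and> card I = k. \<Sum>(ys, zs)\<in>permutations_of_set I \<times> permutations_of_set (U - I). F (ys @ zs))"
    unfolding Q_def using fin by (subst sum.Sigma) auto
  finally show ?thesis by (simp add: sum.cartesian_product)
qed

text \<open>\<open>I\<close> is the set of the variables that receive the parts \<open>ps\<close>.
  The scattering factors between \<open>I\<close> and its complement do not depend on the orderings
  inside the two blocks and come out as \<open>cross\<close>.\<close>

lemma bethe_append:
  assumes "finite U" "length ps + length rs = card U"
  shows "bethe q f (ps @ rs) U =
    (\<Sum>I | I \<subseteq> U \<and> card I = length ps. cross q I (U - I) * (bethe q f ps I * bethe q f rs (U - I)))"
proof -
  have *: "scatter q (ys @ zs) * prod_list (map2 f (ps @ rs) (ys @ zs)) = cross q I (U - I) *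
      (scatter q ys * prod_list (map2 f ps ys) * (scatter q zs * prod_list (map2 f rs zs)))"
    if "I \<subseteq> U" "card I = length ps" "ys \<in> permutations_of_set I" "zs \<in> permutations_of_set (U - I)" for I ys zs
  proof -
    have **: "set ys = I" "distinct ys" "set zs = U - I" "distinct zs"
      using that by (auto simp: permutations_of_set_def)
    then have "length ys = length ps" using that distinct_card by fastforce
    moreover have "distinct (ys @ zs)" using ** by auto
    ultimately show ?thesis using ** by (simp add: scatter_append)
  qed
  show ?thesis unfolding bethe_def sum_product unfolding sum_distrib_left
    by (subst sum_permutations_of_set_append[where k = "length ps"])
      (use assms in \<open>auto simp: * intro!: sum.cong\<close>)
qed

section \<open>q-Pochhammer symbols and groups of equal parts\<close>

lemma qpochhammer_0 [simp]: "qpochhammer a q 0 = 1"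
  and qpochhammer_Suc: "qpochhammer a q (Suc k) = qpochhammer a q k * (1 - a * q ^ k)"
  by (simp_all add: qpochhammer_def)

lemma qpochhammer_eq: "qpochhammer a q k = (\<Prod>r<k. 1 - a * q ^ r)"
  by (induction k) (simp_all add: qpochhammer_Suc)

lemma qpochhammer_nonzero:
  assumes "0 \<le> q" "q < 1" "\<bar>a\<bar> < 1"
  shows "qpochhammer a q k \<noteq> 0"
proof -
  have "a * q ^ r \<noteq> 1" for r
  proof -
    have "\<bar>a * q ^ r\<bar> \<le> \<bar>a\<bar> * 1"
      unfolding abs_mult using assms by (intro mult_left_mono) (auto simp: power_le_one)
    then show ?thesis using assms by auto
  qed
  then show ?thesis by (auto simp: qpochhammer_eq)
qed

lemma sum_card_1:
  "(\<Sum>I | I \<subseteq> U \<and> card I = Suc 0. F I) = (\<Sum>x\<in>U. F {x})"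
  by (rule sum.reindex_bij_witness[of _ "\<lambda>x. {x}" the_elem]) (auto simp: card_1_singleton_iff)

text \<open>The difference of the two partial fraction expansions of the same product at an
  auxiliary point \<open>w\<close>, since \<open>w / (w - x) - x / (w - x) = 1\<close>. It does not
  depend on \<open>w\<close> any more.\<close>

lemma sum_scattering_right:
  fixes q :: real
  assumes "finite U" "q < 1"
  shows "(\<Sum>x\<in>U. cross q {x} (U - {x})) = (1 - q ^ card U) / (1 - q)"
proof -
  obtain w where w: "w \<notin> U" using assms ex_new_if_finite infinite_UNIV_char_0 by blast
  have "(1 - q) * (w / (w - x)) * c - (1 - q) * (x / (w - x)) * c = (1 - q) * c" if "x \<in> U" for x c
    using that w by (subst left_diff_distrib[symmetric], subst right_diff_distrib[symmetric],
      subst diff_divide_distrib[symmetric]) auto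
  then have "(\<Sum>x\<in>U. (1 - q) * (w / (w - x)) * (\<Prod>l\<in>U - {x}. (x - q * l) / (x - l))) -
      (\<Sum>x\<in>U. (1 - q) * (x / (w - x)) * (\<Prod>l\<in>U - {x}. (x - q * l) / (x - l))) =
      (1 - q) * (\<Sum>x\<in>U. cross q {x} (U - {x}))"
    by (simp add: sum_subtractf[symmetric] sum_distrib_left cross_def)
  then show ?thesis
    using prod_scattering_right[OF assms(1) w, of q] assms by (simp add: field_simps)
qed

text \<open>With equal parts the product of the \<open>f\<close> is symmetric and can be taken out.
  The scattering factors, summed over all orderings, give the q-factorial: peeling off the first
  variable contributes \<open>(1 - q ^ m) / (1 - q)\<close> for a set of m elements.\<close>

lemma bethe_replicate:
  assumes "finite U" "card U = m" "0 \<le> q" "q < 1"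
  shows "bethe q f (replicate m k) U = qpochhammer q q m / (1 - q) ^ m * (\<Prod>x\<in>U. f k x)"
  using assms(1,2)
proof (induction m arbitrary: U)
  case 0
  then show ?case by (simp add: bethe_def)
next
  case (Suc m)
  have "bethe q f (replicate (Suc m) k) U = bethe q f ([k] @ replicate m k) U" by simp
  also have "\<dots> = (\<Sum>x\<in>U. cross q {x} (U - {x}) * (bethe q f [k] {x} * bethe q f (replicate m k) (U - {x})))"
    using Suc.prems by (subst bethe_append) (auto simp: sum_card_1)
  also have "\<dots> = (\<Sum>x\<in>U. cross q {x} (U - {x})) * (qpochhammer q q m / (1 - q) ^ m * (\<Prod>x\<in>U. f k x))"
    unfolding sum_distrib_right
  proof (intro sum.cong refl, goal_cases)
    case (1 x)
    have "bethe q f (replicate m k) (U - {x}) = qpochhammer q q m / (1 - q) ^ m * (\<Prod>x\<in>U - {x}. f k x)"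
      using Suc 1 by (intro Suc.IH) auto
    moreover have "bethe q f [k] {x} = f k x" by (simp add: bethe_def)
    moreover have "(\<Prod>x\<in>U. f k x) = f k x * (\<Prod>x\<in>U - {x}. f k x)"
      using 1 Suc.prems by (simp add: prod.remove)
    ultimately show ?case by simp
  qed
  finally show ?case
    using Suc.prems assms by (simp add: sum_scattering_right qpochhammer_Suc)
qed

lemma sum_Pow_card:
  assumes "finite U"
  shows "sum F (Pow U) = (\<Sum>a\<le>card U. \<Sum>I | I \<subseteq> U \<and> card I = a. F I)"
proof -
  have "sum F (Pow U) = (\<Sum>a\<le>card U. sum F {I \<in> Pow U. card I = a})"
    using assms by (intro sum.group[symmetric]) (auto simp: card_mono)
  then show ?thesis by simp
qed

lemma sum_bethe_cluster:
  assumes U: "finite U" "card U = m" and q: "0 \<le> q" "q < 1"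
    and \<alpha>: "\<And>x. x \<in> U \<Longrightarrow> 1 - \<alpha> * x \<noteq> 0"
    and f: "\<And>x. x \<in> U \<Longrightarrow> f (Suc k) x = (x - \<beta>) / (1 - \<alpha> * x) * f k x"
  shows "(\<Sum>a\<le>m. (\<Prod>r<a. \<theta> + \<alpha> * q ^ r) * (\<Prod>r<m - a. 1 + \<beta> * \<theta> * q ^ r) /
        (qpochhammer q q a * qpochhammer q q (m - a)) *
        bethe q f (replicate a (Suc k) @ replicate (m - a) k) U) =
      qpochhammer (\<alpha> * \<beta>) q m / qpochhammer q q m *
      (\<Prod>x\<in>U. (1 + \<theta> * x) / (1 - \<alpha> * x)) * bethe q f (replicate m k) U" (is "?l = ?r")
proof -
  \<comment> \<open>With \<open>P\<close> taken out, a variable in \<open>I\<close> keeps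
    \<open>x - \<beta>\<close> and any other one \<open>1 - \<alpha> * x\<close>, which are the
    factors of \<open>cluster_sum\<close>.\<close>
  define P where "P = (\<Prod>x\<in>U. f k x / (1 - \<alpha> * x))"
  have qnz: "qpochhammer q q n \<noteq> 0" for n using q by (intro qpochhammer_nonzero) auto
  have *: "(\<Prod>r<card I. \<theta> + \<alpha> * q ^ r) * (\<Prod>r<card (U - I). 1 + \<beta> * \<theta> * q ^ r) /
        (qpochhammer q q (card I) * qpochhammer q q (card (U - I))) *
        (cross q I (U - I) * (bethe q f (replicate (card I) (Suc k)) I * bethe q f (replicate (card (U - I)) k) (U - I))) =
      (\<Prod>r<card I. \<theta> + \<alpha> * q ^ r) * (\<Prod>r<card (U - I). 1 + \<beta> * \<theta> * q ^ r) *
        cross q I (U - I) * (\<Prod>i\<in>I. i - \<beta>) * (\<Prod>j\<in>U - I. 1 - \<alpha> * j) * (P / (1 - q) ^ m)"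
    if "I \<subseteq> U" for I
  proof -
    have fin: "finite I" "finite (U - I)" using that U finite_subset by auto
    have m: "card I + card (U - I) = m" using U that fin card_mono[OF U(1) that] by (simp add: card_Diff_subset)
    have "(\<Prod>x\<in>I. f (Suc k) x) = (\<Prod>x\<in>I. x - \<beta>) * (\<Prod>x\<in>I. f k x / (1 - \<alpha> * x))"
      unfolding prod.distrib[symmetric] using that by (intro prod.cong) (auto simp: f subset_eq)
    moreover have "(\<Prod>x\<in>U - I. f k x) = (\<Prod>x\<in>U - I. 1 - \<alpha> * x) * (\<Prod>x\<in>U - I. f k x / (1 - \<alpha> * x))"
      unfolding prod.distrib[symmetric] using \<alpha> by (intro prod.cong) auto
    moreover have "P = (\<Prod>x\<in>U - I. f k x / (1 - \<alpha> * x)) * (\<Prod>x\<in>I. f k x / (1 - \<alpha> * x))"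
      unfolding P_def by (rule prod.subset_diff[OF that U(1)])
    ultimately show ?thesis
      using fin q by (simp add: bethe_replicate m[symmetric] power_add qnz)
  qed
  have "?l = (\<Sum>a\<le>m. \<Sum>I | I \<subseteq> U \<and> card I = a.
      (\<Prod>r<card I. \<theta> + \<alpha> * q ^ r) * (\<Prod>r<card (U - I). 1 + \<beta> * \<theta> * q ^ r) *
        cross q I (U - I) * (\<Prod>i\<in>I. i - \<beta>) * (\<Prod>j\<in>U - I. 1 - \<alpha> * j) * (P / (1 - q) ^ m))"
  proof (intro sum.cong refl, goal_cases)
    case (1 a)
    have c: "card (U - I) = m - card I" if "I \<subseteq> U" for I
      using that U by (simp add: card_Diff_subset finite_subset)
    have "bethe q f (replicate a (Suc k) @ replicate (m - a) k) U =
        (\<Sum>I | I \<subseteq> U \<and> card I = a. cross q I (U - I) *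
          (bethe q f (replicate a (Suc k)) I * bethe q f (replicate (m - a) k) (U - I)))"
      using U 1 by (subst bethe_append) auto
    then show ?case
      by (simp only: sum_distrib_left) (intro sum.cong refl, subst *[symmetric], auto simp: c)
  qed
  also have "\<dots> = cluster_sum q \<theta> \<alpha> \<beta> U * (P / (1 - q) ^ m)"
    unfolding cluster_sum_def sum_distrib_right using U by (subst sum_Pow_card) auto
  also have "\<dots> = ?r"
  proof -
    have "(\<Prod>i\<in>U. 1 + \<theta> * i) * P = (\<Prod>x\<in>U. (1 + \<theta> * x) / (1 - \<alpha> * x)) * (\<Prod>x\<in>U. f k x)"
      unfolding P_def prod.distrib[symmetric] by simp
    then show ?thesis using U q by (simp add: cluster_sum_eq bethe_replicate qpochhammer_eq[symmetric] qnz)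
  qed
  finally show ?thesis .
qed

section \<open>The Cauchy identity\<close>

definition diagram_tail :: "(nat \<Rightarrow> nat) \<Rightarrow> nat \<Rightarrow> nat" where
  "diagram_tail lam j = lam (Suc j)"

text \<open>The parts are padded with zeros to \<open>n\<close> entries. The offset \<open>k\<close>
  counts the columns already removed: dropping the first entry of \<open>lam\<close> lowers each
  positive part of the transpose by one, and \<open>Suc k\<close> makes up for this.\<close>

definition part_list :: "nat \<Rightarrow> (nat \<Rightarrow> nat) \<Rightarrow> nat \<Rightarrow> nat list" where
  "part_list n lam k = map (\<lambda>i. k + transposed lam i) [0..<n]"

text \<open>The diagrams \<open>lam\<close> and \<open>kap\<close> of this section are the transposed ones, so that \<open>lam 0\<close> is the number of
  nonzero parts in the spin Hall-Littlewood function and \<open>n\<close> its number of variables.\<close>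

definition covers :: "nat \<Rightarrow> (nat \<Rightarrow> nat) \<Rightarrow> (nat \<Rightarrow> nat) set" where
  "covers n kap = {lam \<in> young_diagrams. interlaces kap lam \<and> lam 0 \<le> n}"

text \<open>The condition \<open>lam x = 0\<close> holds wherever the dual function in
  \<open>x\<close> variables is nonzero (\<open>dual_spin_qW_eq_0\<close>). Together with the bound
  on the first entry it makes all sums finite.\<close>

definition diagrams :: "nat \<Rightarrow> nat \<Rightarrow> (nat \<Rightarrow> nat) set" where
  "diagrams x n = {lam \<in> young_diagrams. lam x = 0 \<and> lam 0 \<le> n}"

lemma young_antimono: "lam \<in> young_diagrams \<Longrightarrow> i \<le> j \<Longrightarrow> lam j \<le> lam i"
  by (auto simp: young_diagrams_def antimono_def)

lemma young_zero: "lam \<in> young_diagrams \<Longrightarrow> lam i = 0 \<Longrightarrow> i \<le> j \<Longrightarrow> lam j = 0"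
  using young_antimono[of lam i j] by simp

lemma young_diagram_tail: "lam \<in> young_diagrams \<Longrightarrow> diagram_tail lam \<in> young_diagrams"
proof -
  assume lam: "lam \<in> young_diagrams"
  have "finite (Suc -` {i. lam i \<noteq> 0})"
    using lam by (intro finite_vimageI) (auto simp: young_diagrams_def)
  then show "diagram_tail lam \<in> young_diagrams"
    using lam by (auto simp: young_diagrams_def antimono_def diagram_tail_def vimage_def)
qed

lemma young_case_nat:
  assumes "lam \<in> young_diagrams" "lam 0 \<le> l"
  shows "case_nat l lam \<in> young_diagrams"
proof -
  have "{i. case_nat l lam i \<noteq> 0} \<subseteq> insert 0 (Suc ` {i. lam i \<noteq> 0})"
  proof
    fix i assume "i \<in> {i. case_nat l lam i \<noteq> 0}"
    then show "i \<in> insert 0 (Suc ` {i. lam i \<noteq> 0})" by (cases i) auto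
  qed
  moreover have "finite (insert 0 (Suc ` {i. lam i \<noteq> 0}))"
    using assms by (auto simp: young_diagrams_def)
  ultimately have "finite {i. case_nat l lam i \<noteq> 0}" by (rule finite_subset)
  moreover have "case_nat l lam j \<le> case_nat l lam i" if "i \<le> j" for i j
  proof (cases i; cases j)
    fix j' assume "i = 0" "j = Suc j'"
    then show ?thesis using young_antimono[OF assms(1), of 0 j'] assms(2) by simp
  qed (use that young_antimono[OF assms(1)] in auto)
  ultimately show ?thesis by (simp add: young_diagrams_def antimono_def)
qed

lemma finite_diagrams: "finite (diagrams x n)"
proof (rule finite_subset)
  show "finite {f. \<forall>i. (i \<in> {..<x} \<longrightarrow> f i \<in> {..n}) \<and> (i \<notin> {..<x} \<longrightarrow> f i = (0::nat))}"
    by (rule finite_set_of_finite_funs) auto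
  show "diagrams x n \<subseteq> {f. \<forall>i. (i \<in> {..<x} \<longrightarrow> f i \<in> {..n}) \<and> (i \<notin> {..<x} \<longrightarrow> f i = 0)}"
  proof
    fix lam assume "lam \<in> diagrams x n"
    then have lam: "lam \<in> young_diagrams" "lam x = 0" "lam 0 \<le> n" by (auto simp: diagrams_def)
    have "lam i \<le> n" for i using young_antimono[OF lam(1), of 0 i] lam(3) by simp
    moreover have "lam i = 0" if "\<not> i < x" for i using young_zero[OF lam(1,2)] that by simp
    ultimately show "lam \<in> {f. \<forall>i. (i \<in> {..<x} \<longrightarrow> f i \<in> {..n}) \<and> (i \<notin> {..<x} \<longrightarrow> f i = 0)}" by simp
  qed
qed

lemma finite_parts_ge: "lam \<in> young_diagrams \<Longrightarrow> finite {i. lam i \<ge> Suc j}"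
  by (rule finite_subset[of _ "{i. lam i \<noteq> 0}"]) (auto simp: young_diagrams_def)

lemma transposed_eq_0_iff: "lam \<in> young_diagrams \<Longrightarrow> transposed lam j = 0 \<longleftrightarrow> lam 0 \<le> j"
  using finite_parts_ge[of lam j] young_antimono[of lam 0]
  by (auto simp: transposed_def not_less_eq_eq) (meson le_trans not_less_eq_eq)

lemma transposed_shift:
  assumes "lam \<in> young_diagrams" "j < lam 0"
  shows "transposed lam j = Suc (transposed (diagram_tail lam) j)"
proof -
  have "{i. lam i \<ge> Suc j} = insert 0 (Suc ` {i. diagram_tail lam i \<ge> Suc j})"
    using assms(2) by (auto simp: diagram_tail_def image_iff) (metis Suc_le_eq not0_implies_Suc)
  moreover have "finite {i. diagram_tail lam i \<ge> Suc j}"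
    using assms young_diagram_tail finite_parts_ge by blast
  ultimately show ?thesis by (simp add: transposed_def card_image)
qed

lemma map_upt_append:
  "m \<le> n \<Longrightarrow> map f [0..<n] = map f [0..<m] @ map f [m..<n]"
  using upt_add_eq_append[of 0 m "n - m"] by simp

lemma parts_trunc:
  assumes "lam \<in> young_diagrams" "lam 0 \<le> m" "m \<le> n"
  shows "part_list n lam k = part_list m lam k @ replicate (n - m) k"
proof -
  have "map (\<lambda>i. k + transposed lam i) [m..<n] = map (\<lambda>i. k) [m..<n]"
    using assms by (intro map_cong) (auto simp: transposed_eq_0_iff)
  then show ?thesis
    unfolding part_list_def map_upt_append[OF assms(3)] by (simp add: map_replicate_const)
qed

lemma parts_shift:
  assumes "lam \<in> young_diagrams" "lam 0 \<le> n"
  shows "part_list n lam k = part_list (lam 0) (diagram_tail lam) (Suc k) @ replicate (n - lam 0) k"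
proof -
  have "part_list (lam 0) lam k = part_list (lam 0) (diagram_tail lam) (Suc k)"
    unfolding part_list_def using assms by (intro map_cong) (auto simp: transposed_shift)
  then show ?thesis using parts_trunc[OF assms(1) order_refl assms(2)] by simp
qed

text \<open>Because of \<open>lam 1 \<le> kap 0 \<le> lam 0\<close>, the tail has no positive part
  beyond the first \<open>kap 0\<close> positions; there the parts are k + 1 up to position
  \<open>lam 0\<close> and k afterwards.\<close>

lemma parts_covers:
  assumes "lam \<in> covers n kap"
  shows "part_list n lam k = part_list (kap 0) (diagram_tail lam) (Suc k) @
    (replicate (lam 0 - kap 0) (Suc k) @ replicate (n - lam 0) k)"
proof -
  have lam: "lam \<in> young_diagrams" "lam 0 \<le> n" "kap 0 \<le> lam 0" "diagram_tail lam 0 \<le> kap 0"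
    using assms by (auto simp: covers_def interlaces_def diagram_tail_def)
  show ?thesis unfolding parts_shift[OF lam(1,2)]
    by (subst parts_trunc[of _ "kap 0"]) (use lam young_diagram_tail in auto)
qed

lemma length_parts [simp]: "length (part_list n lam k) = n"
  by (simp add: part_list_def)

text \<open>For given \<open>kap\<close> the interlacing conditions decouple: the first entry of
  \<open>lam\<close> ranges over an interval, and the tail independently covers the tail of
  \<open>kap\<close>, with \<open>kap 0\<close> as the new bound.\<close>

lemma sum_covers:
  assumes kap: "kap \<in> young_diagrams" "kap 0 \<le> n"
  shows "(\<Sum>lam\<in>covers n kap. F (lam 0) (diagram_tail lam)) =
    (\<Sum>l\<in>{kap 0..n}. \<Sum>lam\<in>covers (kap 0) (diagram_tail kap). F l lam)"
proof -
  have "(\<Sum>lam\<in>covers n kap. F (lam 0) (diagram_tail lam)) =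
      (\<Sum>(l, lam)\<in>{kap 0..n} \<times> covers (kap 0) (diagram_tail kap). F l lam)"
  proof (rule sum.reindex_bij_witness[of _ "\<lambda>(l, lam). case_nat l lam" "\<lambda>lam. (lam 0, diagram_tail lam)"], goal_cases)
    case (1 lam)
    then show ?case by (auto simp: diagram_tail_def fun_eq_iff split: nat.splits)
  next
    case (2 lam)
    then show ?case by (auto simp: covers_def interlaces_def diagram_tail_def young_diagram_tail)
  next
    case (3 p)
    then show ?case by (auto simp: diagram_tail_def)
  next
    case (4 p)
    then obtain l lam where p: "p = (l, lam)" "kap 0 \<le> l" "l \<le> n" "lam \<in> young_diagrams"
      "\<And>i. kap (Suc i) \<le> lam i" "\<And>i. lam (Suc i) \<le> kap (Suc i)" "lam 0 \<le> kap 0"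
      by (auto simp: covers_def interlaces_def diagram_tail_def)
    then show ?case
      by (auto simp: covers_def interlaces_def intro!: young_case_nat split: nat.splits)
  qed (auto simp: diagram_tail_def)
  then show ?thesis by (simp add: sum.cartesian_product)
qed

text \<open>The variables in \<open>I\<close> take the first \<open>kap 0\<close> parts and are
  governed by the tails alone. The complement is one group of \<open>n - kap 0\<close> variables, of
  which \<open>a\<close> move up from k to k + 1. \<open>\<omega>\<close> and \<open>G\<close> are
  the weights of these two independent choices.\<close>

lemma sum_covers_bethe:
  assumes kap: "kap \<in> young_diagrams" "kap 0 \<le> n" and U: "finite U" "card U = n"
  shows "(\<Sum>lam\<in>covers n kap. \<omega> (lam 0 - kap 0) * G (diagram_tail lam) * bethe q f (part_list n lam k) U) =
    (\<Sum>I | I \<subseteq> U \<and> card I = kap 0. cross q I (U - I) *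
      ((\<Sum>lam\<in>covers (kap 0) (diagram_tail kap). G lam * bethe q f (part_list (kap 0) lam (Suc k)) I) *
       (\<Sum>a\<le>n - kap 0. \<omega> a * bethe q f (replicate a (Suc k) @ replicate (n - kap 0 - a) k) (U - I))))"
    (is "_ = ?r")
proof -
  have "(\<Sum>lam\<in>covers n kap. \<omega> (lam 0 - kap 0) * G (diagram_tail lam) * bethe q f (part_list n lam k) U) =
      (\<Sum>lam\<in>covers n kap. \<omega> (lam 0 - kap 0) * G (diagram_tail lam) *
        bethe q f (part_list (kap 0) (diagram_tail lam) (Suc k) @
          (replicate (lam 0 - kap 0) (Suc k) @ replicate (n - lam 0) k)) U)"
    by (intro sum.cong refl) (simp add: parts_covers)
  also have "\<dots> = (\<Sum>l\<in>{kap 0..n}. \<Sum>lam\<in>covers (kap 0) (diagram_tail kap). \<omega> (l - kap 0) * G lam *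
        bethe q f (part_list (kap 0) lam (Suc k) @
          (replicate (l - kap 0) (Suc k) @ replicate (n - l) k)) U)"
    by (rule sum_covers[OF kap])
  also have "\<dots> = (\<Sum>a\<le>n - kap 0. \<Sum>lam\<in>covers (kap 0) (diagram_tail kap). \<omega> a * G lam *
        bethe q f (part_list (kap 0) lam (Suc k) @
          (replicate a (Suc k) @ replicate (n - kap 0 - a) k)) U)"
    by (rule sum.reindex_bij_witness[of _ "\<lambda>a. a + kap 0" "\<lambda>l. l - kap 0"]) (use kap in auto)
  also have "\<dots> = (\<Sum>a\<le>n - kap 0. \<Sum>lam\<in>covers (kap 0) (diagram_tail kap). \<Sum>I | I \<subseteq> U \<and> card I = kap 0.
        \<omega> a * G lam * (cross q I (U - I) * (bethe q f (part_list (kap 0) lam (Suc k)) I *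
          bethe q f (replicate a (Suc k) @ replicate (n - kap 0 - a) k) (U - I))))"
    by (intro sum.cong refl, subst bethe_append) (use kap U in \<open>auto simp: sum_distrib_left\<close>)
  also have "\<dots> = (\<Sum>I | I \<subseteq> U \<and> card I = kap 0. \<Sum>lam\<in>covers (kap 0) (diagram_tail kap). \<Sum>a\<le>n - kap 0.
        \<omega> a * G lam * (cross q I (U - I) * (bethe q f (part_list (kap 0) lam (Suc k)) I *
          bethe q f (replicate a (Suc k) @ replicate (n - kap 0 - a) k) (U - I))))"
    by (subst sum.swap, subst (2) sum.swap, subst sum.swap) (rule refl)
  also have "\<dots> = ?r"
    unfolding sum_product unfolding sum_distrib_left by (intro sum.cong refl) (simp add: mult_ac)
  finally show ?thesis .
qed

text \<open>The factors of \<open>F\<^sup>*\<^bsub>lam/kap\<^esub>\<close> are regrouped: \<open>site_weight\<close> takes the first factor for the index \<open>k + 1\<close>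
  together with the last two for \<open>k\<close>. The remaining factor belongs to the boundary.\<close>

definition site_weight :: "real \<Rightarrow> real \<Rightarrow> real \<Rightarrow> nat \<Rightarrow> nat \<Rightarrow> real" where
  "site_weight q s \<theta> m a = (\<Prod>r<a. \<theta> + s * q ^ r) * (\<Prod>r<m - a. 1 + s * \<theta> * q ^ r) /
     (qpochhammer q q a * qpochhammer q q (m - a)) * (qpochhammer q q m / qpochhammer (s\<^sup>2) q m)"

primrec bulk_weight :: "real \<Rightarrow> real \<Rightarrow> real \<Rightarrow> nat \<Rightarrow> nat \<Rightarrow> (nat \<Rightarrow> nat) \<Rightarrow> (nat \<Rightarrow> nat) \<Rightarrow> real" where
  "bulk_weight q s \<theta> 0 n lam kap = 1"
| "bulk_weight q s \<theta> (Suc N) n lam kap =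
     site_weight q s \<theta> (n - kap 0) (lam 0 - kap 0) * bulk_weight q s \<theta> N (kap 0) (diagram_tail lam) (diagram_tail kap)"

text \<open>The product over the first \<ell>(\<lambda>) variables is distributed to the single
  variables: these are exactly the ones with a nonzero part.\<close>

definition HL_factor :: "real \<Rightarrow> nat \<Rightarrow> real \<Rightarrow> real" where
  "HL_factor s k x = ((x - s) / (1 - s * x)) ^ k * (if k = 0 then 1 else x / (x - s))"

abbreviation cauchy_factor :: "real \<Rightarrow> real \<Rightarrow> real set \<Rightarrow> real" where
  "cauchy_factor s \<theta> U \<equiv> (\<Prod>x\<in>U. (1 + \<theta> * x) / (1 - s * x))"

text \<open>The symmetrized sums are eigenfunctions of the branching by one \<theta>, with the
  Cauchy factor as eigenvalue. Each level of equal parts is one cluster identity, and the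
  eigenvalues of disjoint sets of variables multiply. For k > 0 the quotient of consecutive
  \<open>HL_factor\<close>s is \<open>(x - s) / (1 - s * x)\<close>.\<close>

lemma bulk_eigenrelation:
  assumes q: "0 \<le> q" "q < 1" and s: "\<bar>s\<bar> < 1"
    and "kap \<in> young_diagrams" "kap 0 \<le> n" "finite U" "card U = n"
    and "\<And>x. x \<in> U \<Longrightarrow> 1 - s * x \<noteq> 0" "\<And>i. N \<le> Suc i \<Longrightarrow> kap i = 0" "N = 0 \<Longrightarrow> n = 0" "0 < k"
  shows "(\<Sum>lam\<in>covers n kap. bulk_weight q s \<theta> N n lam kap * bethe q (HL_factor s) (part_list n lam k) U) =
    cauchy_factor s \<theta> U * bethe q (HL_factor s) (part_list n kap k) U"
  using assms(4-)
proof (induction N arbitrary: n kap U k)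
  case 0
  then have "kap = (\<lambda>_. 0)" "n = 0" "U = {}" by auto
  moreover have "covers 0 (\<lambda>_. 0) = {\<lambda>_. 0}"
    using young_zero[of _ 0] by (auto simp: covers_def interlaces_def fun_eq_iff)
      (auto simp: young_diagrams_def antimono_def)
  ultimately show ?case by simp
next
  case (Suc N)
  define B where "B = bethe q (HL_factor s)"
  have qnz: "qpochhammer q q n \<noteq> 0" for n using q by (intro qpochhammer_nonzero) auto
  have snz: "qpochhammer (s\<^sup>2) q n \<noteq> 0" for n
    using q s by (intro qpochhammer_nonzero) (auto simp: abs_square_less_1)
  have fin: "finite I" if "I \<subseteq> U" for I using that Suc.prems finite_subset by auto
  have tail: "(\<Sum>lam\<in>covers (kap 0) (diagram_tail kap). bulk_weight q s \<theta> N (kap 0) lam (diagram_tail kap) *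
        B (part_list (kap 0) lam (Suc k)) I) = cauchy_factor s \<theta> I * B (part_list (kap 0) (diagram_tail kap) (Suc k)) I"
    if "I \<subseteq> U" "card I = kap 0" for I
    unfolding B_def
  proof (rule Suc.IH)
    show "diagram_tail kap 0 \<le> kap 0" using young_antimono[OF Suc.prems(1), of 0 1] by (simp add: diagram_tail_def)
    show "diagram_tail kap \<in> young_diagrams" by (rule young_diagram_tail[OF Suc.prems(1)])
  qed (use that Suc.prems fin in \<open>auto simp: diagram_tail_def\<close>)
  have head: "(\<Sum>a\<le>n - kap 0. site_weight q s \<theta> (n - kap 0) a *
        B (replicate a (Suc k) @ replicate (n - kap 0 - a) k) (U - I)) =
      cauchy_factor s \<theta> (U - I) * B (replicate (n - kap 0) k) (U - I)"
    if I: "I \<subseteq> U" "card I = kap 0" for I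
  proof -
    have c: "card (U - I) = n - kap 0" using I Suc.prems fin by (simp add: card_Diff_subset)
    have "HL_factor s (Suc k) x = (x - s) / (1 - s * x) * HL_factor s k x" for x
      using Suc.prems(8) by (simp add: HL_factor_def)
    \<comment> \<open>For \<alpha> = \<beta> = s the constant on the right side of the cluster
      identity is cancelled by the last quotient in \<open>site_weight\<close>.\<close>
    from sum_bethe_cluster[where \<alpha> = s and \<beta> = s and \<theta> = \<theta>, OF _ c q _ this]
    have "(\<Sum>a\<le>n - kap 0. (\<Prod>r<a. \<theta> + s * q ^ r) * (\<Prod>r<n - kap 0 - a. 1 + s * \<theta> * q ^ r) /
          (qpochhammer q q a * qpochhammer q q (n - kap 0 - a)) *
          B (replicate a (Suc k) @ replicate (n - kap 0 - a) k) (U - I)) *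
        (qpochhammer q q (n - kap 0) / qpochhammer (s\<^sup>2) q (n - kap 0)) =
      cauchy_factor s \<theta> (U - I) * B (replicate (n - kap 0) k) (U - I)"
      unfolding B_def using Suc.prems snz qnz by (simp add: power2_eq_square)
    then show ?thesis
      unfolding site_weight_def sum_distrib_right by (simp only: mult_ac)
  qed
  have "(\<Sum>lam\<in>covers n kap. bulk_weight q s \<theta> (Suc N) n lam kap * B (part_list n lam k) U) =
      (\<Sum>I | I \<subseteq> U \<and> card I = kap 0. cross q I (U - I) *
        ((cauchy_factor s \<theta> I * B (part_list (kap 0) (diagram_tail kap) (Suc k)) I) *
         (cauchy_factor s \<theta> (U - I) * B (replicate (n - kap 0) k) (U - I))))"
    unfolding bulk_weight.simps
    unfolding sum_covers_bethe[OF Suc.prems(1-4), of "site_weight q s \<theta> (n - kap 0)"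
        "\<lambda>lam. bulk_weight q s \<theta> N (kap 0) lam (diagram_tail kap)" q "HL_factor s" k, folded B_def]
    by (intro sum.cong refl) (simp add: head tail del: diff_diff_left)
  also have "\<dots> = cauchy_factor s \<theta> U * (\<Sum>I | I \<subseteq> U \<and> card I = kap 0. cross q I (U - I) *
        (B (part_list (kap 0) (diagram_tail kap) (Suc k)) I * B (replicate (n - kap 0) k) (U - I)))"
    unfolding sum_distrib_left
  proof (intro sum.cong refl, goal_cases)
    case (1 I)
    then have "cauchy_factor s \<theta> U = cauchy_factor s \<theta> (U - I) * cauchy_factor s \<theta> I"
      using Suc.prems by (intro prod.subset_diff) auto
    then show ?case by (simp add: mult_ac)
  qed
  also have "\<dots> = cauchy_factor s \<theta> U * B (part_list n kap k) U"
    unfolding parts_shift[OF Suc.prems(1,2)] B_def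
    by (subst bethe_append) (use Suc.prems in auto)
  finally show ?case by (simp add: B_def)
qed

text \<open>The level of the parts 0. Here the quotient of \<open>HL_factor\<close>s is
  \<open>x / (1 - s * x)\<close>, so \<beta> = 0: the second product of the cluster identity and its
  constant are 1. The denominator with \<open>n - lam 0\<close> comes from the normalization of the
  spin Hall-Littlewood function, which the relation reproduces for \<open>kap\<close>.\<close>

lemma boundary_eigenrelation:
  assumes q: "0 \<le> q" "q < 1" and s: "\<bar>s\<bar> < 1"
    and kap: "kap \<in> young_diagrams" "kap 0 \<le> n" "kap N = 0" and U: "finite U" "card U = n"
    and nz: "\<And>x. x \<in> U \<Longrightarrow> 1 - s * x \<noteq> 0" "\<And>x. x \<in> U \<Longrightarrow> x \<noteq> s"
  shows "(\<Sum>lam\<in>covers n kap. (\<Prod>r<lam 0 - kap 0. \<theta> + s * q ^ r) /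
      (qpochhammer q q (lam 0 - kap 0) * qpochhammer q q (n - lam 0)) *
      bulk_weight q s \<theta> N (kap 0) (diagram_tail lam) (diagram_tail kap) * bethe q (HL_factor s) (part_list n lam 0) U) =
    cauchy_factor s \<theta> U / qpochhammer q q (n - kap 0) * bethe q (HL_factor s) (part_list n kap 0) U"
proof -
  define B where "B = bethe q (HL_factor s)"
  define \<omega> where "\<omega> a = (\<Prod>r<a. \<theta> + s * q ^ r) /
      (qpochhammer q q a * qpochhammer q q (n - kap 0 - a))" for a
  have fin: "finite I" if "I \<subseteq> U" for I using that U finite_subset by auto
  have z: "kap i = 0" if "N \<le> i" for i using young_zero[OF kap(1,3) that] .
  have tail: "(\<Sum>lam\<in>covers (kap 0) (diagram_tail kap). bulk_weight q s \<theta> N (kap 0) lam (diagram_tail kap) *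
        B (part_list (kap 0) lam (Suc 0)) I) = cauchy_factor s \<theta> I * B (part_list (kap 0) (diagram_tail kap) (Suc 0)) I"
    if "I \<subseteq> U" "card I = kap 0" for I
    unfolding B_def
  proof (rule bulk_eigenrelation[OF q s])
    show "diagram_tail kap 0 \<le> kap 0" using young_antimono[OF kap(1), of 0 1] by (simp add: diagram_tail_def)
    show "diagram_tail kap \<in> young_diagrams" by (rule young_diagram_tail[OF kap(1)])
  qed (use that kap nz fin z in \<open>auto simp: diagram_tail_def\<close>)
  have head: "(\<Sum>a\<le>n - kap 0. \<omega> a * B (replicate a (Suc 0) @ replicate (n - kap 0 - a) 0) (U - I)) =
      cauchy_factor s \<theta> (U - I) / qpochhammer q q (n - kap 0) * B (replicate (n - kap 0) 0) (U - I)"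
    if I: "I \<subseteq> U" "card I = kap 0" for I
  proof -
    have c: "card (U - I) = n - kap 0" using I U fin by (simp add: card_Diff_subset)
    have "HL_factor s (Suc 0) x = (x - 0) / (1 - s * x) * HL_factor s 0 x" if "x \<in> U - I" for x
      using nz[of x] that by (auto simp: HL_factor_def)
    from sum_bethe_cluster[where \<alpha> = s and \<beta> = 0 and \<theta> = \<theta>, OF _ c q _ this] show ?thesis
      unfolding \<omega>_def B_def using U nz by (simp add: qpochhammer_eq[of 0])
  qed
  have "(\<Sum>lam\<in>covers n kap. \<omega> (lam 0 - kap 0) *
      bulk_weight q s \<theta> N (kap 0) (diagram_tail lam) (diagram_tail kap) * B (part_list n lam 0) U) =
      (\<Sum>I | I \<subseteq> U \<and> card I = kap 0. cross q I (U - I) *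
        ((cauchy_factor s \<theta> I * B (part_list (kap 0) (diagram_tail kap) (Suc 0)) I) *
         (cauchy_factor s \<theta> (U - I) / qpochhammer q q (n - kap 0) * B (replicate (n - kap 0) 0) (U - I))))"
    unfolding sum_covers_bethe[OF kap(1,2) U, of \<omega>
        "\<lambda>lam. bulk_weight q s \<theta> N (kap 0) lam (diagram_tail kap)" q "HL_factor s" 0, folded B_def]
    by (intro sum.cong refl) (simp add: head tail del: diff_diff_left)
  also have "\<dots> = cauchy_factor s \<theta> U / qpochhammer q q (n - kap 0) * (\<Sum>I | I \<subseteq> U \<and> card I = kap 0. cross q I (U - I) *
        (B (part_list (kap 0) (diagram_tail kap) (Suc 0)) I * B (replicate (n - kap 0) 0) (U - I)))"
    unfolding sum_distrib_left
  proof (intro sum.cong refl, goal_cases)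
    case (1 I)
    then have "cauchy_factor s \<theta> U = cauchy_factor s \<theta> (U - I) * cauchy_factor s \<theta> I"
      using U by (intro prod.subset_diff) auto
    then show ?case by (simp add: mult_ac)
  qed
  also have "\<dots> = cauchy_factor s \<theta> U / qpochhammer q q (n - kap 0) * B (part_list n kap 0) U"
    unfolding parts_shift[OF kap(1,2)] B_def
    by (subst bethe_append) (use U kap in auto)
  also have "(\<Sum>lam\<in>covers n kap. \<omega> (lam 0 - kap 0) *
      bulk_weight q s \<theta> N (kap 0) (diagram_tail lam) (diagram_tail kap) * B (part_list n lam 0) U) =
     (\<Sum>lam\<in>covers n kap. (\<Prod>r<lam 0 - kap 0. \<theta> + s * q ^ r) /
      (qpochhammer q q (lam 0 - kap 0) * qpochhammer q q (n - lam 0)) *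
      bulk_weight q s \<theta> N (kap 0) (diagram_tail lam) (diagram_tail kap) * B (part_list n lam 0) U)"
  proof (intro sum.cong refl, goal_cases)
    case (1 lam)
    then have "n - kap 0 - (lam 0 - kap 0) = n - lam 0" by (auto simp: covers_def interlaces_def)
    then show ?case by (simp add: \<omega>_def)
  qed
  finally show ?thesis by (simp add: B_def)
qed

section \<open>The branching coefficient as a product over levels\<close>

lemma scaled_qpochhammer:
  assumes "\<theta> \<noteq> 0"
  shows "\<theta> ^ a * qpochhammer (- s / \<theta>) q a = (\<Prod>r<a. \<theta> + s * q ^ r)"
proof (induction a)
  case (Suc a)
  have 1: "\<theta> * (1 - - s / \<theta> * q ^ a) = \<theta> + s * q ^ a" using assms by (simp add: distrib_left)
  have 2: "\<theta> ^ Suc a * (Q * X) = \<theta> ^ a * Q * (\<theta> * X)" for Q X by simp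
  show ?case unfolding qpochhammer_Suc 2 1 Suc.IH by simp
qed simp

lemma ell_young:
  assumes "lam \<in> young_diagrams"
  shows "{i. lam i \<noteq> 0} = {..<ell lam}"
proof -
  have "{i. lam i \<noteq> 0} = {..<card {i. lam i \<noteq> 0}}"
  proof -
    have fin: "finite {i. lam i \<noteq> 0}" using assms by (simp add: young_diagrams_def)
    define m where "m = (LEAST i. lam i = 0)"
    have "\<exists>i. lam i = 0" using ex_new_if_finite[OF infinite_UNIV_nat fin] by auto
    then have "lam m = 0" unfolding m_def by (rule LeastI_ex)
    then have "lam i = 0" if "m \<le> i" for i using young_zero[OF assms _ that] by simp
    moreover have "lam i \<noteq> 0" if "i < m" for i using that not_less_Least unfolding m_def by blast
    ultimately have "i \<in> {i. lam i \<noteq> 0} \<longleftrightarrow> i \<in> {..<m}" for i by (cases "i < m") auto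
    then have "{i. lam i \<noteq> 0} = {..<m}" by (rule set_eqI)
    then show ?thesis by simp
  qed
  then show ?thesis by (simp add: ell_def)
qed

lemma dual_spin_qW1_eq:
  assumes lam: "lam \<in> young_diagrams" "lam (Suc N) = 0" and kap: "kap N = 0" "interlaces kap lam"
    and \<theta>: "\<theta> \<noteq> 0"
  shows "dual_spin_qW1 q s \<theta> lam kap =
    (\<Prod>r<lam 0 - kap 0. \<theta> + s * q ^ r) / qpochhammer q q (lam 0 - kap 0) *
    bulk_weight q s \<theta> N (kap 0) (diagram_tail lam) (diagram_tail kap)"
proof -
  define J where "J a = (\<Prod>r<a. \<theta> + s * q ^ r) / qpochhammer q q a" for a
  define T where "T b = qpochhammer (- s * \<theta>) q b / qpochhammer q q b" for b
  define R where "R m = qpochhammer q q m / qpochhammer (s\<^sup>2) q m" for m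
  have JT0: "J 0 = 1" "T 0 = 1" "R 0 = 1" by (simp_all add: J_def T_def R_def)
  have stay: "qpochhammer (- s * \<theta>) q b = (\<Prod>r<b. 1 + s * \<theta> * q ^ r)" for b
    by (simp add: qpochhammer_eq)
  have site: "site_weight q s \<theta> m a = J a * T (m - a) * R m" for m a
    unfolding site_weight_def J_def T_def R_def stay by simp
  \<comment> \<open>The regrouping leaves over the last two factors of the index \<open>M\<close>.
    In the application to \<open>M = N\<close> they are 1, because \<open>kap N = 0\<close>.\<close>
  have step: "(\<Prod>k<Suc M. J (l k - p k) * T (p k - l (Suc k)) * R (p k - p (Suc k))) =
      J (l 0 - p 0) * bulk_weight q s \<theta> M (p 0) (diagram_tail l) (diagram_tail p) * (T (p M - l (Suc M)) * R (p M - p (Suc M)))"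
    if "\<And>k. p (Suc k) \<le> l (Suc k)" for l p :: "nat \<Rightarrow> nat" and M
    using that
  proof (induction M arbitrary: l p)
    case (Suc M)
    have "(\<Prod>k<Suc (Suc M). J (l k - p k) * T (p k - l (Suc k)) * R (p k - p (Suc k))) =
      J (l 0 - p 0) * T (p 0 - l 1) * R (p 0 - p 1) *
      (\<Prod>k<Suc M. J (diagram_tail l k - diagram_tail p k) * T (diagram_tail p k - diagram_tail l (Suc k)) * R (diagram_tail p k - diagram_tail p (Suc k)))"
      by (subst prod.lessThan_Suc_shift) (simp add: diagram_tail_def)
    also have "(\<Prod>k<Suc M. J (diagram_tail l k - diagram_tail p k) * T (diagram_tail p k - diagram_tail l (Suc k)) * R (diagram_tail p k - diagram_tail p (Suc k))) =
      J (diagram_tail l 0 - diagram_tail p 0) * bulk_weight q s \<theta> M (diagram_tail p 0) (diagram_tail (diagram_tail l)) (diagram_tail (diagram_tail p)) *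
      (T (diagram_tail p M - diagram_tail l (Suc M)) * R (diagram_tail p M - diagram_tail p (Suc M)))"
      by (rule Suc.IH) (use Suc.prems in \<open>simp add: diagram_tail_def\<close>)
    finally have E: "(\<Prod>k<Suc (Suc M). J (l k - p k) * T (p k - l (Suc k)) * R (p k - p (Suc k))) =
      J (l 0 - p 0) * T (p 0 - l 1) * R (p 0 - p 1) *
      (J (diagram_tail l 0 - diagram_tail p 0) * bulk_weight q s \<theta> M (diagram_tail p 0) (diagram_tail (diagram_tail l)) (diagram_tail (diagram_tail p)) *
      (T (diagram_tail p M - diagram_tail l (Suc M)) * R (diagram_tail p M - diagram_tail p (Suc M))))" .
    have e1: "p 0 - l 1 = p 0 - diagram_tail p 0 - (diagram_tail l 0 - diagram_tail p 0)"
      using Suc.prems[of 0] by (simp add: diagram_tail_def)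
    have e2: "p 1 = diagram_tail p 0" "p (Suc M) = diagram_tail p M" "l (Suc (Suc M)) = diagram_tail l (Suc M)"
        "p (Suc (Suc M)) = diagram_tail p (Suc M)"
      by (simp_all add: diagram_tail_def)
    show ?case unfolding E e1 e2 bulk_weight.simps site by (simp only: mult_ac)
  qed simp
  have "ell lam \<le> Suc N" 
  proof (rule ccontr)
    assume "\<not> ell lam \<le> Suc N"
    then have "Suc N \<in> {i. lam i \<noteq> 0}" unfolding ell_young[OF lam(1)] by simp
    then show False using lam(2) by simp
  qed
  have vanish: "lam k = 0" "kap k = 0" "lam (Suc k) = 0" "kap (Suc k) = 0" if "k \<ge> ell lam" for k
  proof -
    have "k \<notin> {i. lam i \<noteq> 0}" unfolding ell_young[OF lam(1)] using that by simp
    then show *: "lam k = 0" by simp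
    show "lam (Suc k) = 0" using young_zero[OF lam(1) *, of "Suc k"] by simp
    moreover note *
    moreover have "kap k \<le> lam k" "kap (Suc k) \<le> lam (Suc k)" using kap(2) by (simp_all add: interlaces_def)
    ultimately show "kap k = 0" "kap (Suc k) = 0" by simp_all
  qed
  have "dual_spin_qW1 q s \<theta> lam kap =
      (\<Prod>k<ell lam. J (lam k - kap k) * T (kap k - lam (Suc k)) * R (kap k - kap (Suc k)))"
    unfolding dual_spin_qW1_def J_def T_def R_def scaled_qpochhammer[OF \<theta>, symmetric] using kap(2) by simp
  also have "\<dots> = (\<Prod>k<Suc N. J (lam k - kap k) * T (kap k - lam (Suc k)) * R (kap k - kap (Suc k)))"
  proof (rule prod.mono_neutral_left)
    show "\<forall>k\<in>{..<Suc N} - {..<ell lam}. J (lam k - kap k) * T (kap k - lam (Suc k)) * R (kap k - kap (Suc k)) = 1"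
    proof
      fix k assume "k \<in> {..<Suc N} - {..<ell lam}"
      then have "ell lam \<le> k" by simp
      then show "J (lam k - kap k) * T (kap k - lam (Suc k)) * R (kap k - kap (Suc k)) = 1"
        by (simp add: vanish JT0)
    qed
  qed (use \<open>ell lam \<le> Suc N\<close> in auto)
  also have "\<dots> = J (lam 0 - kap 0) * bulk_weight q s \<theta> N (kap 0) (diagram_tail lam) (diagram_tail kap) *
     (T (kap N - lam (Suc N)) * R (kap N - kap (Suc N)))"
    using kap(2) by (intro step) (simp add: interlaces_def)
  finally show ?thesis using kap(1) by (simp add: J_def JT0)
qed

text \<open>By interlacing, every variable adds at most one nonzero entry.\<close>

lemma dual_spin_qW_eq_0: "kap l \<noteq> 0 \<Longrightarrow> dual_spin_qW q s kap l \<theta> = 0"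
proof (induction l arbitrary: kap)
  case 0
  then show ?case by (auto simp: dual_spin_qW_def)
next
  case (Suc l)
  have "dual_spin_qW q s p l \<theta> = 0" if "interlaces p kap" for p
  proof (rule Suc.IH)
    have "kap (Suc l) \<le> p l" using that by (simp add: interlaces_def)
    then show "p l \<noteq> 0" using Suc.prems by simp
  qed
  then show ?case by (simp add: dual_spin_qW_def)
qed

definition HL_norm :: "real \<Rightarrow> nat \<Rightarrow> (nat \<Rightarrow> nat) \<Rightarrow> real" where
  "HL_norm q n lam = (1 - q) ^ n / qpochhammer q q (n - lam 0)"

text \<open>The branching rule makes the left side a double sum over \<open>lam\<close> and
  \<open>kap\<close>. Summing over \<open>lam\<close> first, the eigenrelation splits off the factor
  of the last \<theta> and restores the same expression for \<open>kap\<close>.\<close>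

lemma cauchy_identity:
  assumes q: "0 \<le> q" "q < 1" and s: "\<bar>s\<bar> < 1" and \<theta>: "\<And>i. i \<ge> 1 \<Longrightarrow> \<theta> i \<noteq> 0"
    and U: "finite U" "card U = n"
    and nz: "\<And>x. x \<in> U \<Longrightarrow> 1 - s * x \<noteq> 0" "\<And>x. x \<in> U \<Longrightarrow> x \<noteq> s"
  shows "(\<Sum>lam\<in>diagrams x n. HL_norm q n lam * bethe q (HL_factor s) (part_list n lam 0) U * dual_spin_qW q s lam x \<theta>) =
    (\<Prod>i=1..x. cauchy_factor s (\<theta> i) U)"
proof (induction x)
  case 0
  have "diagrams 0 n = {\<lambda>_. 0}"
    using young_zero[of _ 0] by (auto simp: diagrams_def fun_eq_iff) (auto simp: young_diagrams_def antimono_def)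
  moreover have "part_list n (\<lambda>_. 0) 0 = replicate n 0"
    by (simp add: part_list_def transposed_def map_replicate_const)
  moreover have "qpochhammer q q n \<noteq> 0" using q by (intro qpochhammer_nonzero) auto
  ultimately show ?case
    using U q by (simp add: bethe_replicate dual_spin_qW_def HL_norm_def HL_factor_def)
next
  case (Suc x)
  define B where "B lam = bethe q (HL_factor s) (part_list n lam 0) U" for lam
  define below where "below lam = {kap \<in> young_diagrams. interlaces kap lam}" for lam
  define T where "T lam kap =
    HL_norm q n lam * B lam * (dual_spin_qW1 q s (\<theta> (Suc x)) lam kap * dual_spin_qW q s kap x \<theta>)" for lam kap
  \<comment> \<open>The interchange of the sums is exact only for the pairs with
    \<open>kap x = 0\<close>; the terms of the other pairs vanish.\<close>
  have dom: "{(lam, kap). lam \<in> diagrams (Suc x) n \<and> kap \<in> below lam \<and> kap x = 0} =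
      {(lam, kap). kap \<in> diagrams x n \<and> lam \<in> covers n kap}" (is "?A = ?B")
  proof (intro equalityI subsetI; clarify)
    fix lam kap assume "lam \<in> diagrams (Suc x) n" "kap \<in> below lam" "kap x = 0"
    then show "kap \<in> diagrams x n \<and> lam \<in> covers n kap"
      by (auto simp: diagrams_def covers_def below_def interlaces_def intro: order_trans)
  next
    fix lam kap assume "kap \<in> diagrams x n" "lam \<in> covers n kap"
    moreover from this have "lam (Suc x) \<le> kap x" by (auto simp: covers_def interlaces_def)
    ultimately show "lam \<in> diagrams (Suc x) n \<and> kap \<in> below lam \<and> kap x = 0"
      by (auto simp: diagrams_def covers_def below_def)
  qed
  have fin: "finite (below lam)" if "lam \<in> diagrams (Suc x) n" for lam
    using that finite_interlaces by (auto simp: diagrams_def below_def)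
  have finB: "finite ?B"
    by (rule finite_subset[of _ "diagrams (Suc x) n \<times> diagrams x n"])
      (use dom in \<open>auto simp: finite_diagrams\<close>)
  have finc: "finite (covers n kap)" if "kap \<in> diagrams x n" for kap
    by (rule finite_subset[of _ "fst ` ?B"]) (use that finB in \<open>auto simp: image_iff\<close>)
  have "(\<Sum>lam\<in>diagrams (Suc x) n. HL_norm q n lam * B lam * dual_spin_qW q s lam (Suc x) \<theta>) =
      (\<Sum>lam\<in>diagrams (Suc x) n. \<Sum>kap\<in>below lam. T lam kap)"
    by (simp add: dual_spin_qW_def below_def T_def sum_distrib_left)
  also have "\<dots> = (\<Sum>(lam, kap)\<in>(SIGMA lam:diagrams (Suc x) n. below lam). T lam kap)"
    using fin by (subst sum.Sigma) (auto simp: finite_diagrams)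
  also have "\<dots> = (\<Sum>(lam, kap)\<in>?A. T lam kap)"
  proof (rule sum.mono_neutral_right)
    show "finite (SIGMA lam:diagrams (Suc x) n. below lam)"
      using fin by (auto simp: finite_diagrams)
    show "\<forall>p\<in>(SIGMA lam:diagrams (Suc x) n. below lam) - ?A.
      (case p of (lam, kap) \<Rightarrow> T lam kap) = 0"
      unfolding T_def using dual_spin_qW_eq_0[of _ x] by fastforce
  qed auto
  also have "\<dots> = (\<Sum>(kap, lam)\<in>(SIGMA kap:diagrams x n. covers n kap). T lam kap)"
    unfolding dom
    by (rule sum.reindex_bij_witness[of _ "\<lambda>(a, b). (b, a)" "\<lambda>(a, b). (b, a)"]) auto
  also have "\<dots> = (\<Sum>kap\<in>diagrams x n. \<Sum>lam\<in>covers n kap. T lam kap)"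
    using finc by (subst sum.Sigma) (auto simp: finite_diagrams)
  also have "\<dots> = (\<Sum>kap\<in>diagrams x n. cauchy_factor s (\<theta> (Suc x)) U * (HL_norm q n kap * B kap * dual_spin_qW q s kap x \<theta>))"
  proof (intro sum.cong refl, goal_cases)
    case (1 kap)
    then have kap: "kap \<in> young_diagrams" "kap 0 \<le> n" "kap x = 0" by (auto simp: diagrams_def)
    define W where "W lam = (\<Prod>r<lam 0 - kap 0. \<theta> (Suc x) + s * q ^ r) /
      (qpochhammer q q (lam 0 - kap 0) * qpochhammer q q (n - lam 0)) *
      bulk_weight q s (\<theta> (Suc x)) x (kap 0) (diagram_tail lam) (diagram_tail kap) * B lam" for lam
    have "T lam kap = (1 - q) ^ n * dual_spin_qW q s kap x \<theta> * W lam"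
      if "lam \<in> covers n kap" for lam
    proof -
      have "lam \<in> young_diagrams" "interlaces kap lam" "lam (Suc x) = 0"
        using that kap by (auto simp: covers_def interlaces_def) (metis le_zero_eq)
      then show ?thesis
        using kap \<theta> unfolding T_def by (subst dual_spin_qW1_eq[where N = x]) (auto simp: W_def HL_norm_def mult_ac)
    qed
    note * = this
    have "(\<Sum>lam\<in>covers n kap. T lam kap) =
      (1 - q) ^ n * dual_spin_qW q s kap x \<theta> * (\<Sum>lam\<in>covers n kap. W lam)"
      unfolding sum_distrib_left by (intro sum.cong refl) (rule *)
    also have "(\<Sum>lam\<in>covers n kap. W lam) =
        cauchy_factor s (\<theta> (Suc x)) U / qpochhammer q q (n - kap 0) * B kap"
      unfolding W_def B_def by (rule boundary_eigenrelation[OF q s kap U nz])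
    finally have "(\<Sum>lam\<in>covers n kap. T lam kap) =
      (1 - q) ^ n * dual_spin_qW q s kap x \<theta> * (cauchy_factor s (\<theta> (Suc x)) U / qpochhammer q q (n - kap 0) * B kap)" .
    then show ?case by (simp add: HL_norm_def)
  qed
  also have "\<dots> = (\<Prod>i=1..Suc x. cauchy_factor s (\<theta> i) U)"
    using Suc.IH by (simp add: sum_distrib_left[symmetric] B_def)
  finally show ?case by (simp add: B_def)
qed

text \<open>Up to the pass weights of \<open>I\<close>, this is the function p of the diagrams. No
  variable has part 0, so the normalization reduces to the power of 1 - q.\<close>

definition full_length_sum :: "real \<Rightarrow> real \<Rightarrow> (nat \<Rightarrow> real) \<Rightarrow> nat \<Rightarrow> real set \<Rightarrow> real" where
  "full_length_sum q s \<theta> x I = (1 - q) ^ card I *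
     (\<Sum>lam | lam \<in> diagrams x (card I) \<and> lam 0 = card I.
        bethe q (HL_factor s) (part_list (card I) lam 0) I * dual_spin_qW q s lam x \<theta>)"

text \<open>The diagrams of length k give n - k variables the part 0. Their symmetrization is
  \<open>qpochhammer q q (n - k) / (1 - q) ^ (n - k)\<close> by \<open>bethe_replicate\<close>,
  which turns the normalization for n variables into the one for k.\<close>

lemma fixed_length_sum:
  assumes q: "0 \<le> q" "q < 1" and U: "finite U" "card U = n" and k: "k \<le> n"
  shows "(\<Sum>lam | lam \<in> diagrams x n \<and> lam 0 = k.
      HL_norm q n lam * bethe q (HL_factor s) (part_list n lam 0) U * dual_spin_qW q s lam x \<theta>) =
    (\<Sum>I | I \<subseteq> U \<and> card I = k. cross q I (U - I) * full_length_sum q s \<theta> x I)"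
proof -
  define B where "B = bethe q (HL_factor s)"
  have qnz: "qpochhammer q q n \<noteq> 0" for n using q by (intro qpochhammer_nonzero) auto
  have set: "{lam. lam \<in> diagrams x n \<and> lam 0 = k} = {lam. lam \<in> diagrams x k \<and> lam 0 = k}"
    using k by (auto simp: diagrams_def)
  have "HL_norm q n lam * B (part_list n lam 0) U * dual_spin_qW q s lam x \<theta> =
      (\<Sum>I | I \<subseteq> U \<and> card I = k. cross q I (U - I) * ((1 - q) ^ k * (B (part_list k lam 0) I * dual_spin_qW q s lam x \<theta>)))"
    if lam: "lam \<in> diagrams x k" "lam 0 = k" for lam
  proof -
    have "part_list n lam 0 = part_list k lam 0 @ replicate (n - k) 0"
      using lam k by (intro parts_trunc) (auto simp: diagrams_def)
    then have "B (part_list n lam 0) U =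
        (\<Sum>I | I \<subseteq> U \<and> card I = k. cross q I (U - I) * (B (part_list k lam 0) I * B (replicate (n - k) 0) (U - I)))"
      using bethe_append[OF U(1), of "part_list k lam 0" "replicate (n - k) 0"] U k by (simp add: B_def)
    also have "\<dots> = (\<Sum>I | I \<subseteq> U \<and> card I = k. cross q I (U - I) * B (part_list k lam 0) I) *
        (qpochhammer q q (n - k) / (1 - q) ^ (n - k))"
      unfolding sum_distrib_right
    proof (intro sum.cong refl, goal_cases)
      case (1 I)
      then have "finite (U - I)" "card (U - I) = n - k"
        using U by (auto simp: card_Diff_subset finite_subset)
      then have "B (replicate (n - k) 0) (U - I) = qpochhammer q q (n - k) / (1 - q) ^ (n - k)"
        unfolding B_def using q by (subst bethe_replicate) (auto simp: HL_factor_def)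
      then show ?case by simp
    qed
    finally have *: "B (part_list n lam 0) U = (\<Sum>I | I \<subseteq> U \<and> card I = k. cross q I (U - I) * B (part_list k lam 0) I) *
        (qpochhammer q q (n - k) / (1 - q) ^ (n - k))" .
    have "(1 - q) ^ n = (1 - q) ^ k * (1 - q) ^ (n - k)" using k by (simp add: power_add[symmetric])
    then have "HL_norm q n lam * B (part_list n lam 0) U = (1 - q) ^ k * (\<Sum>I | I \<subseteq> U \<and> card I = k. cross q I (U - I) * B (part_list k lam 0) I)"
      unfolding HL_norm_def lam(2) * using q qnz by simp
    then show ?thesis by (simp add: sum_distrib_left sum_distrib_right mult_ac)
  qed
  then have "(\<Sum>lam | lam \<in> diagrams x n \<and> lam 0 = k. HL_norm q n lam * B (part_list n lam 0) U * dual_spin_qW q s lam x \<theta>) =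
      (\<Sum>lam | lam \<in> diagrams x k \<and> lam 0 = k.
      (\<Sum>I | I \<subseteq> U \<and> card I = k. cross q I (U - I) * ((1 - q) ^ k * (B (part_list k lam 0) I * dual_spin_qW q s lam x \<theta>))))"
    unfolding set by (intro sum.cong) auto
  also have "\<dots> = (\<Sum>I | I \<subseteq> U \<and> card I = k. cross q I (U - I) * full_length_sum q s \<theta> x I)"
    by (subst sum.swap) (auto simp: full_length_sum_def B_def sum_distrib_left intro!: sum.cong)
  finally show ?thesis by (simp add: B_def)
qed

lemma sum_cross_full_length:
  assumes q: "0 \<le> q" "q < 1" and s: "\<bar>s\<bar> < 1" and \<theta>: "\<And>i. i \<ge> 1 \<Longrightarrow> \<theta> i \<noteq> 0"
    and U: "finite U"
    and nz: "\<And>x. x \<in> U \<Longrightarrow> 1 - s * x \<noteq> 0" "\<And>x. x \<in> U \<Longrightarrow> x \<noteq> s"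
  shows "(\<Sum>I\<in>Pow U. cross q I (U - I) * full_length_sum q s \<theta> x I) =
    (\<Prod>i=1..x. cauchy_factor s (\<theta> i) U)"
proof -
  define F where "F lam = HL_norm q (card U) lam * bethe q (HL_factor s) (part_list (card U) lam 0) U * dual_spin_qW q s lam x \<theta>" for lam
  have "(\<Sum>I\<in>Pow U. cross q I (U - I) * full_length_sum q s \<theta> x I) =
      (\<Sum>k\<le>card U. \<Sum>lam | lam \<in> diagrams x (card U) \<and> lam 0 = k. F lam)"
    unfolding sum_Pow_card[OF U] F_def using U q by (intro sum.cong refl, subst fixed_length_sum) auto
  also have "\<dots> = (\<Sum>lam\<in>diagrams x (card U). F lam)"
    using finite_diagrams[of x "card U"] by (intro sum.group) (auto simp: diagrams_def)
  finally show ?thesis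
    using cauchy_identity[OF q s \<theta> U refl nz, where x = x] by (simp add: F_def)
qed

section \<open>Exchange relations\<close>

text \<open>Path conservation at a vertex. The subtraction is truncated only for g = 0 with an exit
  but no entry, where the vertex weight is 0.\<close>

abbreviation out_edge :: "nat \<Rightarrow> bool \<Rightarrow> bool \<Rightarrow> nat" where
  "out_edge g a b \<equiv> g + of_bool a - of_bool b"

definition bit_weight :: "real \<Rightarrow> real \<Rightarrow> real \<Rightarrow> real \<Rightarrow> nat \<Rightarrow> bool \<Rightarrow> bool \<Rightarrow> real" where
  "bit_weight q s \<theta> u g a b = vertex_weight q s u \<theta> g (of_bool a) (out_edge g a b) (of_bool b)"

text \<open>One column, read upwards: \<open>g\<close> paths come from below, the bits in the list
  are the outgoing horizontal edges, and the incoming ones are summed over with \<open>F\<close>.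
  The parameters travel along with the bits, so that exchanging rows makes sense.\<close>

fun column_transfer :: "real \<Rightarrow> real \<Rightarrow> real \<Rightarrow> nat \<Rightarrow> ((real \<times> bool) list \<Rightarrow> real) \<Rightarrow> (real \<times> bool) list \<Rightarrow> real" where
  "column_transfer q s \<theta> g F [] = F []"
| "column_transfer q s \<theta> g F ((u, b) # l) = (\<Sum>a\<in>UNIV. bit_weight q s \<theta> u g a b *
     column_transfer q s \<theta> (out_edge g a b) (\<lambda>l'. F ((u, a) # l')) l)"

lemma bit_weight_simps:
  "bit_weight q s \<theta> u g False False = (q ^ g + u * \<theta>) * inverse (1 + u * \<theta>)"
  "bit_weight q s \<theta> u g False True = (1 - q ^ g) * inverse (1 + u * \<theta>)"
  "bit_weight q s \<theta> u g True True = (1 - u * s * q ^ g) * inverse (1 + u * \<theta>)"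
  "bit_weight q s \<theta> u g True False = u * (\<theta> + s * q ^ g) * inverse (1 + u * \<theta>)"
  by (cases g; simp add: bit_weight_def vertex_weight_def divide_inverse)+

lemma sum_bit_weight:
  assumes "1 + u * \<theta> \<noteq> 0"
  shows "bit_weight q s \<theta> u g a False + bit_weight q s \<theta> u g a True = 1"
proof -
  have "(1 + u * \<theta>) * inverse (1 + u * \<theta>) = 1" using assms by simp
  moreover have gen: "u * (\<theta> + s * Q) * I + (1 - u * s * Q) * I = 1" "(Q + u * \<theta>) * I + (1 - Q) * I = 1"
    if "(1 + u * \<theta>) * I = 1" for Q I
  proof -
    show "u * (\<theta> + s * Q) * I + (1 - u * s * Q) * I = 1" using that by algebra
    show "(Q + u * \<theta>) * I + (1 - Q) * I = 1" using that by algebra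
  qed
  ultimately show ?thesis by (cases a) (simp_all only: bit_weight_simps if_True if_False)
qed

lemma column_Cons:
  "column_transfer q s \<theta> g F ((u, b) # l) =
     bit_weight q s \<theta> u g False b * column_transfer q s \<theta> (out_edge g False b) (\<lambda>l'. F ((u, False) # l')) l +
     bit_weight q s \<theta> u g True b * column_transfer q s \<theta> (out_edge g True b) (\<lambda>l'. F ((u, True) # l')) l"
  by (simp add: UNIV_bool)

declare column_transfer.simps(2) [simp del]

lemma column_linear:
  assumes "\<And>l. a * F l = b * G l + c * H l"
  shows "a * column_transfer q s \<theta> g F l = b * column_transfer q s \<theta> g G l + c * column_transfer q s \<theta> g H l"
  using assms
proof (induction l arbitrary: g F G H)
  case (Cons p l)
  obtain u d where p: "p = (u, d)" by (cases p)
  show ?case unfolding p column_Cons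
    using Cons.IH[of "\<lambda>l'. F ((u, False) # l')" "\<lambda>l'. G ((u, False) # l')" "\<lambda>l'. H ((u, False) # l')" "out_edge g False d", OF Cons.prems]
      Cons.IH[of "\<lambda>l'. F ((u, True) # l')" "\<lambda>l'. G ((u, True) # l')" "\<lambda>l'. H ((u, True) # l')" "out_edge g True d", OF Cons.prems]
    by algebra
qed simp

text \<open>Commutation relations of Yang-Baxter type between rows with and without an exiting path.
  As a property of functions of labelled rows they can be handed on from one column to the
  next.\<close>

definition exchangeable :: "real \<Rightarrow> ((real \<times> bool) list \<Rightarrow> real) \<Rightarrow> bool" where
  "exchangeable q F \<longleftrightarrow> (\<forall>pre suf u v. u \<noteq> v \<longrightarrow>
     (u - v) * F (pre @ (u, False) # (v, True) # suf) =
       (u - q * v) * F (pre @ (v, True) # (u, False) # suf) - (1 - q) * u * F (pre @ (u, True) # (v, False) # suf) \<and>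
     (\<forall>b. F (pre @ (u, b) # (v, b) # suf) = F (pre @ (v, b) # (u, b) # suf)))"

lemma exchangeable_mixed:
  "exchangeable q F \<Longrightarrow> u \<noteq> v \<Longrightarrow> (u - v) * F (pre @ (u, False) # (v, True) # suf) =
    (u - q * v) * F (pre @ (v, True) # (u, False) # suf) + (- ((1 - q) * u)) * F (pre @ (u, True) # (v, False) # suf)"
  unfolding exchangeable_def by simp

lemma exchangeable_equal:
  "exchangeable q F \<Longrightarrow> F (pre @ (u, b) # (v, b) # suf) = F (pre @ (v, b) # (u, b) # suf)"
  unfolding exchangeable_def by (cases "u = v") auto

lemma exchangeable_append_left: "exchangeable q F \<Longrightarrow> exchangeable q (\<lambda>l. F (p @ l))"
  unfolding exchangeable_def by (metis append_assoc)

text \<open>\<open>K\<close> is \<open>q ^ k\<close> when k + 1 paths come from below, so that no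
  division by q, which may be 0, occurs. \<open>y\<close>, \<open>r\<close>, \<open>p\<close>,
  \<open>z\<close> stand for the rest of the column when one of the two rows has an incoming path,
  \<open>A\<close> and \<open>B\<close> for none and for both. The terms with \<open>A\<close> and
  \<open>B\<close> agree separately; in the others, multiplication by u - v eliminates
  \<open>y\<close> and \<open>z\<close>. The inverse denominators \<open>iu\<close> and
  \<open>iv\<close> are common to all terms and may be arbitrary.\<close>

lemma one_path_exchange:
  fixes u v q :: real
  assumes "u \<noteq> v" and y: "(u - v) * y = (u - q * v) * r - (1 - q) * u * p"
    and z: "(v - u) * z = (v - q * u) * p - (1 - q) * v * r"
  shows "(u - v) * ((q * K + u * t) * iu * ((1 - q * K) * iv * A + (1 - v * s * (q * K)) * iv * y) +
      u * (t + s * (q * K)) * iu * ((1 - q * (q * K)) * iv * p + (1 - v * s * (q * (q * K))) * iv * B)) =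
    (u - q * v) * ((1 - q * K) * iv * ((K + u * t) * iu * A + u * (t + s * K) * iu * z) +
      (1 - v * s * (q * K)) * iv * ((q * K + u * t) * iu * r + u * (t + s * (q * K)) * iu * B)) -
    (1 - q) * u * ((1 - q * K) * iu * ((K + v * t) * iv * A + v * (t + s * K) * iv * y) +
      (1 - u * s * (q * K)) * iu * ((q * K + v * t) * iv * p + v * (t + s * (q * K)) * iv * B))"
    (is "?L = ?R")
proof -
  define l where "l = (u - v) * ((q * K + u * t) * (1 - v * s * (q * K)) * y + u * (t + s * (q * K)) * (1 - q * (q * K)) * p)"
  define r' where "r' = (u - q * v) * ((1 - q * K) * (u * (t + s * K)) * z + (1 - v * s * (q * K)) * (q * K + u * t) * r) -
    (1 - q) * u * ((1 - q * K) * (v * (t + s * K)) * y + (1 - u * s * (q * K)) * (q * K + v * t) * p)"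
  have "(u - v) * (l - r') = (u - v) * ((q * K + u * t) * (1 - v * s * (q * K)) * ((u - v) * y) +
      (u - v) * (u * (t + s * (q * K)) * (1 - q * (q * K)) * p)) -
    (u - q * v) * (- ((1 - q * K) * (u * (t + s * K)) * ((v - u) * z)) + (u - v) * ((1 - v * s * (q * K)) * (q * K + u * t) * r)) +
    (1 - q) * u * ((1 - q * K) * (v * (t + s * K)) * ((u - v) * y) + (u - v) * ((1 - u * s * (q * K)) * (q * K + v * t) * p))"
    unfolding l_def r'_def by algebra
  also have "\<dots> = 0" unfolding y z by algebra
  finally have "l = r'" using assms(1) by simp
  have "?L - ?R = iu * iv * (l - r')"
    unfolding l_def r'_def by algebra
  then show ?thesis using \<open>l = r'\<close> by simp
qed

text \<open>Two rows with the same output bit, by the same elimination of \<open>y\<close> and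
  \<open>z\<close>. With g paths from below, \<open>K\<close> is \<open>q ^ g\<close> in the first
  equation and \<open>q ^ (g - 1)\<close> in the second.\<close>

lemma equal_exchange:
  fixes u v q :: real
  assumes "u \<noteq> v" and y: "(u - v) * y = (u - q * v) * r - (1 - q) * u * p"
    and z: "(v - u) * z = (v - q * u) * p - (1 - q) * v * r"
  shows "(K + u * t) * iu * ((K + v * t) * iv * A + v * (t + s * K) * iv * y) +
      u * (t + s * K) * iu * ((q * K + v * t) * iv * p + v * (t + s * (q * K)) * iv * B) =
      (K + v * t) * iv * ((K + u * t) * iu * A + u * (t + s * K) * iu * z) +
      v * (t + s * K) * iv * ((q * K + u * t) * iu * r + u * (t + s * (q * K)) * iu * B)" (is "?L1 = ?R1")
    and "(1 - q * K) * iu * ((1 - K) * iv * A + (1 - v * s * K) * iv * y) +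
      (1 - u * s * (q * K)) * iu * ((1 - q * K) * iv * p + (1 - v * s * (q * K)) * iv * B) =
      (1 - q * K) * iv * ((1 - K) * iu * A + (1 - u * s * K) * iu * z) +
      (1 - v * s * (q * K)) * iv * ((1 - q * K) * iu * r + (1 - u * s * (q * K)) * iu * B)" (is "?L2 = ?R2")
proof -
  have "(u - v) * (?L1 - ?R1) = iu * iv * (t + s * K) *
      ((K + u * t) * v * ((u - v) * y) + (u - v) * u * (q * K + v * t) * p +
       (K + v * t) * u * ((v - u) * z) - (u - v) * v * (q * K + u * t) * r)" by algebra
  also have "\<dots> = 0" unfolding y z by algebra
  finally show "?L1 = ?R1" using assms(1) by simp
  have "(u - v) * (?L2 - ?R2) = iu * iv * (1 - q * K) *
      ((1 - v * s * K) * ((u - v) * y) + (u - v) * (1 - u * s * (q * K)) * p +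
       (1 - u * s * K) * ((v - u) * z) - (u - v) * (1 - v * s * (q * K)) * r)" by algebra
  also have "\<dots> = 0" unfolding y z by algebra
  finally show "?L2 = ?R2" using assms(1) by simp
qed

lemma column_exchange_head:
  assumes F: "exchangeable q F" and uv: "u \<noteq> v"
    and C: "C = column_transfer q s \<theta> g F"
  shows "(u - v) * C ((u, False) # (v, True) # l) =
       (u - q * v) * C ((v, True) # (u, False) # l) - (1 - q) * u * C ((u, True) # (v, False) # l)"
    and "C ((u, b) # (v, b) # l) = C ((v, b) # (u, b) # l)" (is ?e)
proof -
  \<comment> \<open>\<open>X\<close> is the rest of the column after the two rows, for given input
    bits of these. It is linear in \<open>F\<close> and inherits its relations, for every number of
    paths entering from below.\<close>
  define X where "X x a y c m = column_transfer q s \<theta> m (\<lambda>l'. F ((x, a) # (y, c) # l')) l" for x a y c m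
  have mixed: "(x - y) * X x False y True m = (x - q * y) * X y True x False m - (1 - q) * x * X x True y False m"
    if "x \<noteq> y" for x y m
  proof -
    have "(x - y) * F ((x, False) # (y, True) # l') = (x - q * y) * F ((y, True) # (x, False) # l') +
        (- ((1 - q) * x)) * F ((x, True) # (y, False) # l')" for l'
      using exchangeable_mixed[OF F that, of "[]" l'] by (simp only: append_Nil)
    from column_linear[of "x - y" "\<lambda>l'. F ((x, False) # (y, True) # l')" "x - q * y"
        "\<lambda>l'. F ((y, True) # (x, False) # l')" "- ((1 - q) * x)" "\<lambda>l'. F ((x, True) # (y, False) # l')" q s \<theta> m l, OF this]
    show ?thesis by (simp add: X_def)
  qed
  have equal: "X u a v a m = X v a u a m" for a m
    unfolding X_def using exchangeable_equal[OF F, of "[]"] by simp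
  define iu where "iu = inverse (1 + u * \<theta>)"
  define iv where "iv = inverse (1 + v * \<theta>)"
  have duv: "u - v \<noteq> 0" using uv by simp
  note h1 = mixed[OF uv] and h2 = mixed[OF uv[symmetric]]
  note expand = C column_Cons X_def[symmetric] bit_weight_simps iu_def[symmetric] iv_def[symmetric]
  show "(u - v) * C ((u, False) # (v, True) # l) =
       (u - q * v) * C ((v, True) # (u, False) # l) - (1 - q) * u * C ((u, True) # (v, False) # l)"
  proof (cases g)
    case 0
    show ?thesis using h1[of 0] h2[of 0] h1[of "Suc 0"] h2[of "Suc 0"] equal[of True "Suc 0"] equal[of False 0]
      unfolding expand 0 by simp algebra
  next
    case (Suc k)
    note E = one_path_exchange[OF uv h1[of g] h2[of g], where K = "q ^ k" and t = \<theta> and s = s and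
        iu = iu and iv = iv and A = "X v False u False k" and B = "X v True u True (Suc g)"]
    show ?thesis using E equal[of True "Suc g"] equal[of False k]
      unfolding expand Suc by simp
  qed
  show ?e
  proof (cases b)
    case True
    then have b: "b = True" by simp
    show ?thesis
    proof (cases g)
      case 0
      show ?thesis using equal[of True 0] unfolding b expand 0 by simp
    next
      case (Suc k)
      show ?thesis
        using equal_exchange(2)[OF uv h1[of k] h2[of k], where K = "q ^ k" and s = s and
          iu = iu and iv = iv and A = "X v False u False (k - 1)" and B = "X v True u True (Suc k)"]
          equal[of True "Suc k"] equal[of False "k - 1"]
        unfolding b expand Suc by simp
    qed
  next
    case False
    then have b: "b = False" by simp
    show ?thesis
      using equal_exchange(1)[OF uv h1[of "Suc g"] h2[of "Suc g"], where K = "q ^ g" and s = s and t = \<theta> and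
        iu = iu and iv = iv and A = "X v False u False g" and B = "X v True u True (Suc (Suc g))"]
        equal[of True "Suc (Suc g)"] equal[of False g]
      unfolding b expand by simp
  qed
qed

text \<open>Rows below the exchanged pair only change the number of paths reaching it and prefix
  \<open>F\<close> with fixed rows, which keeps \<open>F\<close> exchangeable.\<close>

lemma exchangeable_column:
  assumes "exchangeable q F"
  shows "exchangeable q (column_transfer q s \<theta> g F)"
proof -
  have "(u - v) * column_transfer q s \<theta> g F (pre @ (u, False) # (v, True) # suf) =
       (u - q * v) * column_transfer q s \<theta> g F (pre @ (v, True) # (u, False) # suf) -
       (1 - q) * u * column_transfer q s \<theta> g F (pre @ (u, True) # (v, False) # suf) \<and>
     (\<forall>b. column_transfer q s \<theta> g F (pre @ (u, b) # (v, b) # suf) = column_transfer q s \<theta> g F (pre @ (v, b) # (u, b) # suf))"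
    if "u \<noteq> v" for pre suf u v
    using assms
  proof (induction pre arbitrary: g F)
    case Nil
    then show ?case using column_exchange_head[OF Nil that refl] by simp
  next
    case (Cons p pre)
    obtain x d where p: "p = (x, d)" by (cases p)
    have "exchangeable q (\<lambda>l'. F ((x, a) # l'))" for a
      using exchangeable_append_left[OF Cons.prems, of "[(x, a)]"] by simp
    note 1 = Cons.IH[OF this[of False], of "out_edge g False d"] Cons.IH[OF this[of True], of "out_edge g True d"]
    show ?case
    proof (intro conjI allI)
      fix b
      show "column_transfer q s \<theta> g F ((p # pre) @ (u, b) # (v, b) # suf) = column_transfer q s \<theta> g F ((p # pre) @ (v, b) # (u, b) # suf)"
        using 1 unfolding p append_Cons column_Cons by simp
      show "(u - v) * column_transfer q s \<theta> g F ((p # pre) @ (u, False) # (v, True) # suf) =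
       (u - q * v) * column_transfer q s \<theta> g F ((p # pre) @ (v, True) # (u, False) # suf) -
       (1 - q) * u * column_transfer q s \<theta> g F ((p # pre) @ (u, True) # (v, False) # suf)"
        using 1[THEN conjunct1] unfolding p append_Cons column_Cons by algebra
    qed
  qed
  then show ?thesis unfolding exchangeable_def by blast
qed

section \<open>Sorting the rows into a block with and a block without exiting paths\<close>

definition row_block :: "bool \<Rightarrow> real set \<Rightarrow> (real \<times> bool) list" where
  "row_block b S = map (\<lambda>u. (u, b)) (sorted_list_of_set S)"

lemma block_empty [simp]: "row_block b {} = []"
  by (simp add: row_block_def)

lemma exchangeable_rotate:
  assumes "exchangeable q F"
  shows "F (pre @ (x, b) # map (\<lambda>u. (u, b)) xs @ suf) = F (pre @ map (\<lambda>u. (u, b)) xs @ (x, b) # suf)"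
proof (induction xs arbitrary: pre)
  case (Cons y xs)
  have "F (pre @ (x, b) # (y, b) # map (\<lambda>u. (u, b)) xs @ suf) =
      F ((pre @ [(y, b)]) @ (x, b) # map (\<lambda>u. (u, b)) xs @ suf)"
    using exchangeable_equal[OF assms, of pre x b y] by simp
  then show ?case unfolding Cons.IH by simp
qed simp

lemma exchangeable_insort:
  assumes "exchangeable q F"
  shows "F (pre @ map (\<lambda>u. (u, b)) (insort x xs) @ suf) = F (pre @ (x, b) # map (\<lambda>u. (u, b)) xs @ suf)"
proof (induction xs arbitrary: pre)
  case (Cons y xs)
  show ?case
  proof (cases "x \<le> y")
    case False
    then have "F (pre @ map (\<lambda>u. (u, b)) (insort x (y # xs)) @ suf) =
        F ((pre @ [(y, b)]) @ map (\<lambda>u. (u, b)) (insort x xs) @ suf)" by simp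
    also have "\<dots> = F (pre @ (y, b) # (x, b) # map (\<lambda>u. (u, b)) xs @ suf)"
      unfolding Cons.IH by simp
    finally show ?thesis using exchangeable_equal[OF assms, of pre x b y] by simp
  qed simp
qed simp

lemma block_insert:
  assumes "exchangeable q F" "finite S" "x \<notin> S"
  shows "F (pre @ row_block b (insert x S) @ suf) = F (pre @ (x, b) # row_block b S @ suf)"
    and "F (pre @ row_block b (insert x S) @ suf) = F (pre @ row_block b S @ (x, b) # suf)"
proof -
  show *: "F (pre @ row_block b (insert x S) @ suf) = F (pre @ (x, b) # row_block b S @ suf)"
    using assms by (simp add: row_block_def exchangeable_insort[OF assms(1)])
  show "F (pre @ row_block b (insert x S) @ suf) = F (pre @ row_block b S @ (x, b) # suf)"
    unfolding * by (simp add: row_block_def exchangeable_rotate[OF assms(1)])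
qed

text \<open>Moving the row \<open>w\<close> past the block \<open>K\<close>, either \<open>w\<close>
  keeps its path, or exactly one \<open>i\<close> takes it over and \<open>w\<close> joins the
  block. The exchange with \<open>k\<close> leaves \<open>w\<close> or \<open>k\<close> as the row
  with a path that has to pass the remaining block, hence the induction over all \<open>w\<close>
  and \<open>suf\<close>.\<close>

lemma pass_through:
  assumes F: "exchangeable q F" and "finite K" "finite S" "S \<inter> K = {}" "w \<notin> S \<union> K"
  shows "F (row_block True S @ row_block False K @ (w, True) # suf) =
    (\<Prod>i\<in>K. (i - q * w) / (i - w)) * F (row_block True (insert w S) @ row_block False K @ suf) -
    (\<Sum>i\<in>K. (1 - q) * i / (i - w) * (\<Prod>l\<in>K - {i}. (l - q * i) / (l - i)) *
       F (row_block True (insert i S) @ row_block False (insert w (K - {i})) @ suf))"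
  using assms(2,4,5)
proof (induction K arbitrary: w suf rule: finite_induct)
  case empty
  then show ?case using block_insert(2)[OF F assms(3), of w "[]" True suf] by simp
next
  case (insert k K)
  define V where "V S' K' = F (row_block True S' @ row_block False K' @ suf)" for S' K'
  define P where "P i = (\<Prod>l\<in>K - {i}. (l - q * i) / (l - i))" for i
  have push: "F (row_block True S' @ row_block False K' @ (x, False) # suf') =
      F (row_block True S' @ row_block False (insert x K') @ suf')" if "finite K'" "x \<notin> K'" for S' K' x suf'
    using block_insert(2)[OF F that, of "row_block True S'" False suf'] by simp
  have nz: "k - w \<noteq> 0" "k \<noteq> w" "w \<notin> K" "k \<notin> K" "w \<notin> S" "k \<notin> S" "S \<inter> K = {}" using insert by auto
  have "F (row_block True S @ row_block False (insert k K) @ (w, True) # suf) =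
      F ((row_block True S @ row_block False K) @ (k, False) # (w, True) # suf)"
    using push[OF insert.hyps, of S "(w, True) # suf"] by simp
  then have E: "(k - w) * F (row_block True S @ row_block False (insert k K) @ (w, True) # suf) =
      (k - q * w) * F (row_block True S @ row_block False K @ (w, True) # (k, False) # suf) -
      (1 - q) * k * F (row_block True S @ row_block False K @ (k, True) # (w, False) # suf)"
    using exchangeable_mixed[OF F nz(2), of "row_block True S @ row_block False K" suf] by simp
  have dist: "(a * p - b * r) / d = a / d * p - b / d * r" for a b d p r :: real
    by (simp add: diff_divide_distrib)
  have "x = (k - w) * x / (k - w)" for x using nz(1) by simp
  from this[of "F (row_block True S @ row_block False (insert k K) @ (w, True) # suf)"] have main: "F (row_block True S @ row_block False (insert k K) @ (w, True) # suf) =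
      (k - q * w) / (k - w) * F (row_block True S @ row_block False K @ (w, True) # (k, False) # suf) -
      (1 - q) * k / (k - w) * F (row_block True S @ row_block False K @ (k, True) # (w, False) # suf)"
    unfolding E dist .
  have e: "insert k (insert w (K - {i})) = insert w (insert k K - {i})"
    "insert w (insert k (K - {i})) = insert w (insert k K - {i})" if "i \<in> K" for i
    using that nz by auto
  have 1: "F (row_block True S @ row_block False K @ (w, True) # (k, False) # suf) =
      (\<Prod>i\<in>K. (i - q * w) / (i - w)) * V (insert w S) (insert k K) -
      (\<Sum>i\<in>K. (1 - q) * i / (i - w) * P i * V (insert i S) (insert w (insert k K - {i})))"
    using insert.IH[of w "(k, False) # suf"] nz insert.hyps by (simp add: push V_def P_def e)
  have 2: "F (row_block True S @ row_block False K @ (k, True) # (w, False) # suf) =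
      (\<Prod>i\<in>K. (i - q * k) / (i - k)) * V (insert k S) (insert w K) -
      (\<Sum>i\<in>K. (1 - q) * i / (i - k) * P i * V (insert i S) (insert w (insert k K - {i})))"
    using insert.IH[of k "(w, False) # suf"] nz insert.hyps by (simp add: push V_def P_def e)
  have P': "(\<Prod>l\<in>insert k K - {i}. (l - q * i) / (l - i)) = (k - q * i) / (k - i) * P i" if "i \<in> K" for i
  proof -
    have "insert k K - {i} = insert k (K - {i})" using that nz by auto
    then show ?thesis using insert.hyps by (simp add: P_def)
  qed
  \<comment> \<open>Two routes lead to the same final rows: the path goes from \<open>w\<close> to
    \<open>i\<close> directly, or by way of \<open>k\<close>. Their coefficients combine by a
    partial fraction identity.\<close>
  have coef: "(k - q * w) / (k - w) * ((1 - q) * i / (i - w) * P i * v) -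
      (1 - q) * k / (k - w) * ((1 - q) * i / (i - k) * P i * v) =
      (1 - q) * i / (i - w) * ((k - q * i) / (k - i) * P i) * v" if "i \<in> K" for i v
  proof -
    have "i - w \<noteq> 0" "i - k \<noteq> 0" "k - i \<noteq> 0" using that nz by auto
    with nz(1) have "(k - q * w) / (k - w) * (1 / (i - w)) - (1 - q) * k / (k - w) * (1 / (i - k)) =
        1 / (i - w) * ((k - q * i) / (k - i))"
      by (simp add: divide_simps) (simp add: algebra_simps)
    have gen: "A * ((1 - q) * (i * C) * p * v) - B * ((1 - q) * (i * D) * p * v) = (1 - q) * (i * C) * (E * p) * v"
      if "A * C - B * D = C * E" for A B C D E p using that by algebra
    have div: "(1 - q) * i / (i - w) = (1 - q) * (i * (1 / (i - w)))"
      "(1 - q) * i / (i - k) = (1 - q) * (i * (1 / (i - k)))" by simp_all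
    show ?thesis unfolding div by (rule gen) fact
  qed
  have dist2: "a * (x * v - S1) - b * (y * v' - S2) = a * x * v - b * y * v' - (a * S1 - b * S2)"
    for a b x y v v' S1 S2 :: real by algebra
  have "F (row_block True S @ row_block False (insert k K) @ (w, True) # suf) =
      (k - q * w) / (k - w) * (\<Prod>i\<in>K. (i - q * w) / (i - w)) * V (insert w S) (insert k K) -
      (1 - q) * k / (k - w) * (\<Prod>i\<in>K. (i - q * k) / (i - k)) * V (insert k S) (insert w K) -
      (\<Sum>i\<in>K. (k - q * w) / (k - w) * ((1 - q) * i / (i - w) * P i * V (insert i S) (insert w (insert k K - {i}))) -
         (1 - q) * k / (k - w) * ((1 - q) * i / (i - k) * P i * V (insert i S) (insert w (insert k K - {i}))))"
    unfolding main 1 2 dist2 sum_subtractf sum_distrib_left[symmetric] ..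
  also have "\<dots> = (k - q * w) / (k - w) * (\<Prod>i\<in>K. (i - q * w) / (i - w)) * V (insert w S) (insert k K) -
      (1 - q) * k / (k - w) * (\<Prod>i\<in>K. (i - q * k) / (i - k)) * V (insert k S) (insert w K) -
      (\<Sum>i\<in>K. (1 - q) * i / (i - w) * (\<Prod>l\<in>insert k K - {i}. (l - q * i) / (l - i)) * V (insert i S) (insert w (insert k K - {i})))"
    by (intro arg_cong2[where f = "(-)"] sum.cong refl) (simp only: coef P')
  also have "\<dots> = (\<Prod>i\<in>insert k K. (i - q * w) / (i - w)) * V (insert w S) (insert k K) -
    (\<Sum>i\<in>insert k K. (1 - q) * i / (i - w) * (\<Prod>l\<in>insert k K - {i}. (l - q * i) / (l - i)) *
       V (insert i S) (insert w (insert k K - {i})))"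
    using insert.hyps nz by simp
  finally show ?case by (simp only: V_def)
qed

text \<open>A row added on top either extends the block without paths or passes through it. No
  single term has a simple sorted form, only the sum over all \<open>K\<close> has; the exchanges
  preserve the size of \<open>K\<close>, so a weight \<open>g\<close> of this size may be carried
  along and later selects it.\<close>

lemma sum_exchangeable:
  assumes "exchangeable q F" "distinct us"
  shows "(\<Sum>K\<in>Pow (set us). g (card K) * F (map (\<lambda>u. (u, u \<notin> K)) us @ suf)) =
    (\<Sum>K\<in>Pow (set us). g (card K) * (cross q K (set us - K) *
      F (row_block True (set us - K) @ row_block False K @ suf)))"
  using assms(2)
proof (induction us arbitrary: g suf rule: rev_induct)
  case (snoc w us)
  define U where "U = set us"
  define V where "V S K = F (row_block True S @ row_block False K @ suf)" for S K
  have dist_us: "distinct us" using snoc.prems by simp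
  have U: "finite U" "w \<notin> U" "set (us @ [w]) = insert w U" using snoc.prems by (auto simp: U_def)
  have fin: "finite K" if "K \<in> Pow U" for K using that U finite_subset by auto
  define c where "c K i = (1 - q) * i / (i - w) * (\<Prod>l\<in>K - {i}. (l - q * i) / (l - i))" for K i
  have "(\<Sum>K\<in>Pow (set (us @ [w])). g (card K) * F (map (\<lambda>u. (u, u \<notin> K)) (us @ [w]) @ suf)) =
      (\<Sum>K\<in>Pow U. g (Suc (card K)) * F (map (\<lambda>u. (u, u \<notin> K)) us @ (w, False) # suf) +
        g (card K) * F (map (\<lambda>u. (u, u \<notin> K)) us @ (w, True) # suf))"
    unfolding U(3) sum_Pow_insert[OF U(1,2)]
  proof (intro sum.cong refl, goal_cases)
    case (1 K)
    have e: "map (\<lambda>u. (u, u \<notin> insert w K)) us = map (\<lambda>u. (u, u \<notin> K)) us"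
      using U by (auto simp: U_def)
    have "w \<notin> K" using 1 U by auto
    then show ?case unfolding map_append e using fin[OF 1] by simp
  qed
  also have "\<dots> = (\<Sum>K\<in>Pow U. g (Suc (card K)) * (cross q K (U - K) * F (row_block True (U - K) @ row_block False K @ (w, False) # suf))) +
      (\<Sum>K\<in>Pow U. g (card K) * (cross q K (U - K) * F (row_block True (U - K) @ row_block False K @ (w, True) # suf)))"
    unfolding sum.distrib U_def snoc.IH[OF dist_us] snoc.IH[OF dist_us, of "\<lambda>k. g (Suc k)"] ..
  also have "\<dots> = (\<Sum>K\<in>Pow U. g (Suc (card K)) * (cross q K (U - K) * V (U - K) (insert w K))) +
      (\<Sum>K\<in>Pow U. g (card K) * (cross q K (U - K) * ((\<Prod>i\<in>K. (i - q * w) / (i - w)) * V (insert w (U - K)) K -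
        (\<Sum>i\<in>K. c K i * V (insert i (U - K)) (insert w (K - {i}))))))"
  proof (intro arg_cong2[where f = "(+)"] sum.cong refl, goal_cases)
    case (1 K)
    have "w \<notin> K" using 1 U by auto
    then show ?case
      using block_insert(2)[OF assms(1) fin[OF 1], of w "row_block True (U - K)" False suf] by (simp add: V_def)
  next
    case (2 K)
    have "F (row_block True (U - K) @ row_block False K @ (w, True) # suf) =
        (\<Prod>i\<in>K. (i - q * w) / (i - w)) * V (insert w (U - K)) K -
        (\<Sum>i\<in>K. c K i * V (insert i (U - K)) (insert w (K - {i})))"
      unfolding V_def c_def by (rule pass_through[OF assms(1) fin[OF 2]]) (use U 2 in auto)
    then show ?case by simp
  qed
  also have "\<dots> = (\<Sum>K\<in>Pow U. g (Suc (card K)) * (cross q K (U - K) * V (U - K) (insert w K))) -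
      (\<Sum>K\<in>Pow U. \<Sum>i\<in>K. g (card K) * (cross q K (U - K) * (c K i * V (insert i (U - K)) (insert w (K - {i}))))) +
      (\<Sum>K\<in>Pow U. g (card K) * (cross q K (insert w (U - K)) * V (insert w (U - K)) K))"
  proof -
    have "cross q K (insert w (U - K)) = (\<Prod>i\<in>K. (i - q * w) / (i - w)) * cross q K (U - K)" for K
      using U by (intro cross_insert_right) auto
    then have "g (card K) * (cross q K (U - K) * ((\<Prod>i\<in>K. (i - q * w) / (i - w)) * V (insert w (U - K)) K -
        (\<Sum>i\<in>K. c K i * V (insert i (U - K)) (insert w (K - {i}))))) =
      g (card K) * (cross q K (insert w (U - K)) * V (insert w (U - K)) K) -
      (\<Sum>i\<in>K. g (card K) * (cross q K (U - K) * (c K i * V (insert i (U - K)) (insert w (K - {i})))))" for K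
      by (simp only: right_diff_distrib sum_distrib_left mult_ac)
    then show ?thesis by (simp only: sum_subtractf)
  qed
  also have "(\<Sum>K\<in>Pow U. \<Sum>i\<in>K. g (card K) * (cross q K (U - K) * (c K i * V (insert i (U - K)) (insert w (K - {i}))))) =
      (\<Sum>K\<in>Pow U. \<Sum>i\<in>U - K. g (Suc (card K)) * (cross q (insert i K) (U - insert i K) * c (insert i K) i * V (U - K) (insert w K)))"
    unfolding sum_Pow_move_element[OF U(1)]
  proof (intro sum.cong refl, goal_cases)
    case (1 K i)
    then have "insert i (U - insert i K) = U - K" "insert i K - {i} = K" "card (insert i K) = Suc (card K)"
      using fin[OF 1(1)] by auto
    then show ?case by simp
  qed
  \<comment> \<open>Two sources of the final set \<open>insert w K\<close> of rows without a path:
    \<open>w\<close> had none from the beginning, or it gave its path to some \<open>i\<close>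
    outside \<open>K\<close>. The coefficients add up to the partial fraction expansion of the
    factors of \<open>w\<close> in \<open>cross q (insert w K) (U - K)\<close>.\<close>
  also have "(\<Sum>K\<in>Pow U. g (Suc (card K)) * (cross q K (U - K) * V (U - K) (insert w K))) -
      (\<Sum>K\<in>Pow U. \<Sum>i\<in>U - K. g (Suc (card K)) * (cross q (insert i K) (U - insert i K) * c (insert i K) i * V (U - K) (insert w K))) =
      (\<Sum>K\<in>Pow U. g (Suc (card K)) * (cross q (insert w K) (U - K) * V (U - K) (insert w K)))"
    unfolding sum_subtractf[symmetric]
  proof (intro sum.cong refl, goal_cases)
    case (1 K)
    define G where "G i = (\<Prod>j\<in>U - K - {i}. (i - q * j) / (i - j))" for i
    have "cross q (insert i K) (U - insert i K) * c (insert i K) i =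
        - (cross q K (U - K) * ((1 - q) * (i / (w - i)) * G i))" if i: "i \<in> U - K" for i
    proof -
      have e: "insert i (U - K - {i}) = U - K" using i by auto
      have e2: "U - insert i K = U - K - {i}" by auto
      have "cross q K (U - K) = (\<Prod>l\<in>K. (l - q * i) / (l - i)) * cross q K (U - K - {i})"
        using cross_insert_right[of "U - K - {i}" i q K] U unfolding e by simp
      moreover have "cross q (insert i K) (U - insert i K) = G i * cross q K (U - K - {i})"
        using i fin[OF 1] cross_insert_left[of K i q "U - K - {i}"] by (simp add: G_def e2)
      moreover have "c (insert i K) i = - ((1 - q) * (i / (w - i)) * (\<Prod>l\<in>K. (l - q * i) / (l - i)))"
      proof -
        have "(1 - q) * i / (i - w) = - ((1 - q) * (i / (w - i)))"
          using minus_divide_right[of "(1 - q) * i" "w - i"] by simp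
        moreover have "insert i K - {i} = K" using i by auto
        ultimately show ?thesis by (simp only: c_def mult_minus_left)
      qed
      ultimately show ?thesis by simp
    qed
    then have "cross q K (U - K) - (\<Sum>i\<in>U - K. cross q (insert i K) (U - insert i K) * c (insert i K) i) =
        cross q K (U - K) * (1 + (\<Sum>i\<in>U - K. (1 - q) * (i / (w - i)) * G i))"
      by (simp add: sum_negf distrib_left sum_distrib_left)
    also have "1 + (\<Sum>i\<in>U - K. (1 - q) * (i / (w - i)) * G i) = (\<Prod>j\<in>U - K. (w - q * j) / (w - j))"
      unfolding G_def using U by (intro prod_scattering_right(1)[symmetric]) auto
    also have "cross q K (U - K) * \<dots> = cross q (insert w K) (U - K)"
      using U 1 fin[OF 1] by (subst cross_insert_left) auto
    finally have *: "cross q K (U - K) - (\<Sum>i\<in>U - K. cross q (insert i K) (U - insert i K) * c (insert i K) i) =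
      cross q (insert w K) (U - K)" .
    show ?case
      by (simp only: *[symmetric] left_diff_distrib right_diff_distrib sum_distrib_left sum_distrib_right)
  qed
  also have "\<dots> + (\<Sum>K\<in>Pow U. g (card K) * (cross q K (insert w (U - K)) * V (insert w (U - K)) K)) =
      (\<Sum>K\<in>Pow (set (us @ [w])). g (card K) * (cross q K (set (us @ [w]) - K) *
      F (row_block True (set (us @ [w]) - K) @ row_block False K @ suf)))"
    unfolding U(3) sum_Pow_insert[OF U(1,2)] sum.distrib[symmetric]
  proof (intro sum.cong refl, goal_cases)
    case (1 K)
    then have "insert w U - insert w K = U - K" "insert w U - K = insert w (U - K)" "w \<notin> K" using U by auto
    then show ?case using fin[OF 1] by (simp add: V_def)
  qed
  finally show ?case .
qed simp

text \<open>The candidate for the law of the horizontal edges to the right of column x. The value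
  for x = 0 is the step boundary, and every column starts with 0 paths from below.\<close>

primrec column_prob :: "real \<Rightarrow> real \<Rightarrow> (nat \<Rightarrow> real) \<Rightarrow> nat \<Rightarrow> (real \<times> bool) list \<Rightarrow> real" where
  "column_prob q s \<theta> 0 l = (if \<forall>p\<in>set l. snd p then 1 else 0)"
| "column_prob q s \<theta> (Suc x) l = column_transfer q s (\<theta> (Suc x)) 0 (column_prob q s \<theta> x) l"

lemma exchangeable_column_prob: "exchangeable q (column_prob q s \<theta> x)"
proof (induction x)
  case 0
  then show ?case by (auto simp: exchangeable_def)
next
  case (Suc x)
  then show ?case
    using exchangeable_column[of q "column_prob q s \<theta> x" s "\<theta> (Suc x)" 0]
    by (simp add: exchangeable_def)
qed

definition pass_weight :: "real \<Rightarrow> (nat \<Rightarrow> real) \<Rightarrow> nat \<Rightarrow> real \<Rightarrow> real" where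
  "pass_weight s \<theta> x u = (\<Prod>i=1..x. (1 - u * s) / (1 + u * \<theta> i))"

text \<open>The lowest row receives no path from below, and with 0 paths the weight of an exit
  without an entry is \<open>1 - q ^ 0 = 0\<close>. An exiting path of this row has gone straight
  through all columns and does not influence the rows above. Hence the rows with exiting paths are
  sorted to the front.\<close>

lemma column_prob_True:
  "column_prob q s \<theta> x ((u, True) # l) = pass_weight s \<theta> x u * column_prob q s \<theta> x l"
proof (induction x arbitrary: l)
  case (Suc x)
  have "1 * column_transfer q s (\<theta> (Suc x)) 0 (\<lambda>l'. column_prob q s \<theta> x ((u, True) # l')) l =
      pass_weight s \<theta> x u * column_transfer q s (\<theta> (Suc x)) 0 (column_prob q s \<theta> x) l + 0 * column_transfer q s (\<theta> (Suc x)) 0 (\<lambda>_. 0) l"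
    by (rule column_linear) (simp add: Suc.IH)
  then show ?case
    by (simp add: column_Cons bit_weight_simps pass_weight_def divide_inverse mult_ac)
qed (simp add: pass_weight_def)

lemma column_prob_block:
  assumes "finite S"
  shows "column_prob q s \<theta> x (row_block True S @ l) = (\<Prod>u\<in>S. pass_weight s \<theta> x u) * column_prob q s \<theta> x l"
proof -
  have "column_prob q s \<theta> x (map (\<lambda>u. (u, True)) us @ l) = prod_list (map (pass_weight s \<theta> x) us) * column_prob q s \<theta> x l" for us
    by (induction us) (simp_all add: column_prob_True mult_ac del: column_prob.simps)
  then show ?thesis
    using assms by (simp add: row_block_def prod.distinct_set_conv_list[symmetric])
qed

lemma sum_Pow_map_Cons:
  assumes "distinct (j # js)"
  shows "(\<Sum>J\<in>Pow (set (j # js)). H (map (\<lambda>j. (u j, j \<notin> J)) (j # js))) =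
    (\<Sum>J\<in>Pow (set js). H ((u j, False) # map (\<lambda>j. (u j, j \<notin> J)) js) + H ((u j, True) # map (\<lambda>j. (u j, j \<notin> J)) js))"
proof -
  have j: "j \<notin> set js" using assms by simp
  show ?thesis
    unfolding list.set sum_Pow_insert[OF finite_set j]
  proof (intro sum.cong refl, goal_cases)
    case (1 J)
    have e: "map (\<lambda>j. (u j, j \<notin> insert i J)) js = map (\<lambda>j. (u j, j \<notin> J)) js" if "i \<notin> set js" for i
      using that by auto
    have "j \<notin> J" using 1 j by auto
    then show ?case unfolding list.map e[OF j] by simp
  qed
qed

lemma sum_column:
  assumes "distinct js" "\<And>j. j \<in> set js \<Longrightarrow> 1 + u j * \<theta> \<noteq> 0"
  shows "(\<Sum>J\<in>Pow (set js). column_transfer q s \<theta> g F (map (\<lambda>j. (u j, j \<notin> J)) js)) =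
    (\<Sum>J\<in>Pow (set js). F (map (\<lambda>j. (u j, j \<notin> J)) js))"
  using assms
proof (induction js arbitrary: g F)
  case (Cons j js)
  have nz: "1 + u j * \<theta> \<noteq> 0" using Cons.prems by simp
  note tot = sum_bit_weight[OF nz]
  have IH: "(\<Sum>J\<in>Pow (set js). column_transfer q s \<theta> g (\<lambda>l'. F ((u j, a) # l')) (map (\<lambda>j. (u j, j \<notin> J)) js)) =
      (\<Sum>J\<in>Pow (set js). F ((u j, a) # map (\<lambda>j. (u j, j \<notin> J)) js))" for a g
    using Cons by auto
  define R where "R a = (\<Sum>J\<in>Pow (set js). F ((u j, a) # map (\<lambda>j. (u j, j \<notin> J)) js))" for a
  have "(\<Sum>J\<in>Pow (set js). column_transfer q s \<theta> g F ((u j, b) # map (\<lambda>j. (u j, j \<notin> J)) js)) =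
      bit_weight q s \<theta> (u j) g False b * R False + bit_weight q s \<theta> (u j) g True b * R True" for b
    unfolding column_Cons sum.distrib sum_distrib_left[symmetric] IH R_def ..
  then have "(\<Sum>J\<in>Pow (set (j # js)). column_transfer q s \<theta> g F (map (\<lambda>j. (u j, j \<notin> J)) (j # js))) =
      (bit_weight q s \<theta> (u j) g False False + bit_weight q s \<theta> (u j) g False True) * R False +
      (bit_weight q s \<theta> (u j) g True False + bit_weight q s \<theta> (u j) g True True) * R True"
    unfolding sum_Pow_map_Cons[OF Cons.prems(1)] sum.distrib by (simp only: distrib_right)
  then show ?case
    unfolding tot sum_Pow_map_Cons[OF Cons.prems(1)] sum.distrib R_def by simp
qed simp

lemma sum_column_prob:
  assumes "distinct js" "\<And>i j. 1 \<le> i \<Longrightarrow> j \<in> set js \<Longrightarrow> 1 + u j * \<theta> i \<noteq> 0"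
  shows "(\<Sum>J\<in>Pow (set js). column_prob q s \<theta> x (map (\<lambda>j. (u j, j \<notin> J)) js)) = 1"
proof (induction x)
  case 0
  have "(\<Sum>J\<in>Pow (set js). column_prob q s \<theta> 0 (map (\<lambda>j. (u j, j \<notin> J)) js)) =
      (\<Sum>J\<in>Pow (set js). if J = {} then 1 else 0)"
    by (intro sum.cong refl) auto
  then show ?case by simp
next
  case (Suc x)
  then show ?case using assms by (simp add: sum_column)
qed

section \<open>Comparison for distinct variables\<close>

definition regular_set :: "real \<Rightarrow> (nat \<Rightarrow> real) \<Rightarrow> real set \<Rightarrow> bool" where
  "regular_set s \<theta> U \<longleftrightarrow> finite U \<and> (\<forall>u\<in>U. 1 - s * u \<noteq> 0 \<and> u \<noteq> s \<and> (\<forall>i\<ge>1. 1 + u * \<theta> i \<noteq> 0))"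

lemma pass_weight_cauchy_factor:
  assumes "regular_set s \<theta> U"
  shows "(\<Prod>u\<in>U. pass_weight s \<theta> x u) * (\<Prod>i=1..x. cauchy_factor s (\<theta> i) U) = 1"
proof -
  have "(\<Prod>i=1..x. cauchy_factor s (\<theta> i) U) = (\<Prod>u\<in>U. \<Prod>i=1..x. (1 + \<theta> i * u) / (1 - s * u))"
    by (rule prod.swap)
  moreover have "pass_weight s \<theta> x u * (\<Prod>i=1..x. (1 + \<theta> i * u) / (1 - s * u)) = 1" if "u \<in> U" for u
    unfolding pass_weight_def prod.distrib[symmetric]
    using assms that by (intro prod.neutral) (auto simp: regular_set_def mult.commute)
  ultimately show ?thesis by (simp add: prod.distrib[symmetric])
qed

lemma prod_pass_weight_split:
  assumes "finite U" "K \<subseteq> U"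
  shows "(\<Prod>u\<in>U. pass_weight s \<theta> x u) =
    (\<Prod>u\<in>U - K. pass_weight s \<theta> x u) * (\<Prod>u\<in>K. pass_weight s \<theta> x u)"
  using assms by (intro prod.subset_diff)

lemma sum_column_prob_cross:
  assumes "distinct js" "inj_on u (set js)"
  shows "(\<Sum>J\<in>Pow (set js). g (card J) * column_prob q s \<theta> x (map (\<lambda>j. (u j, j \<notin> J)) js)) =
    (\<Sum>K\<in>Pow (u ` set js). g (card K) * (cross q K (u ` set js - K) *
      ((\<Prod>v\<in>u ` set js - K. pass_weight s \<theta> x v) * column_prob q s \<theta> x (row_block False K))))"
proof -
  have bij: "bij_betw ((`) u) (Pow (set js)) (Pow (set (map u js)))"
    using assms(2) by (simp add: bij_betw_Pow inj_on_imp_bij_betw)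
  have "g (card J) * column_prob q s \<theta> x (map (\<lambda>j. (u j, j \<notin> J)) js) =
      g (card (u ` J)) * column_prob q s \<theta> x (map (\<lambda>v. (v, v \<notin> u ` J)) (map u js) @ [])"
    if "J \<in> Pow (set js)" for J
  proof -
    have J: "J \<subseteq> set js" using that by simp
    have c: "card (u ` J) = card J" by (rule card_image) (rule inj_on_subset[OF assms(2) J])
    have "u j \<in> u ` J \<longleftrightarrow> j \<in> J" if "j \<in> set js" for j
      by (rule inj_on_image_mem_iff[OF assms(2) that J])
    then have e: "map (\<lambda>v. (v, v \<notin> u ` J)) (map u js) = map (\<lambda>j. (u j, j \<notin> J)) js"
      unfolding map_map by (intro map_cong refl) simp
    show ?thesis unfolding c e by simp
  qed
  then have "(\<Sum>J\<in>Pow (set js). g (card J) * column_prob q s \<theta> x (map (\<lambda>j. (u j, j \<notin> J)) js)) =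
      (\<Sum>J\<in>Pow (set js). g (card (u ` J)) * column_prob q s \<theta> x (map (\<lambda>v. (v, v \<notin> u ` J)) (map u js) @ []))"
    by (rule sum.cong[OF refl])
  also have "\<dots> = (\<Sum>K\<in>Pow (set (map u js)). g (card K) * column_prob q s \<theta> x (map (\<lambda>v. (v, v \<notin> K)) (map u js) @ []))"
    by (rule sum.reindex_bij_betw[OF bij])
  also have "\<dots> = (\<Sum>K\<in>Pow (set (map u js)). g (card K) * (cross q K (set (map u js) - K) *
      column_prob q s \<theta> x (row_block True (set (map u js) - K) @ row_block False K @ [])))"
    using assms by (intro sum_exchangeable exchangeable_column_prob) (simp add: distinct_map)
  finally show ?thesis by (simp add: column_prob_block)
qed

text \<open>The two expansions of the total mass have the same coefficients \<open>C K\<close>, and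
  by induction their terms agree for every proper subset of \<open>U\<close>.\<close>

lemma column_prob_block_False:
  assumes q: "0 \<le> q" "q < 1" and s: "\<bar>s\<bar> < 1" and \<theta>: "\<And>i. i \<ge> 1 \<Longrightarrow> \<theta> i \<noteq> 0"
    and "regular_set s \<theta> U"
  shows "column_prob q s \<theta> x (row_block False U) = (\<Prod>u\<in>U. pass_weight s \<theta> x u) * full_length_sum q s \<theta> x U"
  using assms(5)
proof (induction "card U" arbitrary: U rule: less_induct)
  case less
  define P where "P = (\<lambda>S. \<Prod>u\<in>S. pass_weight s \<theta> x u)"
  define C where "C K = cross q K (U - K) * P (U - K)" for K
  define us where "us = sorted_list_of_set U"
  have U: "finite U" "set us = U" "distinct us" using less.prems by (auto simp: regular_set_def us_def)
  have Psplit: "P U = P (U - K) * P K" if "K \<in> Pow U" for K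
    unfolding P_def using that U by (intro prod_pass_weight_split) auto
  have "(\<Sum>K\<in>Pow U. C K * column_prob q s \<theta> x (row_block False K)) = 1"
    using sum_column_prob_cross[of us "\<lambda>u. u" "\<lambda>_. 1" q s \<theta> x] sum_column_prob[of us "\<lambda>u. u" \<theta> q s x]
      less.prems U by (simp add: regular_set_def C_def P_def mult_ac)
  moreover have "(\<Sum>K\<in>Pow U. C K * (P K * full_length_sum q s \<theta> x K)) = 1"
  proof -
    have "(\<Sum>K\<in>Pow U. C K * (P K * full_length_sum q s \<theta> x K)) =
        P U * (\<Sum>K\<in>Pow U. cross q K (U - K) * full_length_sum q s \<theta> x K)"
      unfolding sum_distrib_left by (intro sum.cong refl) (simp add: Psplit C_def)
    also have "(\<Sum>K\<in>Pow U. cross q K (U - K) * full_length_sum q s \<theta> x K) = (\<Prod>i=1..x. cauchy_factor s (\<theta> i) U)"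
      using less.prems by (intro sum_cross_full_length[OF q s \<theta> U(1)]) (auto simp: regular_set_def)
    also have "P U * \<dots> = 1"
      unfolding P_def by (rule pass_weight_cauchy_factor[OF less.prems])
    finally show ?thesis .
  qed
  ultimately have "(\<Sum>K\<in>Pow U. C K * (column_prob q s \<theta> x (row_block False K) - P K * full_length_sum q s \<theta> x K)) = 0"
    unfolding right_diff_distrib sum_subtractf by simp
  moreover have "column_prob q s \<theta> x (row_block False K) - P K * full_length_sum q s \<theta> x K = 0" if "K \<in> Pow U - {U}" for K
  proof -
    have "card K < card U" "regular_set s \<theta> K"
      using that U less.prems psubset_card_mono[of U K] finite_subset[of K U] by (auto simp: regular_set_def)
    then show ?thesis using less.hyps by (simp add: P_def)
  qed
  \<comment> \<open>Only the term K = U of the difference survives, and \<open>C U\<close> is 1 as a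
    product of empty products.\<close>
  ultimately have "C U * (column_prob q s \<theta> x (row_block False U) - P U * full_length_sum q s \<theta> x U) = 0"
    using sum.remove[of "Pow U" U "\<lambda>K. C K * (column_prob q s \<theta> x (row_block False K) - P K * full_length_sum q s \<theta> x K)"] U
    by simp
  then show ?case by (simp add: C_def P_def)
qed

lemma column_prob_eq_fixed_length_sum:
  assumes q: "0 \<le> q" "q < 1" and s: "\<bar>s\<bar> < 1" and \<theta>: "\<And>i. i \<ge> 1 \<Longrightarrow> \<theta> i \<noteq> 0"
    and js: "distinct js" "inj_on u (set js)" and U: "U = u ` set js" "regular_set s \<theta> U"
    and k: "k \<le> length js"
  shows "(\<Sum>J | J \<subseteq> set js \<and> card J = k. column_prob q s \<theta> x (map (\<lambda>j. (u j, j \<notin> J)) js)) =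
    (\<Prod>v\<in>U. pass_weight s \<theta> x v) * (\<Sum>lam | lam \<in> diagrams x (length js) \<and> lam 0 = k.
      HL_norm q (length js) lam * bethe q (HL_factor s) (part_list (length js) lam 0) U * dual_spin_qW q s lam x \<theta>)"
proof -
  have fin: "finite U" and card: "card U = length js"
    using U js by (auto simp: card_image distinct_card)
  have sel: "(\<Sum>J | J \<subseteq> A \<and> card J = k. f J) = (\<Sum>J\<in>Pow A. of_bool (card J = k) * f J)"
    if "finite A" for A :: "'c set" and f :: "'c set \<Rightarrow> real"
    using that by (intro sum.mono_neutral_cong_left) auto
  have "(\<Sum>J | J \<subseteq> set js \<and> card J = k. column_prob q s \<theta> x (map (\<lambda>j. (u j, j \<notin> J)) js)) =
      (\<Sum>K | K \<subseteq> U \<and> card K = k. cross q K (U - K) *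
        ((\<Prod>v\<in>U - K. pass_weight s \<theta> x v) * column_prob q s \<theta> x (row_block False K)))"
    using sum_column_prob_cross[OF js, of "\<lambda>c. of_bool (c = k)"] fin unfolding U(1) by (simp add: sel)
  also have "\<dots> = (\<Sum>K | K \<subseteq> U \<and> card K = k. (\<Prod>v\<in>U. pass_weight s \<theta> x v) *
      (cross q K (U - K) * full_length_sum q s \<theta> x K))"
  proof (intro sum.cong refl, goal_cases)
    case (1 K)
    then have "regular_set s \<theta> K" using U(2) finite_subset[of K U] by (auto simp: regular_set_def)
    then have "column_prob q s \<theta> x (row_block False K) = (\<Prod>u\<in>K. pass_weight s \<theta> x u) * full_length_sum q s \<theta> x K"
      using q s \<theta> by (intro column_prob_block_False)
    moreover have "(\<Prod>v\<in>U. pass_weight s \<theta> x v) =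
        (\<Prod>v\<in>U - K. pass_weight s \<theta> x v) * (\<Prod>v\<in>K. pass_weight s \<theta> x v)"
      using 1 fin by (intro prod_pass_weight_split) auto
    ultimately show ?case by simp
  qed
  also have "\<dots> = (\<Prod>v\<in>U. pass_weight s \<theta> x v) * (\<Sum>lam | lam \<in> diagrams x (length js) \<and> lam 0 = k.
      HL_norm q (length js) lam * bethe q (HL_factor s) (part_list (length js) lam 0) U * dual_spin_qW q s lam x \<theta>)"
    unfolding sum_distrib_left[symmetric] fixed_length_sum[OF q fin card k] ..
  finally show ?thesis .
qed

section \<open>From permutations of indices to orderings of values\<close>

lemma scatter_map_upt:
  assumes "inj_on f {a..<b}"
  shows "scatter q (map f [a..<b]) = (\<Prod>i\<in>{a..<b}. \<Prod>j\<in>{Suc i..<b}. (f i - q * f j) / (f i - f j))"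
  using assms
proof (induction "b - a" arbitrary: a)
  case (Suc m)
  then have ab: "a < b" by simp
  have "inj_on f {Suc a..<b}" using Suc.prems by (rule inj_on_subset) auto
  then have IH: "scatter q (map f [Suc a..<b]) = (\<Prod>i\<in>{Suc a..<b}. \<Prod>j\<in>{Suc i..<b}. (f i - q * f j) / (f i - f j))"
    using Suc.hyps(2) by (intro Suc.hyps(1)) auto
  have "(\<Prod>y\<in>f ` {Suc a..<b}. (f a - q * y) / (f a - y)) = (\<Prod>j\<in>{Suc a..<b}. (f a - q * f j) / (f a - f j))"
    using \<open>inj_on f {Suc a..<b}\<close> by (simp add: prod.reindex)
  moreover have "{a..<b} = insert a {Suc a..<b}" using ab by auto
  ultimately show ?case using IH ab by (simp add: upt_conv_Cons)
qed simp

lemma bij_betw_permutes_lists: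
  assumes "inj_on u {1..n}"
  shows "bij_betw (\<lambda>\<sigma>. map (\<lambda>i. u (\<sigma> i)) [1..<Suc n]) {\<sigma>. \<sigma> permutes {1..n}} (permutations_of_set (u ` {1..n}))"
proof -
  let ?h = "\<lambda>\<sigma>. map (\<lambda>i. u (\<sigma> i)) [1..<Suc n]"
  have inj: "inj_on ?h {\<sigma>. \<sigma> permutes {1..n}}"
  proof (rule inj_onI)
    fix \<sigma> \<tau> assume st: "\<sigma> \<in> {\<sigma>. \<sigma> permutes {1..n}}" "\<tau> \<in> {\<sigma>. \<sigma> permutes {1..n}}" and eq: "?h \<sigma> = ?h \<tau>"
    have "\<sigma> i = \<tau> i" for i
    proof (cases "i \<in> {1..n}")
      case True
      then have "u (\<sigma> i) = u (\<tau> i)" using eq by auto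
      moreover have "\<sigma> i \<in> {1..n}" "\<tau> i \<in> {1..n}" using st True permutes_in_image[of _ "{1..n}" i] by auto
      ultimately show ?thesis using assms by (auto dest: inj_onD)
    next
      case False
      then show ?thesis using st by (auto simp: permutes_def)
    qed
    then show "\<sigma> = \<tau>" by auto
  qed
  moreover have "?h ` {\<sigma>. \<sigma> permutes {1..n}} \<subseteq> permutations_of_set (u ` {1..n})"
  proof
    fix xs assume "xs \<in> ?h ` {\<sigma>. \<sigma> permutes {1..n}}"
    then obtain \<sigma> where \<sigma>: "\<sigma> permutes {1..n}" "xs = ?h \<sigma>" by auto
    have set: "set [1..<Suc n] = {1..n}" by auto
    have "set xs = u ` (\<sigma> ` {1..n})" unfolding \<sigma>(2) set_map set image_image ..
    then have "set xs = u ` {1..n}" unfolding permutes_image[OF \<sigma>(1)] .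
    moreover have "inj_on (\<lambda>i. u (\<sigma> i)) {1..n}"
      using comp_inj_on[of \<sigma> "{1..n}" u] assms permutes_inj_on[OF \<sigma>(1)] permutes_image[OF \<sigma>(1)] by (simp add: o_def)
    then have "distinct xs" unfolding \<sigma>(2) distinct_map set by simp
    ultimately show "xs \<in> permutations_of_set (u ` {1..n})" by (simp add: permutations_of_set_def)
  qed
  moreover have "card (?h ` {\<sigma>. \<sigma> permutes {1..n}}) = card (permutations_of_set (u ` {1..n}))"
    using inj assms by (simp add: card_image card_permutations)
  ultimately show ?thesis
    by (simp add: bij_betw_def card_subset_eq finite_permutations_of_set)
qed

lemma ell_transposed:
  assumes "lam \<in> young_diagrams"
  shows "ell (transposed lam) = lam 0"
proof -
  have "{i. transposed lam i \<noteq> 0} = {..<lam 0}" using transposed_eq_0_iff[OF assms] by auto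
  then show ?thesis by (simp add: ell_def)
qed

lemma spin_HL_sum_eq_bethe:
  assumes lam: "lam \<in> young_diagrams" "lam 0 \<le> n" and u: "inj_on u {1..n}"
  shows "spin_HL_sum q s (transposed lam) n u =
    HL_norm q n lam * bethe q (HL_factor s) (part_list n lam 0) (u ` {1..n})"
proof -
  have "bethe q (HL_factor s) (part_list n lam 0) (u ` {1..n}) =
      (\<Sum>\<sigma> | \<sigma> permutes {1..n}. scatter q (map (\<lambda>i. u (\<sigma> i)) [1..<Suc n]) *
        prod_list (map2 (HL_factor s) (part_list n lam 0) (map (\<lambda>i. u (\<sigma> i)) [1..<Suc n])))"
    unfolding bethe_def by (rule sum.reindex_bij_betw[OF bij_betw_permutes_lists[OF u], symmetric])
  also have "\<dots> = (\<Sum>\<sigma> | \<sigma> permutes {1..n}.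
        (\<Prod>(i, j) \<in> {(i, j). 1 \<le> i \<and> i < j \<and> j \<le> n}.
           (u (\<sigma> i) - q * u (\<sigma> j)) / (u (\<sigma> i) - u (\<sigma> j))) *
        (\<Prod>i=1..n. ((u (\<sigma> i) - s) / (1 - s * u (\<sigma> i))) ^ transposed lam (i - 1)) *
        (\<Prod>i=1..lam 0. u (\<sigma> i) / (u (\<sigma> i) - s)))"
  proof (intro sum.cong refl, goal_cases)
    case (1 \<sigma>)
    then have \<sigma>: "\<sigma> permutes {1..n}" by simp
    define w where "w i = u (\<sigma> i)" for i
    have "inj_on w {1..n}"
      using comp_inj_on[of \<sigma> "{1..n}" u] u permutes_inj_on[OF \<sigma>] permutes_image[OF \<sigma>] by (simp add: o_def w_def[abs_def])
    then have "inj_on w {1..<Suc n}" by (simp add: atLeastLessThanSuc_atLeastAtMost)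
    then have "scatter q (map w [1..<Suc n]) =
        (\<Prod>i\<in>{1..<Suc n}. \<Prod>j\<in>{Suc i..<Suc n}. (w i - q * w j) / (w i - w j))"
      by (rule scatter_map_upt)
    also have "\<dots> = (\<Prod>(i, j)\<in>(SIGMA i:{1..<Suc n}. {Suc i..<Suc n}). (w i - q * w j) / (w i - w j))"
      by (rule prod.Sigma) auto
    also have "(SIGMA i:{1..<Suc n}. {Suc i..<Suc n}) = {(i, j). 1 \<le> i \<and> i < j \<and> j \<le> n}" by auto
    finally have S: "scatter q (map w [1..<Suc n]) =
        (\<Prod>(i, j)\<in>{(i, j). 1 \<le> i \<and> i < j \<and> j \<le> n}. (w i - q * w j) / (w i - w j))" .
    have "map2 (HL_factor s) (part_list n lam 0) (map w [1..<Suc n]) =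
        map (\<lambda>i. HL_factor s (transposed lam i) (w (Suc i))) [0..<n]"
      unfolding part_list_def map_Suc_upt[symmetric] One_nat_def by (simp add: zip_map_map map_zip_map comp_def zip_same_conv_map)
    then have "prod_list (map2 (HL_factor s) (part_list n lam 0) (map w [1..<Suc n])) =
        (\<Prod>i<n. HL_factor s (transposed lam i) (w (Suc i)))"
      by (simp add: prod.distinct_set_conv_list[symmetric] lessThan_atLeast0)
    also have "\<dots> = (\<Prod>i=1..n. HL_factor s (transposed lam (i - 1)) (w i))"
      by (rule prod.reindex_bij_witness[of _ "\<lambda>i. i - 1" Suc]) auto
    also have "\<dots> = (\<Prod>i=1..n. ((w i - s) / (1 - s * w i)) ^ transposed lam (i - 1)) *
        (\<Prod>i=1..n. if transposed lam (i - 1) = 0 then 1 else w i / (w i - s))"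
      unfolding HL_factor_def prod.distrib ..
    also have "(\<Prod>i=1..n. if transposed lam (i - 1) = 0 then 1 else w i / (w i - s)) =
        (\<Prod>i=1..lam 0. w i / (w i - s))"
      using lam by (intro prod.mono_neutral_cong_right) (auto simp: transposed_eq_0_iff)
    finally have P: "prod_list (map2 (HL_factor s) (part_list n lam 0) (map w [1..<Suc n])) =
        (\<Prod>i=1..n. ((w i - s) / (1 - s * w i)) ^ transposed lam (i - 1)) * (\<Prod>i=1..lam 0. w i / (w i - s))" .
    show ?case unfolding w_def[symmetric] S P by (simp only: mult.assoc)
  qed
  finally show ?thesis
    unfolding spin_HL_sum_def HL_norm_def ell_transposed[OF lam(1)] by simp
qed

section \<open>Coinciding variables\<close>

text \<open>Polynomials are kept as functions: only their continuity and their divisibility by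
  differences of two variables are used.\<close>

inductive polyfun :: "((nat \<Rightarrow> real) \<Rightarrow> real) \<Rightarrow> bool" where
  const: "polyfun (\<lambda>_. c)"
| var: "polyfun (\<lambda>u. u i)"
| add: "polyfun P \<Longrightarrow> polyfun Q \<Longrightarrow> polyfun (\<lambda>u. P u + Q u)"
| mult: "polyfun P \<Longrightarrow> polyfun Q \<Longrightarrow> polyfun (\<lambda>u. P u * Q u)"

lemma polyfun_diff: "polyfun P \<Longrightarrow> polyfun Q \<Longrightarrow> polyfun (\<lambda>u. P u - Q u)"
  using polyfun.add[of P "\<lambda>u. (-1) * Q u"] polyfun.mult[OF polyfun.const[of "-1"]] by simp

lemma polyfun_power: "polyfun P \<Longrightarrow> polyfun (\<lambda>u. P u ^ n)"
  by (induction n) (auto intro: polyfun.intros)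

lemma polyfun_sum: "(\<And>i. i \<in> I \<Longrightarrow> polyfun (P i)) \<Longrightarrow> polyfun (\<lambda>u. \<Sum>i\<in>I. P i u)"
  by (induction I rule: infinite_finite_induct) (auto intro: polyfun.intros)

lemma polyfun_prod: "(\<And>i. i \<in> I \<Longrightarrow> polyfun (P i)) \<Longrightarrow> polyfun (\<lambda>u. \<Prod>i\<in>I. P i u)"
  by (induction I rule: infinite_finite_induct) (auto intro: polyfun.intros)

lemma polyfun_reindex: "polyfun P \<Longrightarrow> polyfun (\<lambda>u. P (\<lambda>i. u (f i)))"
  by (induction rule: polyfun.induct) (auto intro: polyfun.intros)

lemma polyfun_tendsto:
  assumes "polyfun P" "\<And>i. ((\<lambda>v. w v i) \<longlongrightarrow> u i) F"
  shows "((\<lambda>v. P (w v)) \<longlongrightarrow> P u) F"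
  using assms by (induction rule: polyfun.induct) (auto intro!: tendsto_intros)

text \<open>The factor theorem as a difference quotient. In the product case the substituted value
  of \<open>P\<close> is expressed as \<open>P u - (u i - u j) * P' u\<close>, so that the quotient
  stays polynomial in \<open>u\<close>.\<close>

lemma polyfun_subst:
  assumes "polyfun P"
  shows "\<exists>Q. polyfun Q \<and> (\<forall>u. P u - P (u(i := u j)) = (u i - u j) * Q u)"
  using assms
proof (induction rule: polyfun.induct)
  case (const c)
  then show ?case by (intro exI[of _ "\<lambda>_. 0"]) (auto intro: polyfun.intros)
next
  case (var k)
  then show ?case
    by (intro exI[of _ "\<lambda>_. if k = i then 1 else 0"]) (auto intro: polyfun.intros)
next
  case (add P Q)
  then obtain P' Q' where *: "polyfun P'" "polyfun Q'" and P': "\<And>u. P u - P (u(i := u j)) = (u i - u j) * P' u"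
    and Q': "\<And>u. Q u - Q (u(i := u j)) = (u i - u j) * Q' u" by blast
  have "P u + Q u - (P (u(i := u j)) + Q (u(i := u j))) = (u i - u j) * (P' u + Q' u)" for u
    unfolding distrib_left P'[symmetric] Q'[symmetric] by simp
  then show ?case using polyfun.add[OF *] by blast
next
  case (mult P Q)
  then obtain P' Q' where *: "polyfun P'" "polyfun Q'" and P': "\<And>u. P u - P (u(i := u j)) = (u i - u j) * P' u"
    and Q': "\<And>u. Q u - Q (u(i := u j)) = (u i - u j) * Q' u" by blast
  have "P u * Q u - P (u(i := u j)) * Q (u(i := u j)) =
      (u i - u j) * (P' u * Q u + (P u - (u i - u j) * P' u) * Q' u)" for u
  proof -
    have "P u * Q u - P (u(i := u j)) * Q (u(i := u j)) =
        (P u - P (u(i := u j))) * Q u + (P u - (P u - P (u(i := u j)))) * (Q u - Q (u(i := u j)))"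
      by algebra
    then show ?thesis unfolding P' Q' by algebra
  qed
  moreover have "polyfun (\<lambda>u. P' u * Q u + (P u - (u i - u j) * P' u) * Q' u)"
    using mult.hyps * by (intro polyfun.add polyfun.mult polyfun_diff polyfun.var) auto
  ultimately show ?case by blast
qed

lemma polyfun_divide:
  assumes "polyfun P" "i \<noteq> j" "\<And>u. u i = u j \<Longrightarrow> P u = 0"
  shows "\<exists>Q. polyfun Q \<and> (\<forall>u. P u = (u i - u j) * Q u)"
proof -
  obtain Q where "polyfun Q" "\<forall>u. P u - P (u(i := u j)) = (u i - u j) * Q u"
    using polyfun_subst[OF assms(1)] by blast
  moreover have "P (u(i := u j)) = 0" for u using assms(2,3) by simp
  ultimately show ?thesis by auto
qed

lemma eventually_at_notin_finite:
  fixes a :: "'a :: t1_space"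
  assumes "finite T"
  shows "eventually (\<lambda>x. x \<notin> T) (at a)"
proof -
  have "open (- (T - {a}))" using assms by (intro open_Compl finite_imp_closed) auto
  then show ?thesis unfolding eventually_at_topological
    by (intro exI[of _ "- (T - {a})"]) auto
qed

text \<open>A substitute for cancelling a nonzero polynomial: on a suitable line the factor vanishes
  for finitely many parameters only, and the other factor is continuous.\<close>

lemma polyfun_zero_along_line:
  assumes "polyfun P" "finite T" "\<And>t. t \<notin> T \<Longrightarrow> P (\<lambda>i. u i + t * e i) = 0"
  shows "P u = 0"
proof -
  have "((\<lambda>t. P (\<lambda>i. u i + t * e i)) \<longlongrightarrow> P u) (at 0)"
    by (rule polyfun_tendsto[OF assms(1)]) (auto intro!: tendsto_eq_intros)
  moreover have "((\<lambda>t. P (\<lambda>i. u i + t * e i)) \<longlongrightarrow> 0) (at 0)"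
    by (rule tendsto_eventually, rule eventually_mono[OF eventually_at_notin_finite[OF assms(2)]])
      (use assms(3) in auto)
  ultimately show ?thesis using tendsto_unique[of "at (0::real)"] by auto
qed

lemma finite_line_collisions:
  fixes u e :: "nat \<Rightarrow> real"
  assumes "finite S" "\<And>c d. (c, d) \<in> S \<Longrightarrow> e c \<noteq> e d"
  shows "finite {t. \<exists>(c, d)\<in>S. u c + t * e c = u d + t * e d}"
proof (rule finite_subset)
  show "finite ((\<lambda>(c, d). (u d - u c) / (e c - e d)) ` S)" using assms(1) by simp
  show "{t. \<exists>(c, d)\<in>S. u c + t * e c = u d + t * e d} \<subseteq> (\<lambda>(c, d). (u d - u c) / (e c - e d)) ` S"
  proof clarify
    fix t c d assume cd: "(c, d) \<in> S" and "u c + t * e c = u d + t * e d"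
    then have "t * (e c - e d) = u d - u c" by (simp add: algebra_simps)
    then have "t = (u d - u c) / (e c - e d)" using assms(2)[OF cd] by (simp add: eq_divide_eq)
    then show "t \<in> (\<lambda>(c, d). (u d - u c) / (e c - e d)) ` S" using cd by force
  qed
qed

lemma polyfun_zero_on_diagonal:
  assumes P: "polyfun P" and S: "finite S" "\<And>c d. (c, d) \<in> S \<Longrightarrow> c < d" "(a, b) \<notin> S" "a < b"
    and zero: "\<And>w. w a = w b \<Longrightarrow> (\<Prod>(c, d)\<in>S. (w c - w d)\<^sup>2) * P w = 0" and u: "u a = u b"
  shows "P u = 0"
proof -
  \<comment> \<open>As \<open>e a = e b\<close>, the line in this direction stays on the diagonal
    \<open>u a = u b\<close>. For the pairs in \<open>S\<close> the values of \<open>e\<close>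
    differ, so their differences are not constant along it.\<close>
  define e where "e i = real (if i = b then a else i)" for i
  have e: "e c \<noteq> e d" if "(c, d) \<in> S" for c d
    using S(2)[OF that] that S(3,4) by (auto simp: e_def split: if_splits)
  show ?thesis
  proof (rule polyfun_zero_along_line[OF P, where e = e and u = u])
    show "finite {t. \<exists>(c, d)\<in>S. u c + t * e c = u d + t * e d}"
      using S(1) e by (rule finite_line_collisions)
    fix t assume t: "t \<notin> {t. \<exists>(c, d)\<in>S. u c + t * e c = u d + t * e d}"
    have "u a + t * e a = u b + t * e b" using u by (simp add: e_def)
    from zero[of "\<lambda>i. u i + t * e i", OF this]
    show "P (\<lambda>i. u i + t * e i) = 0" using t S(1) by fastforce
  qed
qed

text \<open>The differences of distinct pairs are coprime: those already divided out do not vanish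
  identically on the diagonal of the next pair, so there the quotient itself has to vanish.\<close>

lemma polyfun_divide_squares:
  assumes A: "polyfun A" and S: "finite S" "\<And>c d. (c, d) \<in> S \<Longrightarrow> c < d"
    and sq: "\<And>a b. (a, b) \<in> S \<Longrightarrow> \<exists>C. polyfun C \<and> (\<forall>u. A u = (u a - u b)\<^sup>2 * C u)"
  shows "\<exists>B. polyfun B \<and> (\<forall>u. A u = (\<Prod>(c, d)\<in>S. (u c - u d)\<^sup>2) * B u)"
  using S sq
proof (induction S rule: finite_induct)
  case empty
  then show ?case using A by auto
next
  case (insert p S)
  obtain a b where p: "p = (a, b)" by (cases p)
  have ab: "a < b" "(a, b) \<notin> S" using insert p by auto
  have S: "c < d" if "(c, d) \<in> S" for c d using insert.prems that by auto
  define D where "D u = (\<Prod>(c, d)\<in>S. (u c - u d)\<^sup>2)" for u :: "nat \<Rightarrow> real"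
  obtain B where B: "polyfun B" "\<And>u. A u = D u * B u" using insert by (auto simp: D_def)
  obtain C where C: "polyfun C" "\<And>u. A u = (u a - u b)\<^sup>2 * C u" using insert.prems p by blast
  have D: "polyfun D" unfolding D_def
    by (auto intro!: polyfun_prod polyfun_power polyfun_diff polyfun.var simp: case_prod_beta)
  have "B u = 0" if "u a = u b" for u
  proof (rule polyfun_zero_on_diagonal[OF B(1) insert.hyps(1) S ab(2,1) _ that])
    fix w :: "nat \<Rightarrow> real" assume "w a = w b"
    then show "(\<Prod>(c, d)\<in>S. (w c - w d)\<^sup>2) * B w = 0" using B(2)[of w] C(2)[of w] by (simp add: D_def)
  qed
  then obtain B' where B': "polyfun B'" "\<And>u. B u = (u a - u b) * B' u"
    using polyfun_divide[OF B(1), of a b] ab by blast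
  \<comment> \<open>One factor \<open>u a - u b\<close> is cancelled from the two expressions for
    \<open>A\<close>, off the diagonal and then by continuity. So \<open>B'\<close> vanishes on the
    diagonal as well, and a second division is possible.\<close>
  have DB': "D u * B' u - (u a - u b) * C u = 0" for u
  proof (rule polyfun_zero_along_line[where e = real and u = u])
    show "polyfun (\<lambda>u. D u * B' u - (u a - u b) * C u)"
      using D B' C by (auto intro!: polyfun_diff polyfun.intros)
    show "finite {t. \<exists>(c, d)\<in>{(a, b)}. u c + t * real c = u d + t * real d}"
      by (rule finite_line_collisions) (use ab in auto)
    fix t assume "t \<notin> {t. \<exists>(c, d)\<in>{(a, b)}. u c + t * real c = u d + t * real d}"
    then have nz: "(u a + t * real a) - (u b + t * real b) \<noteq> 0" by auto
    define w where "w i = u i + t * real i" for i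
    have "(w a - w b) * (D w * B' w - (w a - w b) * C w) = 0"
      using B(2)[of w] C(2)[of w] B'(2)[of w] by (simp add: algebra_simps power2_eq_square)
    then show "D (\<lambda>i. u i + t * real i) * B' (\<lambda>i. u i + t * real i) -
        (u a + t * real a - (u b + t * real b)) * C (\<lambda>i. u i + t * real i) = 0"
      using nz by (auto simp: w_def[abs_def])
  qed
  have "B' u = 0" if "u a = u b" for u
  proof (rule polyfun_zero_on_diagonal[OF B'(1) insert.hyps(1) S ab(2,1) _ that])
    fix w :: "nat \<Rightarrow> real" assume "w a = w b"
    then show "(\<Prod>(c, d)\<in>S. (w c - w d)\<^sup>2) * B' w = 0" using DB'[of w] by (simp add: D_def)
  qed
  then obtain B'' where B'': "polyfun B''" "\<And>u. B' u = (u a - u b) * B'' u"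
    using polyfun_divide[OF B'(1), of a b] ab by blast
  have "A u = (\<Prod>(c, d)\<in>insert p S. (u c - u d)\<^sup>2) * B'' u" for u
    using insert.hyps B(2)[of u] B'(2)[of u] B''(2)[of u] by (simp add: p D_def power2_eq_square)
  then show ?case using B''(1) by blast
qed

abbreviation index_pairs :: "nat \<Rightarrow> (nat \<times> nat) set" where
  "index_pairs n \<equiv> {(i, j). 1 \<le> i \<and> i < j \<and> j \<le> n}"

lemma finite_index_pairs: "finite (index_pairs n)"
  by (rule finite_subset[of _ "{..n} \<times> {..n}"]) auto

text \<open>The square of the Vandermonde product is the product of the absolute differences over
  all ordered pairs, which is visibly invariant. As a common denominator of the symmetrization it
  avoids the signs of permutations.\<close>

lemma prod_square_differences_permute:
  fixes w :: "nat \<Rightarrow> real"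
  assumes "\<sigma> permutes {1..n}"
  shows "(\<Prod>(i, j)\<in>index_pairs n. (w (\<sigma> i) - w (\<sigma> j))\<^sup>2) = (\<Prod>(i, j)\<in>index_pairs n. (w i - w j)\<^sup>2)"
proof -
  define X where "X = {(i, j). i \<in> {1..n} \<and> j \<in> {1..n} \<and> i \<noteq> j}"
  have *: "(\<Prod>(i, j)\<in>index_pairs n. (v i - v j)\<^sup>2) = (\<Prod>(i, j)\<in>X. \<bar>v i - v j\<bar>)" for v :: "nat \<Rightarrow> real"
  proof -
    have X: "X = index_pairs n \<union> prod.swap ` index_pairs n" by (force simp: X_def)
    have "(\<Prod>(i, j)\<in>X. \<bar>v i - v j\<bar>) = (\<Prod>(i, j)\<in>index_pairs n. \<bar>v i - v j\<bar>) *
        (\<Prod>(i, j)\<in>prod.swap ` index_pairs n. \<bar>v i - v j\<bar>)"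
      unfolding X using finite_index_pairs by (intro prod.union_disjoint) auto
    also have "(\<Prod>(i, j)\<in>prod.swap ` index_pairs n. \<bar>v i - v j\<bar>) = (\<Prod>(i, j)\<in>index_pairs n. \<bar>v i - v j\<bar>)"
      by (subst prod.reindex) (auto simp: inj_on_def case_prod_beta abs_minus_commute intro!: prod.cong)
    also have "(\<Prod>(i, j)\<in>index_pairs n. \<bar>v i - v j\<bar>) * (\<Prod>(i, j)\<in>index_pairs n. \<bar>v i - v j\<bar>) =
        (\<Prod>(i, j)\<in>index_pairs n. (v i - v j)\<^sup>2)"
      unfolding prod.distrib[symmetric] by (intro prod.cong refl) (auto simp: power2_eq_square)
    finally show ?thesis ..
  qed
  have "(\<Prod>(i, j)\<in>X. \<bar>w (\<sigma> i) - w (\<sigma> j)\<bar>) = (\<Prod>(i, j)\<in>X. \<bar>w i - w j\<bar>)"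
  proof (rule prod.reindex_bij_witness[of _ "\<lambda>(i, j). (inv \<sigma> i, inv \<sigma> j)" "\<lambda>(i, j). (\<sigma> i, \<sigma> j)"])
    have inv: "inv \<sigma> permutes {1..n}" using assms by (rule permutes_inv)
    have "(\<rho> i, \<rho> j) \<in> X" if "\<rho> permutes {1..n}" "(i, j) \<in> X" for \<rho> i j
    proof -
      have "\<rho> i \<noteq> \<rho> j" using that permutes_inj[OF that(1)] by (auto simp: X_def dest: injD)
      then show ?thesis
        using that(2) permutes_in_image[OF that(1), of i] permutes_in_image[OF that(1), of j] by (simp add: X_def)
    qed
    then show "(\<lambda>(i, j). (\<sigma> i, \<sigma> j)) p \<in> X" "(\<lambda>(i, j). (inv \<sigma> i, inv \<sigma> j)) p \<in> X" if "p \<in> X" for p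
      using that assms inv by (cases p; simp)+
  qed (simp_all add: permutes_inverses[OF assms] case_prod_beta)
  then show ?thesis using *[of "\<lambda>i. w (\<sigma> i)"] *[of w] by simp
qed

text \<open>The symmetrized sum vanishes on each diagonal. Its quotient by u a - u b is
  antisymmetric under exchanging a and b, hence vanishes there too, which gives the second factor of
  the square.\<close>

lemma symmetrized_polyfun_divide:
  assumes T: "polyfun T" and T0: "\<And>u i j. (i, j) \<in> index_pairs n \<Longrightarrow> u i = u j \<Longrightarrow> T u = 0"
  shows "\<exists>B. polyfun B \<and> (\<forall>u. (\<Sum>\<sigma> | \<sigma> permutes {1..n}. T (\<lambda>i. u (\<sigma> i))) =
    (\<Prod>(i, j)\<in>index_pairs n. (u i - u j)\<^sup>2) * B u)"
proof (rule polyfun_divide_squares)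
  define A where "A u = (\<Sum>\<sigma> | \<sigma> permutes {1..n}. T (\<lambda>i. u (\<sigma> i)))" for u
  show A: "polyfun (\<lambda>u. \<Sum>\<sigma> | \<sigma> permutes {1..n}. T (\<lambda>i. u (\<sigma> i)))"
    by (rule polyfun_sum) (rule polyfun_reindex[OF T])
  show "finite (index_pairs n)" by (rule finite_index_pairs)
  show "c < d" if "(c, d) \<in> index_pairs n" for c d using that by auto
  fix a b assume ab: "(a, b) \<in> index_pairs n"
  define \<tau> where "\<tau> = Transposition.transpose a b"
  have \<tau>: "\<tau> permutes {1..n}" unfolding \<tau>_def using ab by (intro permutes_swap_id) auto
  have sym: "A (\<lambda>i. u (\<tau> i)) = A u" for u
    unfolding A_def
    using setum_permutations_compose_left[OF \<tau>, of "\<lambda>\<sigma>. T (\<lambda>i. u (\<sigma> i))"] by (simp add: o_def)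
  have "A u = 0" if "u a = u b" for u
    unfolding A_def
  proof (rule sum.neutral, clarify)
    fix \<sigma> assume \<sigma>: "\<sigma> permutes {1..n}"
    define i j where "i = inv \<sigma> a" and "j = inv \<sigma> b"
    have inv: "\<sigma> i = a" "\<sigma> j = b" using permutes_inverses[OF \<sigma>] by (simp_all add: i_def j_def)
    have "i \<in> {1..n}" "j \<in> {1..n}" unfolding i_def j_def permutes_in_image[OF permutes_inv[OF \<sigma>]] using ab by auto
    moreover have "i \<noteq> j" using inv ab by auto
    ultimately have "(i, j) \<in> index_pairs n \<or> (j, i) \<in> index_pairs n" by auto
    moreover have "u (\<sigma> i) = u (\<sigma> j)" unfolding inv by (rule that)
    ultimately show "T (\<lambda>i. u (\<sigma> i)) = 0" using T0[of i j "\<lambda>i. u (\<sigma> i)"] T0[of j i "\<lambda>i. u (\<sigma> i)"] by argo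
  qed
  then obtain C where C: "polyfun C" "\<And>u. A u = (u a - u b) * C u"
  proof -
    have "polyfun A" using A by (simp add: A_def[abs_def])
    moreover have "a \<noteq> b" using ab by auto
    ultimately show thesis using polyfun_divide[of A a b] \<open>\<And>u. u a = u b \<Longrightarrow> A u = 0\<close> that by blast
  qed
  have \<tau>ab: "\<tau> a = b" "\<tau> b = a" by (auto simp: \<tau>_def)
  \<comment> \<open>The exchange of a and b fixes \<open>A\<close> and changes the sign of u a - u
    b. This determines \<open>C\<close> off the diagonal; continuity covers the rest.\<close>
  have "C (\<lambda>i. u (\<tau> i)) + C u = 0" for u
  proof (rule polyfun_zero_along_line[where e = real and u = u])
    show "polyfun (\<lambda>u. C (\<lambda>i. u (\<tau> i)) + C u)" by (rule polyfun.add[OF polyfun_reindex[OF C(1)] C(1)])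
    show "finite {t. \<exists>(c, d)\<in>{(a, b)}. u c + t * real c = u d + t * real d}"
      by (rule finite_line_collisions) (use ab in auto)
    fix t assume "t \<notin> {t. \<exists>(c, d)\<in>{(a, b)}. u c + t * real c = u d + t * real d}"
    then have nz: "(u a + t * real a) - (u b + t * real b) \<noteq> 0" by auto
    define w where "w i = u i + t * real i" for i
    have "(w a - w b) * (C (\<lambda>i. w (\<tau> i)) + C w) = 0"
      using sym[of w] C(2)[of w] C(2)[of "\<lambda>i. w (\<tau> i)"] by (simp add: \<tau>ab algebra_simps)
    then show "C (\<lambda>i. u (\<tau> i) + t * real (\<tau> i)) + C (\<lambda>i. u i + t * real i) = 0"
      using nz by (auto simp: w_def[abs_def])
  qed
  note anti = this
  have "C u = 0" if "u a = u b" for u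
  proof -
    have "u (\<tau> i) = u i" for i
      using that by (cases "i = a"; cases "i = b") (simp_all add: \<tau>_def)
    then show ?thesis using anti[of u] by simp
  qed
  moreover have "a \<noteq> b" using ab by auto
  ultimately obtain C' where C': "polyfun C'" "\<And>u. C u = (u a - u b) * C' u"
    using polyfun_divide[OF C(1), of a b] by blast
  have "A u = (u a - u b)\<^sup>2 * C' u" for u
    unfolding C(2) C'(2) by (simp add: power2_eq_square)
  then show "\<exists>C. polyfun C \<and> (\<forall>u. (\<Sum>\<sigma> | \<sigma> permutes {1..n}. T (\<lambda>i. u (\<sigma> i))) = (u a - u b)\<^sup>2 * C u)"
    using C'(1) unfolding A_def by blast
qed

section \<open>Existence of the limit at coinciding variables\<close>

lemma tendsto_coordinate: "((\<lambda>v. v i) \<longlongrightarrow> (u :: nat \<Rightarrow> real) i) (at u within S)"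
proof -
  have "continuous_on UNIV (\<lambda>v :: nat \<Rightarrow> real. v i)" by simp
  then have "((\<lambda>v. v i) \<longlongrightarrow> u i) (at u)" by (simp add: continuous_on_def)
  then show ?thesis by (rule tendsto_within_subset) simp
qed

text \<open>Needed for the uniqueness of limits. On the line \<open>u i + t * i\<close> collisions
  of the finitely many relevant coordinates occur for finitely many t, and any t other than 0 moves
  the coordinate 1 away from \<open>u\<close>.\<close>

lemma distinct_points_nontrivial:
  "at u within {v. inj_on v {1..n}} \<noteq> (bot :: (nat \<Rightarrow> real) filter)"
proof
  assume bot: "at u within {v. inj_on v {1..n}} = bot"
  define p where "p t i = u i + t * real i" for t i
  define T where "T = {t. \<exists>(c, d)\<in>index_pairs n. u c + t * real c = u d + t * real d}"
  have T: "finite T" unfolding T_def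
    by (rule finite_line_collisions[OF finite_index_pairs]) auto
  have "continuous_on UNIV p" unfolding p_def[abs_def]
    by (intro continuous_on_coordinatewise_then_product continuous_intros)
  then have "(p \<longlongrightarrow> p 0) (at 0)" by (simp add: continuous_on_def)
  moreover have "p 0 = u" by (simp add: p_def fun_eq_iff)
  ultimately have "(p \<longlongrightarrow> u) (at 0)" by simp
  moreover have "eventually (\<lambda>t. p t \<in> {v. inj_on v {1..n}} \<and> p t \<noteq> u) (at 0)"
    using eventually_at_notin_finite[OF T, of 0] eventually_at_notin_finite[of "{0}" "0 :: real", simplified]
  proof eventually_elim
    case (elim t)
    have "p t i \<noteq> p t j" if "1 \<le> i" "i < j" "j \<le> n" for i j
      using elim(1) that by (force simp: T_def p_def)
    then have "inj_on (p t) {1..n}"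
      by (intro linorder_inj_onI) auto
    moreover have "p t 1 \<noteq> u 1" using elim(2) by (simp add: p_def)
    ultimately show ?case by auto
  qed
  ultimately have "filterlim p (at u within {v. inj_on v {1..n}}) (at 0)"
    by (auto simp: filterlim_at elim: eventually_mono)
  then have "filterlim p bot (at (0 :: real))" unfolding bot .
  then show False by (simp add: filterlim_def bot.extremum_unique filtermap_bot_iff)
qed

lemma spin_HL_sum_converges:
  assumes lam: "lam \<in> young_diagrams" "ell lam \<le> n"
    and u: "\<And>i. i \<in> {1..n} \<Longrightarrow> u i \<noteq> s \<and> 1 - s * u i \<noteq> 0"
  shows "\<exists>L. (spin_HL_sum q s lam n \<longlongrightarrow> L) (at u within {v. inj_on v {1..n}})"
proof -
  define N where "N = lam 0"
  \<comment> \<open>The numerator of the factor of one variable over the common denominator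
    \<open>(1 - s * x) ^ N\<close>, where \<open>N\<close> is the largest part. For k > 0 the factor
    \<open>x / (x - s)\<close> cancels one power of x - s.\<close>
  define r where "r k x = (if k = 0 then (1 - s * x) ^ N else x * (x - s) ^ (k - 1) * (1 - s * x) ^ (N - k))" for k x
  \<comment> \<open>Extending each scattering fraction by its denominator turns the total
    denominator into the squared Vandermonde product, the same for every \<sigma>.\<close>
  define T where "T w = (\<Prod>(i, j)\<in>index_pairs n. (w i - q * w j) * (w i - w j)) *
    (\<Prod>i=1..n. r (lam (i - 1)) (w i))" for w :: "nat \<Rightarrow> real"
  have "polyfun (\<lambda>w. r k (w i))" for k i
    by (cases "k = 0") (auto simp: r_def intro!: polyfun.intros polyfun_power polyfun_diff)
  then have T: "polyfun T" unfolding T_def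
    by (auto intro!: polyfun.mult polyfun_prod polyfun_diff polyfun.var polyfun.const simp: case_prod_beta)
  have "T w = 0" if "(i, j) \<in> index_pairs n" "w i = w j" for w i j
    using that finite_index_pairs[of n] by (auto simp: T_def intro!: bexI[of _ "(i, j)"])
  then obtain B where B: "polyfun B" "\<And>v. (\<Sum>\<sigma> | \<sigma> permutes {1..n}. T (\<lambda>i. v (\<sigma> i))) =
      (\<Prod>(i, j)\<in>index_pairs n. (v i - v j)\<^sup>2) * B v"
    using symmetrized_polyfun_divide[OF T] by blast
  define c where "c = (1 - q) ^ n / qpochhammer q q (n - ell lam)"
  define D where "D v = (\<Prod>i=1..n. (1 - s * v i) ^ N)" for v :: "nat \<Rightarrow> real"
  have r: "((x - s) / (1 - s * x)) ^ k * (if k = 0 then 1 else x / (x - s)) = r k x / (1 - s * x) ^ N"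
    if "k \<le> N" "x \<noteq> s" "1 - s * x \<noteq> 0" for k x
  proof (cases k)
    case (Suc m)
    have "(1 - s * x) ^ N = (1 - s * x) ^ k * (1 - s * x) ^ (N - k)" using that by (simp add: power_add[symmetric])
    moreover have "x - s \<noteq> 0" using that by simp
    ultimately show ?thesis using that(3) unfolding r_def Suc by (simp add: power_divide)
  qed (use that in \<open>simp add: r_def\<close>)
  have eq: "spin_HL_sum q s lam n v = c * (B v / D v)"
    if v: "inj_on v {1..n}" "\<And>i. i \<in> {1..n} \<Longrightarrow> v i \<noteq> s \<and> 1 - s * v i \<noteq> 0" for v
  proof -
    define d where "d = (\<Prod>(i, j)\<in>index_pairs n. (v i - v j)\<^sup>2)"
    have d: "d \<noteq> 0" unfolding d_def prod_zero_iff[OF finite_index_pairs]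
    proof clarify
      fix i j assume ij: "1 \<le> i" "i < j" "j \<le> n" and "(v i - v j)\<^sup>2 = 0"
      then have "i = j" by (intro inj_onD[OF v(1)]) auto
      then show False using ij by simp
    qed
    have "(\<Prod>(i, j) \<in> index_pairs n. (v (\<sigma> i) - q * v (\<sigma> j)) / (v (\<sigma> i) - v (\<sigma> j))) *
        (\<Prod>i=1..n. ((v (\<sigma> i) - s) / (1 - s * v (\<sigma> i))) ^ lam (i - 1)) *
        (\<Prod>i=1..ell lam. v (\<sigma> i) / (v (\<sigma> i) - s)) = T (\<lambda>i. v (\<sigma> i)) / (d * D v)"
      if \<sigma>: "\<sigma> permutes {1..n}" for \<sigma>
    proof -
      define w where "w i = v (\<sigma> i)" for i
      have w: "w i \<noteq> s \<and> 1 - s * w i \<noteq> 0" if "i \<in> {1..n}" for i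
        unfolding w_def using v(2) permutes_in_image[OF \<sigma>] that by blast
      have inj: "w i \<noteq> w j" if "(i, j) \<in> index_pairs n" for i j
      proof -
        have "\<sigma> i \<in> {1..n}" "\<sigma> j \<in> {1..n}" "\<sigma> i \<noteq> \<sigma> j"
          unfolding permutes_in_image[OF \<sigma>] using that permutes_inj[OF \<sigma>] by (auto dest: injD)
        then show ?thesis unfolding w_def using v(1) by (meson inj_onD)
      qed
      have "d = (\<Prod>(i, j)\<in>index_pairs n. (w i - w j)\<^sup>2)"
        unfolding d_def w_def by (rule prod_square_differences_permute[OF \<sigma>, symmetric])
      then have "(\<Prod>(i, j)\<in>index_pairs n. (w i - q * w j) * (w i - w j)) / d =
          (\<Prod>p\<in>index_pairs n. (case p of (i, j) \<Rightarrow> (w i - q * w j) * (w i - w j)) / (case p of (i, j) \<Rightarrow> (w i - w j)\<^sup>2))"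
        by (simp add: prod_dividef)
      also have "\<dots> = (\<Prod>(i, j)\<in>index_pairs n. (w i - q * w j) / (w i - w j))"
        using inj by (intro prod.cong refl) (auto simp: power2_eq_square)
      finally have 1: "(\<Prod>(i, j)\<in>index_pairs n. (w i - q * w j) / (w i - w j)) =
          (\<Prod>(i, j)\<in>index_pairs n. (w i - q * w j) * (w i - w j)) / d" ..
      have D: "D v = (\<Prod>i=1..n. (1 - s * w i) ^ N)"
        unfolding D_def w_def using prod.permute[OF \<sigma>, of "\<lambda>i. (1 - s * v i) ^ N"] by (simp add: o_def)
      have "lam i = 0 \<longleftrightarrow> i \<notin> {i. lam i \<noteq> 0}" for i by simp
      then have ell: "lam i = 0 \<longleftrightarrow> ell lam \<le> i" for i unfolding ell_young[OF lam(1)] by (simp add: not_less)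
      have "(\<Prod>i=1..ell lam. w i / (w i - s)) = (\<Prod>i=1..n. if lam (i - 1) = 0 then 1 else w i / (w i - s))"
        using lam(2) by (intro prod.mono_neutral_cong_left) (auto simp: ell)
      then have "(\<Prod>i=1..n. ((w i - s) / (1 - s * w i)) ^ lam (i - 1)) * (\<Prod>i=1..ell lam. w i / (w i - s)) =
          (\<Prod>i=1..n. ((w i - s) / (1 - s * w i)) ^ lam (i - 1) * (if lam (i - 1) = 0 then 1 else w i / (w i - s)))"
        by (simp only: prod.distrib)
      also have "\<dots> = (\<Prod>i=1..n. r (lam (i - 1)) (w i) / (1 - s * w i) ^ N)"
      proof (intro prod.cong refl r)
        fix i assume "i \<in> {1..n}"
        then show "w i \<noteq> s" "1 - s * w i \<noteq> 0" using w by auto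
        show "lam (i - 1) \<le> N" unfolding N_def by (rule young_antimono[OF lam(1)]) simp
      qed
      also have "\<dots> = (\<Prod>i=1..n. r (lam (i - 1)) (w i)) / D v"
        unfolding D by (rule prod_dividef)
      finally show ?thesis unfolding w_def[symmetric] mult.assoc 1 by (simp add: T_def)
    qed
    then have "spin_HL_sum q s lam n v = c * ((\<Sum>\<sigma> | \<sigma> permutes {1..n}. T (\<lambda>i. v (\<sigma> i))) / (d * D v))"
      unfolding spin_HL_sum_def c_def sum_divide_distrib by (intro arg_cong2[where f = "(*)"] sum.cong refl) auto
    also have "\<dots> = c * (B v / D v)" unfolding B(2) d_def[symmetric] using d by simp
    finally show ?thesis .
  qed
  have "((\<lambda>v. c * (B v / D v)) \<longlongrightarrow> c * (B u / D u)) (at u within {v. inj_on v {1..n}})"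
  proof (intro tendsto_intros)
    show "(B \<longlongrightarrow> B u) (at u within {v. inj_on v {1..n}})"
      by (rule polyfun_tendsto[OF B(1) tendsto_coordinate])
    show "(D \<longlongrightarrow> D u) (at u within {v. inj_on v {1..n}})"
      unfolding D_def by (intro tendsto_intros tendsto_coordinate)
    show "D u \<noteq> 0" using u by (auto simp: D_def)
  qed
  moreover have "eventually (\<lambda>v. \<forall>i\<in>{1..n}. v i \<noteq> s \<and> 1 - s * v i \<noteq> 0) (at u within {v. inj_on v {1..n}})"
  proof (rule eventually_ball_finite, simp, rule ballI, rule eventually_conj)
    fix i assume "i \<in> {1..n}"
    then show "eventually (\<lambda>v. v i \<noteq> s) (at u within {v. inj_on v {1..n}})"
      using u by (intro tendsto_imp_eventually_ne[OF tendsto_coordinate]) auto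
    have "((\<lambda>v. 1 - s * v i) \<longlongrightarrow> 1 - s * u i) (at u within {v. inj_on v {1..n}})"
      by (intro tendsto_intros tendsto_coordinate)
    then show "eventually (\<lambda>v. 1 - s * v i \<noteq> 0) (at u within {v. inj_on v {1..n}})"
      using u \<open>i \<in> {1..n}\<close> by (intro tendsto_imp_eventually_ne) auto
  qed
  then have "eventually (\<lambda>v. c * (B v / D v) = spin_HL_sum q s lam n v) (at u within {v. inj_on v {1..n}})"
    unfolding eventually_at_filter
  proof eventually_elim
    case (elim v)
    show ?case
    proof (intro impI)
      assume "v \<noteq> u" "v \<in> {v. inj_on v {1..n}}"
      with elim show "c * (B v / D v) = spin_HL_sum q s lam n v"
        by (intro eq[symmetric]) auto
    qed
  qed
  ultimately have "(spin_HL_sum q s lam n \<longlongrightarrow> c * (B u / D u)) (at u within {v. inj_on v {1..n}})"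
    by (rule Lim_transform_eventually)
  then show ?thesis by blast
qed

lemma spin_HL_tendsto:
  assumes "lam \<in> young_diagrams" "ell lam \<le> n" "\<And>i. i \<in> {1..n} \<Longrightarrow> u i \<noteq> s \<and> 1 - s * u i \<noteq> 0"
    and "\<not> inj_on u {1..n}"
  shows "(spin_HL_sum q s lam n \<longlongrightarrow> spin_HL q s lam n u) (at u within {v. inj_on v {1..n}})"
proof -
  obtain L where L: "(spin_HL_sum q s lam n \<longlongrightarrow> L) (at u within {v. inj_on v {1..n}})"
    using spin_HL_sum_converges[OF assms(1,2), of u s q] assms(3) by blast
  moreover have "Lim (at u within {v. inj_on v {1..n}}) (spin_HL_sum q s lam n) = L"
    using distinct_points_nontrivial L by (intro tendsto_Lim) auto
  ultimately show ?thesis using assms by (simp add: spin_HL_def)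
qed

section \<open>Transposition of diagrams and continuity of the column probabilities\<close>

lemma le_transposed_iff:
  assumes "lam \<in> young_diagrams"
  shows "Suc i \<le> transposed lam j \<longleftrightarrow> Suc j \<le> lam i"
proof -
  define A where "A = {i. Suc j \<le> lam i}"
  have fin: "finite A" unfolding A_def by (rule finite_parts_ge[OF assms])
  have down: "i' \<in> A" if "i \<in> A" "i' \<le> i" for i i'
    using that young_antimono[OF assms that(2)] by (auto simp: A_def)
  have "card A \<ge> Suc i \<longleftrightarrow> i \<in> A"
  proof
    assume "i \<in> A"
    then have "{..i} \<subseteq> A" using down by auto
    then show "card A \<ge> Suc i" using card_mono[OF fin, of "{..i}"] by simp
  next
    assume c: "card A \<ge> Suc i"
    show "i \<in> A"
    proof (rule ccontr)
      assume "i \<notin> A"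
      then have "A \<subseteq> {..<i}" using down not_less by blast
      then show False using c card_mono[of "{..<i}" A] by simp
    qed
  qed
  then show ?thesis by (simp add: transposed_def A_def)
qed

lemma transposed_young:
  assumes "lam \<in> young_diagrams"
  shows "transposed lam \<in> young_diagrams"
proof -
  have "transposed lam j \<le> transposed lam i" if "i \<le> j" for i j
  proof (cases "transposed lam j")
    case (Suc m)
    then have "Suc j \<le> lam m" using le_transposed_iff[OF assms, of m j] by simp
    then show ?thesis using le_transposed_iff[OF assms, of m i] that Suc by simp
  qed simp
  moreover have "finite {i. transposed lam i \<noteq> 0}"
    by (rule finite_subset[of _ "{..<lam 0}"]) (auto simp: transposed_eq_0_iff[OF assms] not_le)
  ultimately show ?thesis by (simp add: young_diagrams_def antimono_def)
qed

lemma transposed_transposed: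
  assumes "lam \<in> young_diagrams"
  shows "transposed (transposed lam) = lam"
proof
  fix i
  have "{j. Suc i \<le> transposed lam j} = {..<lam i}"
    unfolding le_transposed_iff[OF assms] by auto
  then show "transposed (transposed lam) i = lam i" by (simp add: transposed_def[of "transposed lam"])
qed

lemma bit_weight_tendsto:
  assumes "(w \<longlongrightarrow> u) F" "1 + u * \<theta> \<noteq> 0"
  shows "((\<lambda>v. bit_weight q s \<theta> (w v) g a b) \<longlongrightarrow> bit_weight q s \<theta> u g a b) F"
  using assms by (cases a; cases b) (auto simp: bit_weight_simps intro!: tendsto_intros)

lemma column_tendsto:
  assumes "distinct js" "\<And>j. j \<in> set js \<Longrightarrow> ((\<lambda>v. w v j) \<longlongrightarrow> u j) F \<and> 1 + u j * \<theta> \<noteq> 0"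
    and "\<And>b. ((\<lambda>v. G v (map (\<lambda>j. (w v j, b j)) js)) \<longlongrightarrow> G0 (map (\<lambda>j. (u j, b j)) js)) F"
  shows "((\<lambda>v. column_transfer q s \<theta> g (G v) (map (\<lambda>j. (w v j, b j)) js)) \<longlongrightarrow>
    column_transfer q s \<theta> g G0 (map (\<lambda>j. (u j, b j)) js)) F"
  using assms
proof (induction js arbitrary: g G G0)
  case Nil
  then show ?case by simp
next
  case (Cons j js)
  have "((\<lambda>v. column_transfer q s \<theta> h (\<lambda>l. G v ((w v j, a) # l)) (map (\<lambda>j. (w v j, b j)) js)) \<longlongrightarrow>
      column_transfer q s \<theta> h (\<lambda>l. G0 ((u j, a) # l)) (map (\<lambda>j. (u j, b j)) js)) F" for a h
  proof (rule Cons.IH)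
    fix b' :: "'a \<Rightarrow> bool"
    have upd: "map (\<lambda>i. (f i, (b'(j := a)) i)) js = map (\<lambda>i. (f i, b' i)) js" for f :: "'a \<Rightarrow> real"
      using Cons.prems(1) by auto
    from Cons.prems(3)[of "b'(j := a)"]
    show "((\<lambda>v. G v ((w v j, a) # map (\<lambda>j. (w v j, b' j)) js)) \<longlongrightarrow> G0 ((u j, a) # map (\<lambda>j. (u j, b' j)) js)) F"
      unfolding list.map upd by simp
  qed (use Cons.prems in auto)
  moreover have "((\<lambda>v. bit_weight q s \<theta> (w v j) g a (b j)) \<longlongrightarrow> bit_weight q s \<theta> (u j) g a (b j)) F" for a
    using Cons.prems(2)[of j] by (intro bit_weight_tendsto) auto
  ultimately show ?case
    unfolding list.map column_Cons by (intro tendsto_intros)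
qed

lemma column_prob_tendsto:
  assumes "distinct js" "\<And>i j. 1 \<le> i \<Longrightarrow> j \<in> set js \<Longrightarrow> ((\<lambda>v. w v j) \<longlongrightarrow> u j) F \<and> 1 + u j * \<theta> i \<noteq> 0"
  shows "((\<lambda>v. column_prob q s \<theta> x (map (\<lambda>j. (w v j, b j)) js)) \<longlongrightarrow>
    column_prob q s \<theta> x (map (\<lambda>j. (u j, b j)) js)) F"
proof (induction x arbitrary: b)
  case 0
  then show ?case by simp
next
  case (Suc x)
  then show ?case unfolding column_prob.simps
    using assms by (intro column_tendsto) auto
qed

lemma length_law_distinct:
  assumes q: "0 \<le> q" "q < 1" and s: "\<bar>s\<bar> < 1" and \<theta>: "\<And>i. i \<ge> 1 \<Longrightarrow> \<theta> i \<noteq> 0"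
    and u: "inj_on u {1..y}" "regular_set s \<theta> (u ` {1..y})" and k: "k \<le> y"
  shows "(\<Sum>lam | lam \<in> diagrams x y \<and> lam 0 = k. (\<Prod>i=1..x. \<Prod>j=1..y. (1 - u j * s) / (1 + u j * \<theta> i)) *
      spin_HL_sum q s (transposed lam) y u * dual_spin_qW q s lam x \<theta>) =
    (\<Sum>J | J \<subseteq> {1..y} \<and> card J = k. column_prob q s \<theta> x (map (\<lambda>j. (u j, j \<notin> J)) [1..<Suc y]))"
proof -
  have set: "set [1..<Suc y] = {1..y}" and len: "length [1..<Suc y] = y" by auto
  have "(\<Prod>v\<in>u ` {1..y}. pass_weight s \<theta> x v) = (\<Prod>i=1..x. \<Prod>j=1..y. (1 - u j * s) / (1 + u j * \<theta> i))"
    unfolding pass_weight_def by (subst prod.reindex[OF u(1)]) (simp, rule prod.swap)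
  then have "(\<Sum>lam | lam \<in> diagrams x y \<and> lam 0 = k. (\<Prod>i=1..x. \<Prod>j=1..y. (1 - u j * s) / (1 + u j * \<theta> i)) *
      spin_HL_sum q s (transposed lam) y u * dual_spin_qW q s lam x \<theta>) =
    (\<Prod>v\<in>u ` {1..y}. pass_weight s \<theta> x v) * (\<Sum>lam | lam \<in> diagrams x y \<and> lam 0 = k.
      HL_norm q y lam * bethe q (HL_factor s) (part_list y lam 0) (u ` {1..y}) * dual_spin_qW q s lam x \<theta>)"
    unfolding sum_distrib_left
    by (intro sum.cong refl) (auto simp: spin_HL_sum_eq_bethe[OF _ _ u(1)] diagrams_def)
  also have "\<dots> = (\<Sum>J | J \<subseteq> {1..y} \<and> card J = k. column_prob q s \<theta> x (map (\<lambda>j. (u j, j \<notin> J)) [1..<Suc y]))"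
    using column_prob_eq_fixed_length_sum[OF q s \<theta>, where js = "[1..<Suc y]" and u = u and U = "u ` {1..y}" and k = k and x = x] u k
    unfolding set len by simp
  finally show ?thesis .
qed

text \<open>For negative v the worst case is \<theta> = -1/s, where the value is 1 - v/s; this is
  still positive as long as v > s.\<close>

lemma one_plus_mult_pos:
  assumes s: "- 1 < s" "s < 0" and \<theta>: "\<theta> \<in> {- s .. - inverse s}" and v: "s < v"
  shows "0 < 1 + v * (\<theta> :: real)"
proof (cases "v \<ge> 0")
  case True
  then have "0 \<le> v * \<theta>" using \<theta> s by auto
  then show ?thesis by simp
next
  case False
  then have "v * \<theta> \<ge> v * (- inverse s)" using \<theta> by (intro mult_left_mono_neg) auto
  moreover have "v * inverse s < s * inverse s" using v s by (intro mult_strict_right_mono_neg) auto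
  ultimately show ?thesis using s by simp
qed

lemma one_minus_mult_pos:
  assumes s: "- 1 < s" "s < 0" and v: "s < v"
  shows "0 < 1 - s * (v :: real)"
proof -
  have "s * v < s * s" using v s by (intro mult_strict_left_mono_neg) auto
  also have "s * s < 1" using s abs_square_less_1[of s] by (simp add: power2_eq_square)
  finally show ?thesis by simp
qed

lemma regular_setI:
  assumes "- 1 < s" "s < 0" "\<And>i. i \<ge> 1 \<Longrightarrow> \<theta> i \<in> {- s .. - inverse s}"
    and "finite U" "\<And>v. v \<in> U \<Longrightarrow> s < v"
  shows "regular_set s \<theta> U"
  unfolding regular_set_def
proof (intro conjI ballI allI impI)
  fix v assume v: "v \<in> U"
  show "1 - s * v \<noteq> 0" using one_minus_mult_pos[of s v] assms v by force
  show "v \<noteq> s" using assms v by force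
  show "1 + v * \<theta> i \<noteq> 0" if "1 \<le> i" for i using one_plus_mult_pos[of s "\<theta> i" v] assms v that by force
qed fact

text \<open>The condition s < u j is open, unlike u j in [0,1). The distinct points that approximate
  \<open>u\<close> may have negative coordinates when some u j is 0, but they finally stay in this
  region.\<close>

lemma length_law:
  assumes q: "0 \<le> q" "q < 1" and s: "- 1 < s" "s < 0"
    and \<theta>: "\<And>i. i \<ge> 1 \<Longrightarrow> \<theta> i \<in> {- s .. - inverse s}"
    and u: "\<And>j. j \<in> {1..y} \<Longrightarrow> s < u j" and k: "k \<le> y"
  shows "(\<Sum>lam | lam \<in> diagrams x y \<and> lam 0 = k. (\<Prod>i=1..x. \<Prod>j=1..y. (1 - u j * s) / (1 + u j * \<theta> i)) *
      spin_HL q s (transposed lam) y u * dual_spin_qW q s lam x \<theta>) =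
    (\<Sum>J | J \<subseteq> {1..y} \<and> card J = k. column_prob q s \<theta> x (map (\<lambda>j. (u j, j \<notin> J)) [1..<Suc y]))"
    (is "?L = ?R")
proof -
  define A where "A v = (\<Prod>i=1..x. \<Prod>j=1..y. (1 - v j * s) / (1 + v j * \<theta> i))" for v :: "nat \<Rightarrow> real"
  define R where "R v = (\<Sum>J | J \<subseteq> {1..y} \<and> card J = k.
    column_prob q s \<theta> x (map (\<lambda>j. (v j, j \<notin> J)) [1..<Suc y]))" for v :: "nat \<Rightarrow> real"
  have s1: "\<bar>s\<bar> < 1" and \<theta>0: "\<And>i. i \<ge> 1 \<Longrightarrow> \<theta> i \<noteq> 0" using s \<theta> by force+
  have law: "(\<Sum>lam | lam \<in> diagrams x y \<and> lam 0 = k. A v * spin_HL_sum q s (transposed lam) y v * dual_spin_qW q s lam x \<theta>) = R v"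
    if v: "inj_on v {1..y}" "\<forall>j\<in>{1..y}. s < v j" for v
    unfolding A_def R_def
    using v by (intro length_law_distinct[OF q s1 \<theta>0 _ _ k] regular_setI[OF s \<theta>]) auto
  have nz: "1 + u j * \<theta> i \<noteq> 0" "u j \<noteq> s" "1 - s * u j \<noteq> 0" if "1 \<le> i" "j \<in> {1..y}" for i j
    using one_plus_mult_pos[OF s \<theta> u, of i j] one_minus_mult_pos[OF s u, of j] u[of j] that by force+
  have lam: "transposed lam \<in> young_diagrams" "ell (transposed lam) \<le> y" if "lam \<in> diagrams x y" for lam
    using that ell_transposed[of lam] transposed_young[of lam] by (auto simp: diagrams_def)
  show ?thesis
  proof (cases "inj_on u {1..y}")
    case True
    have "spin_HL q s (transposed lam) y u = spin_HL_sum q s (transposed lam) y u" if "lam \<in> diagrams x y" for lam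
      using lam[OF that] True by (simp add: spin_HL_def)
    then show ?thesis using law[OF True] u by (simp add: A_def R_def)
  next
    case False
    let ?F = "at u within {v. inj_on v {1..y}}"
    have "((\<lambda>v. \<Sum>lam | lam \<in> diagrams x y \<and> lam 0 = k. A v * spin_HL_sum q s (transposed lam) y v * dual_spin_qW q s lam x \<theta>)
        \<longlongrightarrow> (\<Sum>lam | lam \<in> diagrams x y \<and> lam 0 = k. A u * spin_HL q s (transposed lam) y u * dual_spin_qW q s lam x \<theta>)) ?F"
    proof (rule tendsto_sum, rule tendsto_mult[OF tendsto_mult tendsto_const])
      fix nu assume "nu \<in> {lam \<in> diagrams x y. lam 0 = k}"
      then have nu: "nu \<in> diagrams x y" by simp
      show "(A \<longlongrightarrow> A u) ?F" unfolding A_def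
        using nz by (intro tendsto_prod tendsto_divide tendsto_diff tendsto_add tendsto_mult tendsto_const tendsto_coordinate) auto
      show "((\<lambda>v. spin_HL_sum q s (transposed nu) y v) \<longlongrightarrow> spin_HL q s (transposed nu) y u) ?F"
        using lam[OF nu] nz[of 1] False by (intro spin_HL_tendsto) auto
    qed
    note limit = this
    have R: "(R \<longlongrightarrow> R u) ?F" unfolding R_def
      using nz by (intro tendsto_sum column_prob_tendsto conjI tendsto_coordinate) auto
    have "eventually (\<lambda>v. R v = (\<Sum>lam | lam \<in> diagrams x y \<and> lam 0 = k.
        A v * spin_HL_sum q s (transposed lam) y v * dual_spin_qW q s lam x \<theta>)) ?F"
    proof -
      have "eventually (\<lambda>v. \<forall>j\<in>{1..y}. s < v j) ?F"
        using u by (intro eventually_ball_finite ballI order_tendstoD(1)[OF tendsto_coordinate]) auto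
      then show ?thesis
        unfolding eventually_at_filter by eventually_elim (auto intro!: law[symmetric])
    qed
    from Lim_transform_eventually[OF R this] have "((\<lambda>v. \<Sum>lam | lam \<in> diagrams x y \<and> lam 0 = k.
        A v * spin_HL_sum q s (transposed lam) y v * dual_spin_qW q s lam x \<theta>) \<longlongrightarrow> R u) ?F" .
    from this limit have "R u = (\<Sum>lam | lam \<in> diagrams x y \<and> lam 0 = k. A u * spin_HL q s (transposed lam) y u * dual_spin_qW q s lam x \<theta>)"
      using tendsto_unique[OF distinct_points_nontrivial] by blast
    then show ?thesis by (simp add: A_def R_def)
  qed
qed

section \<open>Probabilities in the vertex model\<close>

definition agree_on :: "'a measure \<Rightarrow> ('a \<Rightarrow> nat \<Rightarrow> nat \<Rightarrow> nat) \<Rightarrow> ('a \<Rightarrow> nat \<Rightarrow> nat \<Rightarrow> nat) \<Rightarrow>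
    (nat \<times> nat) set \<Rightarrow> (nat \<Rightarrow> nat \<Rightarrow> nat) \<Rightarrow> (nat \<Rightarrow> nat \<Rightarrow> nat) \<Rightarrow> 'a set" where
  "agree_on N V H R v h = {\<omega> \<in> space N. \<forall>(i, j)\<in>R. V \<omega> i j = v i j \<and> H \<omega> i j = h i j}"

definition local_weight :: "real \<Rightarrow> real \<Rightarrow> (nat \<Rightarrow> real) \<Rightarrow> (nat \<Rightarrow> real) \<Rightarrow>
    (nat \<Rightarrow> nat \<Rightarrow> nat) \<Rightarrow> (nat \<Rightarrow> nat \<Rightarrow> nat) \<Rightarrow> nat \<times> nat \<Rightarrow> real" where
  "local_weight q s \<theta> u v h = (\<lambda>(i, j).
     vertex_weight q s (u j) (\<theta> i) (v i (j - 1)) (h (i - 1) j) (v i j) (h i j))"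

definition vertex_triangle :: "nat \<Rightarrow> (nat \<times> nat) set" where
  "vertex_triangle n = {(i, j). 1 \<le> i \<and> 1 \<le> j \<and> i + j \<le> n}"

lemma finite_vertex_triangle: "finite (vertex_triangle n)"
  by (rule finite_subset[of _ "{..n} \<times> {..n}"]) (auto simp: vertex_triangle_def)

definition down_closed :: "(nat \<times> nat) set \<Rightarrow> bool" where
  "down_closed R \<longleftrightarrow> (\<forall>(i, j)\<in>R. (2 \<le> i \<longrightarrow> (i - 1, j) \<in> R) \<and> (2 \<le> j \<longrightarrow> (i, j - 1) \<in> R))"

lemma measure_agree_on_triangle:
  assumes "stochastic_hs6v q s \<theta> u N V H" "step_boundary v h"
  shows "measure N (agree_on N V H (vertex_triangle n) v h) = prod (local_weight q s \<theta> u v h) (vertex_triangle n)"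
proof (induction n)
  case 0
  have "vertex_triangle 0 = {}" by (auto simp: vertex_triangle_def)
  then show ?case using assms(1) prob_space.prob_space[of N]
    by (simp add: agree_on_def stochastic_hs6v_def)
next
  case (Suc n)
  define D where "D = {(i, j). 1 \<le> i \<and> 1 \<le> j \<and> i + j = Suc n}"
  have eq: "agree_on N V H (vertex_triangle m) v h = agree_upto N V H m v h" for m
    by (auto simp: agree_on_def agree_upto_def vertex_triangle_def)
  have tri: "vertex_triangle (Suc n) = vertex_triangle n \<union> D" "vertex_triangle n \<inter> D = {}"
    by (auto simp: vertex_triangle_def D_def)
  have "finite D" using finite_vertex_triangle[of "Suc n"] tri by simp
  then have "prod (local_weight q s \<theta> u v h) (vertex_triangle (Suc n)) =
      prod (local_weight q s \<theta> u v h) (vertex_triangle n) * prod (local_weight q s \<theta> u v h) D"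
    unfolding tri(1) using finite_vertex_triangle tri(2) by (intro prod.union_disjoint)
  moreover have "measure N (agree_upto N V H (Suc n) v h) =
      measure N (agree_upto N V H n v h) * prod (local_weight q s \<theta> u v h) D"
    using assms unfolding stochastic_hs6v_def D_def local_weight_def by blast
  ultimately show ?case using Suc.IH by (simp add: eq)
qed

lemma sets_agree_on:
  assumes "stochastic_hs6v q s \<theta> u N V H" "finite R"
  shows "agree_on N V H R v h \<in> sets N"
proof -
  have "{\<omega> \<in> space N. V \<omega> i j = v i j \<and> H \<omega> i j = h i j} \<in> sets N" for i j
  proof -
    have "(\<lambda>\<omega>. V \<omega> i j) \<in> N \<rightarrow>\<^sub>M count_space UNIV" "(\<lambda>\<omega>. H \<omega> i j) \<in> N \<rightarrow>\<^sub>M count_space UNIV"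
      using assms(1) by (auto simp: stochastic_hs6v_def)
    then show ?thesis by measurable
  qed
  then have "{\<omega> \<in> space N. \<forall>p\<in>R. V \<omega> (fst p) (snd p) = v (fst p) (snd p) \<and> H \<omega> (fst p) (snd p) = h (fst p) (snd p)} \<in> sets N"
    using assms(2) by (intro sets.sets_Collect_finite_All) auto
  then show ?thesis by (simp add: agree_on_def case_prod_beta)
qed

text \<open>Lower bounds are enough here and below, because those for the distribution of the height sum to one.\<close>

lemma measure_agree_on_ge:
  assumes hs: "stochastic_hs6v q s \<theta> u N V H"
    and nz: "\<And>i j. 1 \<le> i \<Longrightarrow> 1 \<le> j \<Longrightarrow> 1 + u j * \<theta> i \<noteq> 0"
    and "step_boundary v h" "down_closed R" "R \<subseteq> vertex_triangle n"
  shows "prod (local_weight q s \<theta> u v h) R \<le> measure N (agree_on N V H R v h)"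
  using assms(3-5)
proof (induction "card (vertex_triangle n - R)" arbitrary: R v h rule: less_induct)
  case less
  interpret N: prob_space N using hs by (simp add: stochastic_hs6v_def)
  show ?case
  proof (cases "R = vertex_triangle n")
    case True
    then show ?thesis using measure_agree_on_triangle[OF hs less.prems(1)] by simp
  next
    case False
    then have "vertex_triangle n - R \<noteq> {}" using less.prems by auto
    \<comment> \<open>Both vertices feeding a missing vertex with the least coordinate sum belong to
      \<open>R\<close> or to the boundary. Adding it keeps \<open>R\<close> down closed and is the
      induction step towards the full triangle.\<close>
    then obtain p where "is_arg_min (\<lambda>r. fst r + snd r) (\<lambda>r. r \<in> vertex_triangle n - R) p"
      using ex_is_arg_min_if_finite[of "vertex_triangle n - R"] finite_vertex_triangle by blast
    then have p: "p \<in> vertex_triangle n - R" "\<And>r. r \<in> vertex_triangle n - R \<Longrightarrow> fst p + snd p \<le> fst r + snd r"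
      by (auto simp: is_arg_min_linorder)
    obtain a b where ab: "p = (a, b)" by (cases p)
    have ab1: "1 \<le> a" "1 \<le> b" "a + b \<le> n" "(a, b) \<notin> R" using p(1) by (auto simp: ab vertex_triangle_def)
    have left: "(a - 1, b) \<in> R" if "2 \<le> a"
    proof (rule ccontr)
      assume "(a - 1, b) \<notin> R"
      then have "(a - 1, b) \<in> vertex_triangle n - R" using ab1 that by (auto simp: vertex_triangle_def)
      from p(2)[OF this] show False using that by (simp add: ab)
    qed
    have below: "(a, b - 1) \<in> R" if "2 \<le> b"
    proof (rule ccontr)
      assume "(a, b - 1) \<notin> R"
      then have "(a, b - 1) \<in> vertex_triangle n - R" using ab1 that by (auto simp: vertex_triangle_def)
      from p(2)[OF this] show False using that by (simp add: ab)
    qed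
    have finR: "finite R" using less.prems(3) finite_vertex_triangle finite_subset by blast
    define g where "g = v a (b - 1)"
    define i1 where "i1 = h (a - 1) b"
    show ?thesis
    proof (cases "i1 \<le> 1")
      case False
      \<comment> \<open>Two or more paths on a horizontal edge cannot come from the boundary, and as
        an output of a vertex in \<open>R\<close> they have weight 0.\<close>
      then have "2 \<le> a" using less.prems(1) ab1 by (cases "a = 1") (auto simp: i1_def step_boundary_def)
      moreover have "local_weight q s \<theta> u v h (a - 1, b) = 0"
        using False by (auto simp: local_weight_def vertex_weight_def i1_def)
      ultimately have "prod (local_weight q s \<theta> u v h) R = 0"
        using left finR by (meson prod_zero)
      then show ?thesis by simp
    next
      case True
      define \<alpha> where "\<alpha> \<longleftrightarrow> i1 = 1"
      have i1: "i1 = of_bool \<alpha>" using True by (cases i1) (auto simp: \<alpha>_def)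
      \<comment> \<open>The configuration is changed at \<open>(a, b)\<close> only: \<open>d\<close>
        is the new horizontal output, and path conservation then forces the vertical one.\<close>
      define v' where "v' d = v(a := (v a)(b := out_edge g \<alpha> d))" for d
      define h' where "h' d = h(a := (h a)(b := of_bool d))" for d
      have sb: "step_boundary (v' d) (h' d)" for d
        using less.prems(1) ab1 by (auto simp: step_boundary_def v'_def h'_def)
      have dc: "down_closed (insert (a, b) R)"
        using less.prems(2) left below by (auto simp: down_closed_def)
      have sub: "insert (a, b) R \<subseteq> vertex_triangle n" using p less.prems(3) ab by auto
      have card: "card (vertex_triangle n - insert (a, b) R) < card (vertex_triangle n - R)"
        using p(1) finite_vertex_triangle[of n] unfolding ab by (intro psubset_card_mono) auto
      \<comment> \<open>As \<open>R\<close> is down closed and does not contain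
        \<open>(a, b)\<close>, no vertex of \<open>R\<close> takes an input from there.\<close>
      have eqR: "local_weight q s \<theta> u (v' d) (h' d) r = local_weight q s \<theta> u v h r" if r: "r \<in> R" for r d
      proof -
        obtain i j where ij: "r = (i, j)" by (cases r)
        have ne: "(i, j) \<noteq> (a, b)" using r ij ab1 by auto
        have "1 \<le> i" "1 \<le> j" using r less.prems(3) by (auto simp: ij vertex_triangle_def)
        have "(i, j - 1) \<noteq> (a, b)"
        proof
          assume *: "(i, j - 1) = (a, b)"
          then have "2 \<le> j" using ab1 by auto
          then have "(i, j - 1) \<in> R" using less.prems(2) r by (auto simp: down_closed_def ij)
          then show False using * ab1 by simp
        qed
        moreover have "(i - 1, j) \<noteq> (a, b)"
        proof
          assume *: "(i - 1, j) = (a, b)"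
          then have "2 \<le> i" using ab1 by auto
          then have "(i - 1, j) \<in> R" using less.prems(2) r by (auto simp: down_closed_def ij)
          then show False using * ab1 by simp
        qed
        ultimately show ?thesis using ne by (auto simp: local_weight_def ij v'_def h'_def)
      qed
      have wp: "local_weight q s \<theta> u (v' d) (h' d) (a, b) = bit_weight q s (\<theta> a) (u b) g \<alpha> d" for d
      proof -
        have "b - 1 \<noteq> b" "a - 1 \<noteq> a" using ab1 by auto
        then show ?thesis
          by (simp add: local_weight_def v'_def h'_def bit_weight_def g_def i1[symmetric] i1_def)
      qed
      define E where "E d = agree_on N V H (insert (a, b) R) (v' d) (h' d)" for d
      have ge: "prod (local_weight q s \<theta> u v h) R * bit_weight q s (\<theta> a) (u b) g \<alpha> d \<le> measure N (E d)" for d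
        using less.hyps[OF card sb dc sub, of d] finR ab1 eqR unfolding E_def
        by (simp add: wp mult.commute cong: prod.cong)
      have "prod (local_weight q s \<theta> u v h) R =
          prod (local_weight q s \<theta> u v h) R * bit_weight q s (\<theta> a) (u b) g \<alpha> False +
          prod (local_weight q s \<theta> u v h) R * bit_weight q s (\<theta> a) (u b) g \<alpha> True"
        using sum_bit_weight[OF nz[OF ab1(1,2)], of q s g \<alpha>] by (simp add: distrib_left[symmetric])
      also have "\<dots> \<le> measure N (E False) + measure N (E True)"
        using ge by (intro add_mono)
      also have "\<dots> = measure N (E False \<union> E True)"
      proof (rule N.finite_measure_Union[symmetric])
        show "E False \<in> sets N" "E True \<in> sets N" unfolding E_def using hs finR by (auto intro: sets_agree_on)
        show "E False \<inter> E True = {}" by (auto simp: E_def agree_on_def h'_def)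
      qed
      also have "\<dots> \<le> measure N (agree_on N V H R v h)"
      proof (rule N.finite_measure_mono)
        have "\<omega> \<in> agree_on N V H R v h" if "\<omega> \<in> E d" for \<omega> d
        proof -
          have "V \<omega> i j = v i j \<and> H \<omega> i j = h i j" if "(i, j) \<in> R" for i j
          proof -
            have "V \<omega> i j = v' d i j \<and> H \<omega> i j = h' d i j" "(i, j) \<noteq> (a, b)"
              using \<open>\<omega> \<in> E d\<close> that ab1 by (auto simp: E_def agree_on_def)
            then show ?thesis by (auto simp: v'_def h'_def split: if_splits)
          qed
          then show ?thesis using that by (auto simp: E_def agree_on_def)
        qed
        then show "E False \<union> E True \<subseteq> agree_on N V H R v h" by auto
        show "agree_on N V H R v h \<in> sets N" using hs finR by (rule sets_agree_on)
      qed
      finally show ?thesis .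
    qed
  qed
qed

section \<open>From full configurations to the horizontal edges of one column\<close>

lemma disjoint_column_events:
  assumes "\<And>A. A \<in> P \<Longrightarrow> A \<subseteq> S"
    and E: "\<And>A \<omega> j. A \<in> P \<Longrightarrow> \<omega> \<in> E A \<Longrightarrow> j \<in> S \<Longrightarrow> X \<omega> j = (of_bool (j \<notin> A) :: nat)"
  shows "disjoint_family_on E P"
unfolding disjoint_family_on_def
proof (intro ballI impI)
  fix A B assume AB: "A \<in> P" "B \<in> P" "A \<noteq> B"
  then obtain j where j: "j \<in> S" "j \<in> A \<longleftrightarrow> j \<notin> B" using assms(1) by blast
  then have "(of_bool (j \<notin> A) :: nat) = of_bool (j \<notin> B)" if "\<omega> \<in> E A" "\<omega> \<in> E B" for \<omega>
    using E AB that by metis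
  then show "E A \<inter> E B = {}" using j(2) by auto
qed

fun column_path_weight :: "real \<Rightarrow> real \<Rightarrow> (nat \<Rightarrow> real) \<Rightarrow> real \<Rightarrow> nat \<Rightarrow> nat list \<Rightarrow> (nat \<Rightarrow> bool) \<Rightarrow> (nat \<Rightarrow> bool) \<Rightarrow> real" where
  "column_path_weight q s u \<theta> g [] a b = 1"
| "column_path_weight q s u \<theta> g (j # js) a b =
     bit_weight q s \<theta> (u j) g (a j) (b j) * column_path_weight q s u \<theta> (out_edge g (a j) (b j)) js a b"

lemma column_path_weight_cong:
  "(\<And>j. j \<in> set js \<Longrightarrow> a j = a' j \<and> b j = b' j) \<Longrightarrow>
    column_path_weight q s u \<theta> g js a b = column_path_weight q s u \<theta> g js a' b'"
  by (induction js arbitrary: g) auto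

lemma column_eq_sum_paths:
  assumes "distinct js"
  shows "column_transfer q s \<theta> g F (map (\<lambda>j. (u j, b j)) js) =
    (\<Sum>A\<in>Pow (set js). column_path_weight q s u \<theta> g js (\<lambda>j. j \<notin> A) b * F (map (\<lambda>j. (u j, j \<notin> A)) js))"
  using assms
proof (induction js arbitrary: g F)
  case (Cons j js)
  have j: "j \<notin> set js" using Cons.prems by simp
  have m: "map (\<lambda>i. (u i, i \<notin> insert j A)) js = map (\<lambda>i. (u i, i \<notin> A)) js" for A
    using j by auto
  have c: "column_path_weight q s u \<theta> h js (\<lambda>i. i \<notin> insert j A) b = column_path_weight q s u \<theta> h js (\<lambda>i. i \<notin> A) b" for A h
    using j by (intro column_path_weight_cong) auto
  show ?case
    unfolding list.set sum_Pow_insert[OF finite_set j] list.map column_Cons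
      Cons.IH[OF distinct.simps(2)[THEN iffD1, THEN conjunct2, OF Cons.prems]] sum_distrib_left sum.distrib[symmetric]
  proof (intro sum.cong refl, goal_cases)
    case (1 A)
    then have jA: "(j \<in> A) = False" using j by auto
    show ?case unfolding column_path_weight.simps c m jA by simp
  qed
qed simp

text \<open>The horizontal bits determine the vertical edges by path conservation, starting with no
  path at the bottom. Impossible bit patterns have weight 0, whatever the truncated subtraction
  yields.\<close>

definition path_config :: "(nat \<Rightarrow> nat \<Rightarrow> bool) \<Rightarrow> nat \<Rightarrow> nat \<Rightarrow> nat" where
  "path_config \<beta> i = rec_nat 0 (\<lambda>j g. out_edge g (\<beta> (i - 1) (Suc j)) (\<beta> i (Suc j)))"

lemma path_config_simps [simp]:
  "path_config \<beta> i 0 = 0"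
  "path_config \<beta> i (Suc j) = out_edge (path_config \<beta> i j) (\<beta> (i - 1) (Suc j)) (\<beta> i (Suc j))"
  by (simp_all add: path_config_def)

lemma prod_column_weights:
  "(\<Prod>j\<in>{Suc k..<Suc y}. bit_weight q s \<theta> (u j) (path_config \<beta> i (j - 1)) (\<beta> (i - 1) j) (\<beta> i j)) =
    column_path_weight q s u \<theta> (path_config \<beta> i k) [Suc k..<Suc y] (\<beta> (i - 1)) (\<beta> i)"
proof (induction "y - k" arbitrary: k)
  case (Suc m)
  then have ky: "Suc k < Suc y" by simp
  have "{Suc k..<Suc y} = insert (Suc k) {Suc (Suc k)..<Suc y}" using ky by auto
  moreover have "[Suc k..<Suc y] = Suc k # [Suc (Suc k)..<Suc y]" using ky by (rule upt_conv_Cons)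
  moreover have "(\<Prod>j\<in>{Suc (Suc k)..<Suc y}. bit_weight q s \<theta> (u j) (path_config \<beta> i (j - 1)) (\<beta> (i - 1) j) (\<beta> i j)) =
      column_path_weight q s u \<theta> (path_config \<beta> i (Suc k)) [Suc (Suc k)..<Suc y] (\<beta> (i - 1)) (\<beta> i)"
    using Suc.hyps(2) by (intro Suc.hyps(1)) simp
  ultimately show ?case by (simp del: upt_Suc)
qed simp

text \<open>For m = 0 the left side is the weight of a full rectangle, for m = x it is
  \<open>column_prob\<close>. The step from m to m + 1 sums over the edges between the columns m and
  m + 1, that is, over disjoint events.\<close>

lemma measure_column_history_ge:
  assumes hs: "stochastic_hs6v q s \<theta> u N V H"
    and nz: "\<And>i j. 1 \<le> i \<Longrightarrow> 1 \<le> j \<Longrightarrow> 1 + u j * \<theta> i \<noteq> 0" and "m \<le> x"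
  shows "column_prob q s \<theta> m (map (\<lambda>j. (u j, \<beta> m j)) [1..<Suc y]) *
      (\<Prod>k\<in>{Suc m..x}. column_path_weight q s u (\<theta> k) 0 [1..<Suc y] (\<beta> (k - 1)) (\<beta> k)) \<le>
    measure N {\<omega> \<in> space N. \<forall>k\<in>{m..x}. \<forall>j\<in>{1..y}. H \<omega> k j = of_bool (\<beta> k j)}"
  using \<open>m \<le> x\<close>
proof (induction m arbitrary: \<beta>)
  case 0
  interpret N: prob_space N using hs by (simp add: stochastic_hs6v_def)
  have Hm: "(\<lambda>\<omega>. H \<omega> i j) \<in> N \<rightarrow>\<^sub>M count_space UNIV" for i j
    using hs by (auto simp: stochastic_hs6v_def)
  show ?case
  proof (cases "\<forall>j\<in>{1..y}. \<beta> 0 j")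
    case True
    \<comment> \<open>The assumption on \<open>\<beta> 0\<close> only concerns the rows up to y, but
      the step boundary asks for a path in every row.\<close>
    define \<gamma> where "\<gamma> = \<beta>(0 := \<lambda>_. True)"
    define v where "v = path_config \<gamma>"
    define h :: "nat \<Rightarrow> nat \<Rightarrow> nat" where "h i j = of_bool (\<gamma> i j)" for i j
    define R where "R = {1..x} \<times> {1..y}"
    have bd: "step_boundary v h" by (auto simp: step_boundary_def v_def h_def \<gamma>_def)
    have "down_closed R" by (auto simp: down_closed_def R_def)
    moreover have "R \<subseteq> vertex_triangle (x + y)" by (auto simp: R_def vertex_triangle_def)
    ultimately have ge: "prod (local_weight q s \<theta> u v h) R \<le> measure N (agree_on N V H R v h)"
      using hs nz bd by (intro measure_agree_on_ge)
    have "prod (local_weight q s \<theta> u v h) R = (\<Prod>i\<in>{1..x}. \<Prod>j\<in>{1..y}. local_weight q s \<theta> u v h (i, j))"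
      unfolding R_def by (simp add: prod.cartesian_product)
    also have "\<dots> = (\<Prod>k\<in>{Suc 0..x}. column_path_weight q s u (\<theta> k) 0 [1..<Suc y] (\<beta> (k - 1)) (\<beta> k))"
    proof (intro prod.cong, simp, goal_cases)
      case (1 i)
      have "local_weight q s \<theta> u v h (i, j) = bit_weight q s (\<theta> i) (u j) (path_config \<gamma> i (j - 1)) (\<gamma> (i - 1) j) (\<gamma> i j)"
        if "j \<in> {1..y}" for j
        using that by (cases j) (auto simp: local_weight_def bit_weight_def v_def h_def)
      then have "(\<Prod>j\<in>{1..y}. local_weight q s \<theta> u v h (i, j)) =
          column_path_weight q s u (\<theta> i) 0 [1..<Suc y] (\<gamma> (i - 1)) (\<gamma> i)"
        using prod_column_weights[of q s "\<theta> i" u \<gamma> i 0 y] by (simp add: atLeastLessThanSuc_atLeastAtMost del: upt_Suc)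
      also have "\<dots> = column_path_weight q s u (\<theta> i) 0 [1..<Suc y] (\<beta> (i - 1)) (\<beta> i)"
        using True 1 by (intro column_path_weight_cong) (auto simp: \<gamma>_def)
      finally show ?case .
    qed
    finally have "(\<Prod>k\<in>{Suc 0..x}. column_path_weight q s u (\<theta> k) 0 [1..<Suc y] (\<beta> (k - 1)) (\<beta> k)) \<le>
        measure N (agree_on N V H R v h)" using ge by simp
    also have "\<dots> \<le> measure N {\<omega> \<in> space N. \<forall>k\<in>{0..x}. \<forall>j\<in>{1..y}. H \<omega> k j = of_bool (\<beta> k j)}"
    proof (rule N.finite_measure_mono)
      show "{\<omega> \<in> space N. \<forall>k\<in>{0..x}. \<forall>j\<in>{1..y}. H \<omega> k j = of_bool (\<beta> k j)} \<in> sets N"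
        using Hm by measurable
      show "agree_on N V H R v h \<subseteq> {\<omega> \<in> space N. \<forall>k\<in>{0..x}. \<forall>j\<in>{1..y}. H \<omega> k j = of_bool (\<beta> k j)}"
      proof clarify
        fix \<omega> assume \<omega>: "\<omega> \<in> agree_on N V H R v h"
        have "H \<omega> k j = of_bool (\<beta> k j)" if "k \<in> {0..x}" "j \<in> {1..y}" for k j
        proof (cases k)
          case 0
          then show ?thesis using hs \<omega> that True by (auto simp: stochastic_hs6v_def step_boundary_def agree_on_def)
        next
          case (Suc k')
          then have "(k, j) \<in> R" using that by (auto simp: R_def)
          then show ?thesis using \<omega> Suc by (auto simp: agree_on_def h_def \<gamma>_def)
        qed
        then show "\<omega> \<in> space N \<and> (\<forall>k\<in>{0..x}. \<forall>j\<in>{1..y}. H \<omega> k j = of_bool (\<beta> k j))"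
          using \<omega> by (auto simp: agree_on_def)
      qed
    qed
    finally show ?thesis using True by (auto simp del: upt_Suc)
  next
    case False
    then have "column_prob q s \<theta> 0 (map (\<lambda>j. (u j, \<beta> 0 j)) [1..<Suc y]) = 0" by (auto simp del: upt_Suc)
    then show ?thesis by simp
  qed
next
  case (Suc m)
  interpret N: prob_space N using hs by (simp add: stochastic_hs6v_def)
  have Hm: "(\<lambda>\<omega>. H \<omega> i j) \<in> N \<rightarrow>\<^sub>M count_space UNIV" for i j
    using hs by (auto simp: stochastic_hs6v_def)
  define js where "js = [1..<Suc y]"
  have js: "set js = {1..y}" "distinct js" by (auto simp: js_def)
  define W where "W k = column_path_weight q s u (\<theta> k) 0 js" for k
  define E where "E A = {\<omega> \<in> space N. \<forall>k\<in>{m..x}. \<forall>j\<in>{1..y}. H \<omega> k j = of_bool ((\<beta>(m := \<lambda>j. j \<notin> A)) k j)}" for A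
  have E_sets: "E A \<in> sets N" for A unfolding E_def using Hm by measurable
  have "column_prob q s \<theta> (Suc m) (map (\<lambda>j. (u j, \<beta> (Suc m) j)) js) * (\<Prod>k\<in>{Suc (Suc m)..x}. W k (\<beta> (k - 1)) (\<beta> k)) =
      (\<Sum>A\<in>Pow {1..y}. column_prob q s \<theta> m (map (\<lambda>j. (u j, j \<notin> A)) js) *
        (W (Suc m) (\<lambda>j. j \<notin> A) (\<beta> (Suc m)) * (\<Prod>k\<in>{Suc (Suc m)..x}. W k (\<beta> (k - 1)) (\<beta> k))))"
    unfolding column_prob.simps column_eq_sum_paths[OF js(2)] W_def js(1) sum_distrib_right by (simp add: mult_ac)
  \<comment> \<open>\<open>A\<close> is the set of rows without a path on the edges after column m;
    the induction hypothesis applies to the history that is prescribed there as well.\<close>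
  also have "\<dots> \<le> (\<Sum>A\<in>Pow {1..y}. measure N (E A))"
  proof (rule sum_mono)
    fix A
    define \<gamma> where "\<gamma> = \<beta>(m := \<lambda>j. j \<notin> A)"
    have "{Suc m..x} = insert (Suc m) {Suc (Suc m)..x}" using Suc.prems by auto
    then have "(\<Prod>k\<in>{Suc m..x}. W k (\<gamma> (k - 1)) (\<gamma> k)) =
        W (Suc m) (\<gamma> m) (\<gamma> (Suc m)) * (\<Prod>k\<in>{Suc (Suc m)..x}. W k (\<gamma> (k - 1)) (\<gamma> k))" by simp
    also have "(\<Prod>k\<in>{Suc (Suc m)..x}. W k (\<gamma> (k - 1)) (\<gamma> k)) = (\<Prod>k\<in>{Suc (Suc m)..x}. W k (\<beta> (k - 1)) (\<beta> k))"
      by (intro prod.cong refl) (auto simp: \<gamma>_def)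
    finally show "column_prob q s \<theta> m (map (\<lambda>j. (u j, j \<notin> A)) js) *
        (W (Suc m) (\<lambda>j. j \<notin> A) (\<beta> (Suc m)) * (\<Prod>k\<in>{Suc (Suc m)..x}. W k (\<beta> (k - 1)) (\<beta> k))) \<le> measure N (E A)"
      using Suc.IH[of \<gamma>] Suc.prems by (simp add: \<gamma>_def W_def js_def E_def del: upt_Suc)
  qed
  also have "\<dots> = measure N (\<Union>A\<in>Pow {1..y}. E A)"
  proof (rule N.finite_measure_finite_Union[symmetric])
    show "disjoint_family_on E (Pow {1..y})"
      by (rule disjoint_column_events[where S = "{1..y}" and X = "\<lambda>\<omega>. H \<omega> m"]) (use Suc.prems in \<open>auto simp: E_def\<close>)
  qed (use E_sets in auto)
  also have "\<dots> \<le> measure N {\<omega> \<in> space N. \<forall>k\<in>{Suc m..x}. \<forall>j\<in>{1..y}. H \<omega> k j = of_bool (\<beta> k j)}"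
  proof (rule N.finite_measure_mono)
    show "{\<omega> \<in> space N. \<forall>k\<in>{Suc m..x}. \<forall>j\<in>{1..y}. H \<omega> k j = of_bool (\<beta> k j)} \<in> sets N"
      using Hm by measurable
    show "(\<Union>A\<in>Pow {1..y}. E A) \<subseteq> {\<omega> \<in> space N. \<forall>k\<in>{Suc m..x}. \<forall>j\<in>{1..y}. H \<omega> k j = of_bool (\<beta> k j)}"
      by (auto simp: E_def)
  qed
  finally show ?case by (simp only: js_def W_def)
qed

lemma measure_height_ge:
  assumes hs: "stochastic_hs6v q s \<theta> u N V H"
    and nz: "\<And>i j. 1 \<le> i \<Longrightarrow> 1 \<le> j \<Longrightarrow> 1 + u j * \<theta> i \<noteq> 0" and k: "k \<le> y"
  shows "(\<Sum>J | J \<subseteq> {1..y} \<and> card J = k. column_prob q s \<theta> x (map (\<lambda>j. (u j, j \<notin> J)) [1..<Suc y])) \<le>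
    measure N {\<omega> \<in> space N. hs_height (H \<omega>) (x + 1) y = y - k}"
proof -
  interpret N: prob_space N using hs by (simp add: stochastic_hs6v_def)
  have Hm: "(\<lambda>\<omega>. H \<omega> i j) \<in> N \<rightarrow>\<^sub>M count_space UNIV" for i j
    using hs by (auto simp: stochastic_hs6v_def)
  define E where "E J = {\<omega> \<in> space N. \<forall>j\<in>{1..y}. H \<omega> x j = of_bool (j \<notin> J)}" for J
  have E_sets: "E J \<in> sets N" for J unfolding E_def using Hm by measurable
  have "(\<Sum>J | J \<subseteq> {1..y} \<and> card J = k. column_prob q s \<theta> x (map (\<lambda>j. (u j, j \<notin> J)) [1..<Suc y])) \<le>
      (\<Sum>J | J \<subseteq> {1..y} \<and> card J = k. measure N (E J))"
  proof (rule sum_mono)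
    fix J
    show "column_prob q s \<theta> x (map (\<lambda>j. (u j, j \<notin> J)) [1..<Suc y]) \<le> measure N (E J)"
      using measure_column_history_ge[OF hs nz order_refl[of x], of "\<lambda>_ j. j \<notin> J" y]
      by (simp add: E_def del: upt_Suc)
  qed
  also have "\<dots> = measure N (\<Union>J\<in>{J. J \<subseteq> {1..y} \<and> card J = k}. E J)"
  proof (rule N.finite_measure_finite_Union[symmetric])
    show "disjoint_family_on E {J. J \<subseteq> {1..y} \<and> card J = k}"
      by (rule disjoint_column_events[where S = "{1..y}" and X = "\<lambda>\<omega>. H \<omega> x"]) (auto simp: E_def)
  qed (use E_sets in auto)
  also have "\<dots> \<le> measure N {\<omega> \<in> space N. hs_height (H \<omega>) (x + 1) y = y - k}"
  proof (rule N.finite_measure_mono)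
    have "hs_height (H \<omega>) (x + 1) y = (\<Sum>j\<in>{1..y}. of_bool (H \<omega> x j > 0))" for \<omega>
      by (simp add: hs_height_def Int_def)
    moreover have "(\<lambda>\<omega>. \<Sum>j\<in>{1..y}. of_bool (H \<omega> x j > 0) :: nat) \<in> N \<rightarrow>\<^sub>M count_space UNIV"
      using Hm by measurable
    ultimately show "{\<omega> \<in> space N. hs_height (H \<omega>) (x + 1) y = y - k} \<in> sets N" by simp
    show "(\<Union>J\<in>{J. J \<subseteq> {1..y} \<and> card J = k}. E J) \<subseteq> {\<omega> \<in> space N. hs_height (H \<omega>) (x + 1) y = y - k}"
    proof clarify
      fix \<omega> J assume J: "\<omega> \<in> E J" "J \<subseteq> {1..y}" "k = card J"
      then have "{j \<in> {1..y}. H \<omega> x j > 0} = {1..y} - J" by (auto simp: E_def)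
      then show "\<omega> \<in> space N \<and> hs_height (H \<omega>) (x + 1) y = y - card J"
        using J by (auto simp: hs_height_def card_Diff_subset finite_subset E_def)
    qed
  qed
  finally show ?thesis .
qed

section \<open>Laws determined by lower bounds of total mass one\<close>

lemma measure_eq_if_ge:
  assumes "prob_space M" "X \<in> M \<rightarrow>\<^sub>M count_space UNIV" "finite S" "(\<Sum>z\<in>S. p z) = 1"
    and ge: "\<And>z. z \<in> S \<Longrightarrow> p z \<le> measure M {\<omega> \<in> space M. X \<omega> = z}"
  shows "measure M {\<omega> \<in> space M. X \<omega> = z} = (if z \<in> S then p z else 0)"
proof -
  interpret prob_space M by fact
  define E where "E z = {\<omega> \<in> space M. X \<omega> = z}" for z
  have E: "E z \<in> sets M" for z unfolding E_def using assms(2) by measurable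
  have tot: "(\<Sum>z\<in>T. measure M (E z)) \<le> 1" if "finite T" for T
  proof -
    have "(\<Sum>z\<in>T. measure M (E z)) = measure M (\<Union>z\<in>T. E z)"
      using that E by (intro finite_measure_finite_Union[symmetric]) (auto simp: disjoint_family_on_def E_def)
    then show ?thesis by simp
  qed
  have ge': "p z \<le> measure M (E z)" if "z \<in> S" for z using ge[OF that] by (simp add: E_def)
  show ?thesis
  proof (cases "z \<in> S")
    case True
    have "(\<Sum>z\<in>S - {z}. p z) \<le> (\<Sum>z\<in>S - {z}. measure M (E z))" using ge' by (intro sum_mono) auto
    moreover have "p z + (\<Sum>z\<in>S - {z}. p z) = 1" using assms(3,4) True by (simp add: sum.remove)
    moreover have "measure M (E z) + (\<Sum>z\<in>S - {z}. measure M (E z)) \<le> 1"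
      using tot[OF assms(3)] assms(3) True by (simp add: sum.remove)
    ultimately show ?thesis using ge'[OF True] True by (simp add: E_def)
  next
    case False
    have "1 \<le> (\<Sum>z\<in>S. measure M (E z))" unfolding assms(4)[symmetric] using ge' by (intro sum_mono)
    moreover have "measure M (E z) + (\<Sum>z\<in>S. measure M (E z)) \<le> 1"
      using tot[of "insert z S"] assms(3) False by simp
    ultimately have "measure M (E z) = 0" using measure_nonneg[of M "E z"] by linarith
    then show ?thesis using False by (simp add: E_def)
  qed
qed

lemma distr_eq_if_ge:
  fixes X :: "'a \<Rightarrow> 'c :: countable"
  assumes M: "prob_space M" "X \<in> M \<rightarrow>\<^sub>M count_space UNIV" and N: "prob_space N" "Y \<in> N \<rightarrow>\<^sub>M count_space UNIV"
    and S: "finite S" "(\<Sum>z\<in>S. p z) = 1"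
    and ge: "\<And>z. z \<in> S \<Longrightarrow> p z \<le> measure M {\<omega> \<in> space M. X \<omega> = z}"
      "\<And>z. z \<in> S \<Longrightarrow> p z \<le> measure N {\<omega> \<in> space N. Y \<omega> = z}"
  shows "distr M (count_space UNIV) X = distr N (count_space UNIV) Y"
proof (rule measure_eqI_countable[of _ UNIV])
  interpret M: prob_space M by fact
  interpret N: prob_space N by fact
  fix z
  have "measure M {\<omega> \<in> space M. X \<omega> = z} = measure N {\<omega> \<in> space N. Y \<omega> = z}"
    using measure_eq_if_ge[OF M S ge(1)] measure_eq_if_ge[OF N S ge(2)] by simp
  then show "emeasure (distr M (count_space UNIV) X) {z} = emeasure (distr N (count_space UNIV) Y) {z}"
    using M(2) N(2) by (simp add: emeasure_distr M.emeasure_eq_measure N.emeasure_eq_measure vimage_def Int_def conj_commute)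
qed auto

section \<open>The theorem\<close>

theorem theorem1p4:
  fixes q s :: real and \<theta> u :: "nat \<Rightarrow> real" and x y :: nat
    and M :: "'a measure" and \<Lambda> :: "'a \<Rightarrow> nat \<Rightarrow> nat"
    and N :: "'b measure" and V H :: "'b \<Rightarrow> nat \<Rightarrow> nat \<Rightarrow> nat"
  assumes "0 \<le> q" and "q < 1" and "- 1 < s" and "s < 0"
    and "\<And>i. i \<ge> 1 \<Longrightarrow> \<theta> i \<in> {- s .. - inverse s}"
    and "\<And>j. j \<ge> 1 \<Longrightarrow> u j \<in> {0 ..< 1}"
    and "stochastic_hs6v q s \<theta> u N V H"
    and "prob_space M"
    and "\<Lambda> \<in> M \<rightarrow>\<^sub>M count_space young_diagrams"
    and "\<And>\<nu>. \<nu> \<in> young_diagrams \<Longrightarrow>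
      measure M {\<omega> \<in> space M. \<Lambda> \<omega> = \<nu>} =
        (\<Prod>i=1..x. \<Prod>j=1..y. (1 - u j * s) / (1 + u j * \<theta> i)) *
        spin_HL q s \<nu> y u * dual_spin_qW q s (transposed \<nu>) x \<theta>"
  shows "distr M (count_space UNIV) (\<lambda>\<omega>. int y - int (ell (\<Lambda> \<omega>))) =
         distr N (count_space UNIV) (\<lambda>\<omega>. int (hs_height (H \<omega>) (x + 1) y))"
proof -
  interpret M: prob_space M by fact
  interpret N: prob_space N using assms(7) by (simp add: stochastic_hs6v_def)
  have Hm: "(\<lambda>\<omega>. H \<omega> i j) \<in> N \<rightarrow>\<^sub>M count_space UNIV" for i j
    using assms(7) by (auto simp: stochastic_hs6v_def)
  have us: "s < u j" if "1 \<le> j" for j using assms(4) assms(6)[OF that] by auto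
  have nz: "1 + u j * \<theta> i \<noteq> 0" if "1 \<le> i" "1 \<le> j" for i j
    using one_plus_mult_pos[OF assms(3,4) assms(5)[OF that(1)] us[OF that(2)]] by simp
  define Z where "Z k = (\<Sum>J | J \<subseteq> {1..y} \<and> card J = k.
    column_prob q s \<theta> x (map (\<lambda>j. (u j, j \<notin> J)) [1..<Suc y]))" for k
  define S where "S = (\<lambda>k. int y - int k) ` {..y}"
  define p where "p z = Z (nat (int y - z))" for z
  have inj: "inj_on (\<lambda>k. int y - int k) {..y}" by (auto simp: inj_on_def)
  show ?thesis
  proof (rule distr_eq_if_ge[where S = S and p = p])
    show "prob_space M" "prob_space N" by unfold_locales
    show "(\<lambda>\<omega>. int y - int (ell (\<Lambda> \<omega>))) \<in> M \<rightarrow>\<^sub>M count_space UNIV"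
      by (rule measurable_compose[OF assms(9)]) simp
    have "hs_height (H \<omega>) (x + 1) y = (\<Sum>j\<in>{1..y}. of_bool (H \<omega> x j > 0))" for \<omega>
      by (simp add: hs_height_def Int_def)
    moreover have "(\<lambda>\<omega>. int (\<Sum>j\<in>{1..y}. of_bool (H \<omega> x j > 0))) \<in> N \<rightarrow>\<^sub>M count_space UNIV"
      using Hm by measurable
    ultimately show "(\<lambda>\<omega>. int (hs_height (H \<omega>) (x + 1) y)) \<in> N \<rightarrow>\<^sub>M count_space UNIV" by simp
    show "finite S" by (simp add: S_def)
    \<comment> \<open>The total mass is computed in the vertex model. It forces equality in the
      lower bounds on the side of the diagrams, too.\<close>
    have "(\<Sum>z\<in>S. p z) = (\<Sum>k\<le>y. Z k)"
      unfolding S_def by (subst sum.reindex[OF inj]) (simp add: p_def)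
    also have "\<dots> = (\<Sum>J\<in>Pow {1..y}. column_prob q s \<theta> x (map (\<lambda>j. (u j, j \<notin> J)) [1..<Suc y]))"
      unfolding Z_def by (subst sum_Pow_card) (simp_all del: upt_Suc)
    also have "\<dots> = 1"
      using sum_column_prob[of "[1..<Suc y]" u \<theta> q s x] nz by (simp add: atLeastLessThanSuc_atLeastAtMost del: upt_Suc)
    finally show "(\<Sum>z\<in>S. p z) = 1" .
  next
    fix z assume "z \<in> S"
    then obtain k where k: "k \<le> y" "z = int y - int k" by (auto simp: S_def)
    then have pz: "p z = Z k" by (simp add: p_def)
    have "int (hs_height (H \<omega>) (x + 1) y) = z \<longleftrightarrow> hs_height (H \<omega>) (x + 1) y = y - k" for \<omega>
      using k by auto
    then show "p z \<le> measure N {\<omega> \<in> space N. int (hs_height (H \<omega>) (x + 1) y) = z}"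
      using measure_height_ge[OF assms(7) nz k(1), of x] by (simp add: pz Z_def del: upt_Suc)
    define D where "D = {lam. lam \<in> diagrams x y \<and> lam 0 = k}"
    define E where "E lam = {\<omega> \<in> space M. \<Lambda> \<omega> = transposed lam}" for lam
    have D: "finite D" "\<And>lam. lam \<in> D \<Longrightarrow> lam \<in> young_diagrams \<and> lam 0 = k"
      using finite_subset[OF _ finite_diagrams[of x y], of D] by (auto simp: D_def diagrams_def)
    have E_sets: "E lam \<in> sets M" if "lam \<in> D" for lam
    proof -
      have "\<Lambda> -` {transposed lam} \<inter> space M \<in> sets M"
        using D(2)[OF that] by (intro measurable_sets[OF assms(9)]) (simp add: transposed_young)
      also have "\<Lambda> -` {transposed lam} \<inter> space M = E lam" by (auto simp: E_def)
      finally show ?thesis .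
    qed
    \<comment> \<open>Only the diagrams with parts at most x are counted. As a lower bound is asked
      for, nothing needs to be said about the others.\<close>
    have "p z = (\<Sum>lam\<in>D. (\<Prod>i=1..x. \<Prod>j=1..y. (1 - u j * s) / (1 + u j * \<theta> i)) *
      spin_HL q s (transposed lam) y u * dual_spin_qW q s lam x \<theta>)"
      unfolding pz Z_def D_def using us by (intro length_law[symmetric] assms k) auto
    also have "\<dots> = (\<Sum>lam\<in>D. measure M (E lam))"
      using D(2) by (intro sum.cong refl) (simp add: E_def assms(10) transposed_young transposed_transposed)
    also have "\<dots> = measure M (\<Union>lam\<in>D. E lam)"
    proof (rule M.finite_measure_finite_Union[symmetric])
      show "disjoint_family_on E D"
        unfolding disjoint_family_on_def
      proof (intro ballI impI)
        fix lam mu assume "lam \<in> D" "mu \<in> D" "lam \<noteq> mu"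
        then have "transposed lam \<noteq> transposed mu"
          using D(2) transposed_transposed by metis
        then show "E lam \<inter> E mu = {}" by (auto simp: E_def)
      qed
    qed (use D E_sets in auto)
    also have "\<dots> \<le> measure M {\<omega> \<in> space M. int y - int (ell (\<Lambda> \<omega>)) = z}"
    proof (rule M.finite_measure_mono)
      have "(\<lambda>\<omega>. int y - int (ell (\<Lambda> \<omega>))) \<in> M \<rightarrow>\<^sub>M count_space UNIV"
        by (rule measurable_compose[OF assms(9)]) simp
      then show "{\<omega> \<in> space M. int y - int (ell (\<Lambda> \<omega>)) = z} \<in> sets M" by measurable
      show "(\<Union>lam\<in>D. E lam) \<subseteq> {\<omega> \<in> space M. int y - int (ell (\<Lambda> \<omega>)) = z}"
        using D(2) by (auto simp: E_def ell_transposed k(2))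
    qed
    finally show "p z \<le> measure M {\<omega> \<in> space M. int y - int (ell (\<Lambda> \<omega>)) = z}" .
  qed
qed

end
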